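(* Let $N\in\mathbb N$ and let $\omega$ be an admissible radial measure on $\overline{\mathbb B_d}$. Let $\varphi,\psi\in\mathrm{Mult}(B^N_\omega)$ with $\psi$ not identically zero. Then $\varphi\in\mathrm{Rad}(\psi)$ if and only if there is $n\in\mathbb N$ such that $\varphi^n/\psi\in H^\infty(\mathbb B_d)$.
   Context: $\mathbb N=\{1,2,\dots\}$, $d\in\mathbb N$, $\mathbb B_d$ is the open unit ball of $\mathbb C^d$, $\sigma$ is the normalized rotationally invariant measure on $\partial\mathbb B_d$, $\mathrm{Hol}(\mathbb B_d)$ is the set of analytic functions on $\mathbb B_d$, and $H^\infty(\mathbb B_d)$ is the set of bounded ones. An admissible radial measure $\omega$ on $\overline{\mathbb B_d}$ is one of the form $d\omega(z)=d\mu(r)\,d\sigma(w)$, $z=rw$ (i.e. the image of $\mu\times\sigma$ under $(r,w)\mapsto rw$), where $\mu$ is a finite Borel measure on $[0,1]$ with $\mu((r,1])>0$ for all $0<r<1$. For analytic $f$ put $\|f\|^2_{L^2(\omega)}=\int_{\mathbb B_d}|f|^2d\omega+\mu(\{1\})\|f\|^2_{H^2(\partial\mathbb B_d)}$, where $\|f\|^2_{H^2(\partial\mathbb B_d)}=\sup_{0<r<1}\int_{\partial\mathbb B_d}|f(rw)|^2d\sigma(w)$ and the second term is omitted if $\mu(\{1\})=0$. Let $R=\sum_{j=1}^d z_j\frac{\partial}{\partial z_j}$. The radially weighted Besov space is $B^N_\omega=\{f\in\mathrm{Hol}(\mathbb B_d):\|R^Nf\|_{L^2(\omega)}<\infty\}$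 with $\|f\|^2_{B^N_\omega}=\mu([0,1])|f(0)|^2+\|R^Nf\|^2_{L^2(\omega)}$ for $N\ge1$. $\mathrm{Mult}(B^N_\omega)=\{\varphi:\varphi f\in B^N_\omega\text{ for all }f\in B^N_\omega\}$. For $\psi\in\mathrm{Mult}(B^N_\omega)$, $\mathrm{Rad}(\psi)=\{\varphi\in\mathrm{Mult}(B^N_\omega):\varphi^n=u\psi\text{ for some }u\in\mathrm{Mult}(B^N_\omega),\ n\in\mathbb N\}$. The notation $\varphi^n/\psi\in H^\infty(\mathbb B_d)$ means that $\varphi^n=h\psi$ for some $h\in H^\infty(\mathbb B_d)$. *)

theory Defs
  imports "HOL-Analysis.Analysis"
begin

text \<open>
  The space \<open>\<complex>\<^sup>d\<close> is \<^typ>\<open>complex ^ 'd\<close>; its library norm is the Euclidean one, so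
  \<open>ball 0 1\<close> is the open unit ball and \<open>sphere 0 1\<close> its boundary. Functions on the ball are
  total functions whose values off the ball play no role: all conditions and all identities
  between functions below are restricted to \<open>ball 0 1\<close>.
\<close>

definition holomorphic_ball :: "(complex ^ 'd \<Rightarrow> complex) \<Rightarrow> bool" where
  "holomorphic_ball f \<longleftrightarrow>
     (\<forall>z\<in>ball 0 1. \<exists>D. (f has_derivative D) (at z) \<and> (\<forall>c v. D (c *s v) = c * D v))"

definition bounded_holomorphic_ball :: "(complex ^ 'd \<Rightarrow> complex) \<Rightarrow> bool" where
  "bounded_holomorphic_ball h \<longleftrightarrow> holomorphic_ball h \<and> bounded (h ` ball 0 1)"

definition partial_deriv :: "'d \<Rightarrow> (complex ^ 'd \<Rightarrow> complex) \<Rightarrow> complex ^ 'd \<Rightarrow> complex" where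
  "partial_deriv j f z = deriv (\<lambda>t. f (z + t *s axis j 1)) 0"

definition radial_deriv :: "(complex ^ 'd \<Rightarrow> complex) \<Rightarrow> complex ^ 'd \<Rightarrow> complex" where
  "radial_deriv f z = (\<Sum>j\<in>UNIV. z $ j * partial_deriv j f z)"

text \<open>
  The normalized rotationally invariant measure on the sphere, given by the properties that
  determine it uniquely. Rotations are the orthogonal maps of the underlying real Euclidean
  space, which include the unitary maps.
\<close>

definition rotation_invariant_sphere_measure :: "(complex ^ 'd) measure \<Rightarrow> bool" where
  "rotation_invariant_sphere_measure \<sigma> \<longleftrightarrow>
     sets \<sigma> = sets (restrict_space borel (sphere 0 1)) \<and>
     emeasure \<sigma> (sphere 0 1) = 1 \<and>
     (\<forall>U. orthogonal_transformation U \<longrightarrow> distr \<sigma> \<sigma> U = \<sigma>)"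

definition admissible_radial_part :: "real measure \<Rightarrow> bool" where
  "admissible_radial_part \<mu> \<longleftrightarrow>
     sets \<mu> = sets (restrict_space borel {0..1}) \<and> finite_measure \<mu> \<and>
     (\<forall>r. 0 < r \<and> r < 1 \<longrightarrow> emeasure \<mu> {r<..1} > 0)"

definition radial_measure ::
    "real measure \<Rightarrow> (complex ^ 'd) measure \<Rightarrow> (complex ^ 'd) measure" where
  "radial_measure \<mu> \<sigma> =
     distr (\<mu> \<Otimes>\<^sub>M \<sigma>) (restrict_space borel (cball 0 1)) (\<lambda>(r, w). r *\<^sub>R w)"

definition hardy_norm_sq :: "(complex ^ 'd) measure \<Rightarrow> (complex ^ 'd \<Rightarrow> complex) \<Rightarrow> ennreal" where
  "hardy_norm_sq \<sigma> f =
     (SUP r\<in>{0<..<1::real}. \<integral>\<^sup>+ w. ennreal ((cmod (f (r *\<^sub>R w)))\<^sup>2) \<partial>\<sigma>)"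

text \<open>
  As \<open>0 * \<infinity> = 0\<close> in \<^typ>\<open>ennreal\<close>, the Hardy space term disappears if \<open>\<mu> {1} = 0\<close>.
\<close>

definition L2_norm_sq ::
    "real measure \<Rightarrow> (complex ^ 'd) measure \<Rightarrow> (complex ^ 'd \<Rightarrow> complex) \<Rightarrow> ennreal" where
  "L2_norm_sq \<mu> \<sigma> f =
     (\<integral>\<^sup>+ z\<in>ball 0 1. ennreal ((cmod (f z))\<^sup>2) \<partial>radial_measure \<mu> \<sigma>)
     + emeasure \<mu> {1} * hardy_norm_sq \<sigma> f"

definition besov_space ::
    "real measure \<Rightarrow> (complex ^ 'd) measure \<Rightarrow> nat \<Rightarrow> (complex ^ 'd \<Rightarrow> complex) set" where
  "besov_space \<mu> \<sigma> N =
     {f. holomorphic_ball f \<and> L2_norm_sq \<mu> \<sigma> ((radial_deriv ^^ N) f) < \<infinity>}"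

definition besov_mult ::
    "real measure \<Rightarrow> (complex ^ 'd) measure \<Rightarrow> nat \<Rightarrow> (complex ^ 'd \<Rightarrow> complex) set" where
  "besov_mult \<mu> \<sigma> N =
     {\<phi>. \<forall>f\<in>besov_space \<mu> \<sigma> N. (\<lambda>z. \<phi> z * f z) \<in> besov_space \<mu> \<sigma> N}"

definition besov_rad ::
    "real measure \<Rightarrow> (complex ^ 'd) measure \<Rightarrow> nat \<Rightarrow> (complex ^ 'd \<Rightarrow> complex)
      \<Rightarrow> (complex ^ 'd \<Rightarrow> complex) set" where
  "besov_rad \<mu> \<sigma> N \<psi> =
     {\<phi> \<in> besov_mult \<mu> \<sigma> N.
        \<exists>u\<in>besov_mult \<mu> \<sigma> N. \<exists>n::nat. n \<ge> 1 \<and> (\<forall>z\<in>ball 0 1. \<phi> z ^ n = u z * \<psi> z)}"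

end

theory Submission
  imports Defs "HOL-Complex_Analysis.Complex_Analysis"
begin

text \<open>
  The statement has an easy algebraic core that rests on two facts about multipliers.

  \<^emph>\<open>Core.\<close> Let \<open>\<Phi> = h \<psi>\<close> with \<open>h\<close> bounded. Applying \<open>R\<close> and multiplying by \<open>h\<close> gives
  \<open>\<Phi> R h = h (R \<Phi> - h R \<psi>)\<close>: a derivative that falls on \<open>h\<close> costs one factor \<open>\<Phi>\<close> and leaves only
  derivatives of multipliers behind. If \<open>\<Phi>\<close> and \<open>\<psi>\<close> multiply the spaces of all orders \<open>k \<le> N\<close>, then induction on \<open>k\<close> shows that \<open>h\<^sup>a \<Phi>\<^sup>k\<close> maps the
  space of order \<open>k\<close> into itself for every \<open>a\<close> (\<open>besov_quotient_power_mult\<close>). The induction starts in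
  the \<open>L\<^sup>2\<close> space of order \<open>0\<close>, which bounded functions multiply. For \<open>\<Phi> = \<phi>\<^sup>n\<close> the function
  \<open>u = h \<Phi>\<^sup>N\<close> is then a multiplier of order \<open>N\<close>, and \<open>u \<psi> = \<Phi>\<^sup>N\<^sup>+\<^sup>1\<close> is a power of \<open>\<phi>\<close>.

  What remains is that multipliers of order \<open>N\<close> are bounded, which also gives the direction
  from the radical to \<open>H\<^sup>\<infinity>\<close>, and that they are multipliers of every order \<open>k \<le> N\<close>.

  \<^emph>\<open>Coordinates.\<close> Multiplication by a unimodular scalar is a rotation and acts on the homogeneous
  component \<open>f\<^sub>n\<close> of \<open>f\<close> by its \<open>n\<close>-th power. So the components are orthogonal in \<open>L\<^sup>2(\<sigma>)\<close>, and the
  square of the norm of order \<open>k\<close> is equivalent to the sum of \<open>(n + 1)\<^sup>2\<^sup>k m\<^sub>n \<parallel>f\<^sub>n\<parallel>\<^sup>2\<close>, where \<open>m\<^sub>n\<close> is the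
  moment of order \<open>2 n\<close> of \<open>\<mu>\<close> (\<open>L2_norm_sq_eq\<close>, \<open>besov_space_iff\<close>).

  \<^emph>\<open>Boundedness.\<close> A gliding hump argument in the Frechet space whose topology is given by the Besov
  norm together with the suprema over smaller balls shows that multiplication by \<open>\<phi>\<close> is continuous
  (\<open>besov_mult_frechet_bounded\<close>). The suprema are included because with them completeness is
  immediate: a limit is taken locally uniformly and is holomorphic. Consequently the norms of the powers
  \<open>\<phi>\<^sup>j\<close> grow at most geometrically in \<open>j\<close>, and so do their mean squares over a sphere. As nonempty
  open subsets of the sphere have positive measure, \<open>\<phi>\<close> is bounded (\<open>besov_mult_bounded\<close>).

  \<^emph>\<open>Lower orders.\<close> Multiplication by \<open>\<phi>\<close> is continuous in the orders \<open>0\<close> and \<open>N\<close>. To interpolate,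
  split \<open>f\<close> for each \<open>m\<close> into its Taylor polynomial of degree below \<open>m\<close>, treated in order \<open>N\<close>, and
  the remainder, treated in order \<open>0\<close>. This bounds the tail of \<open>\<phi> f\<close> from degree \<open>m\<close> on, and the
  sum of these bounds with weights of size \<open>m\<^sup>2\<^sup>k\<^sup>-\<^sup>1\<close> is the estimate of order \<open>k\<close>
  (\<open>weighted_sum_interpolation\<close>, \<open>besov_mult_interpolation\<close>). It is a discrete form of the real
  interpolation method with the suprema of the Taylor polynomials as a harmless extra term.
\<close>

section \<open>Holomorphic functions on the ball\<close>

lemma norm_vec_scalar: "norm (c *s v) = cmod c * norm (v :: complex ^ 'd)"
  by (simp add: norm_vec_def norm_mult L2_set_right_distrib)

lemma bounded_linear_vec_scalar: "bounded_linear (\<lambda>t. t *s (v :: complex ^ 'd))"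
  by (rule bounded_linear_intro[where K = "norm v"])
     (auto simp: norm_vec_scalar vec_eq_iff algebra_simps)

lemma scaleR_eq_vec_scalar: "r *\<^sub>R v = of_real r *s (v :: complex ^ 'd)"
  unfolding vec_eq_iff by (simp add: vector_scaleR_component) (simp add: scaleR_conv_of_real)

lemma has_derivative_slice:
  assumes "(f has_derivative D) (at (z + t *s v))" "\<forall>c v. D (c *s v) = c * D v"
  shows "((\<lambda>t. f (z + t *s (v :: complex ^ 'd))) has_field_derivative D v) (at t)"
proof -
  have "((\<lambda>t. z + t *s v) has_derivative (\<lambda>t. t *s v)) (at t)"
    using bounded_linear_imp_has_derivative[OF bounded_linear_vec_scalar]
    by (auto intro!: derivative_eq_intros)
  from diff_chain_at[OF this assms(1)]
  have "((\<lambda>t. f (z + t *s v)) has_derivative (\<lambda>t. D (t *s v))) (at t)" by (simp only: o_def)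
  moreover have "(\<lambda>t. D (t *s v)) = (*) (D v)"
    using assms(2) by (intro ext) (simp add: mult.commute)
  ultimately show ?thesis by (simp only: has_field_derivative_def)
qed

lemma holomorphic_ball_cong:
  assumes "\<And>z. z \<in> ball 0 1 \<Longrightarrow> f z = g z" "holomorphic_ball (f :: complex ^ 'd \<Rightarrow> complex)"
  shows "holomorphic_ball g"
  unfolding holomorphic_ball_def
proof
  fix z :: "complex ^ 'd" assume z: "z \<in> ball 0 1"
  then obtain D where D: "(f has_derivative D) (at z)" "\<forall>c v. D (c *s v) = c * D v"
    using assms(2) unfolding holomorphic_ball_def by blast
  have "(g has_derivative D) (at z)"
    using has_derivative_transform_within_open[OF D(1), of "ball 0 1" g] z assms(1) by auto
  with D(2) show "\<exists>D. (g has_derivative D) (at z) \<and> (\<forall>c v. D (c *s v) = c * D v)" by blast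
qed

lemma holomorphic_ball_const [simp, intro]: "holomorphic_ball (\<lambda>_. c)"
  unfolding holomorphic_ball_def by (auto intro!: exI[of _ "\<lambda>_. 0"])

lemma holomorphic_ball_add [intro]:
  assumes "holomorphic_ball (f :: complex ^ 'd \<Rightarrow> complex)" "holomorphic_ball g"
  shows "holomorphic_ball (\<lambda>z. f z + g z)"
  unfolding holomorphic_ball_def
proof
  fix z :: "complex ^ 'd" assume z: "z \<in> ball 0 1"
  obtain D where D: "(f has_derivative D) (at z)" "\<forall>c v. D (c *s v) = c * D v"
    using assms(1) z unfolding holomorphic_ball_def by blast
  obtain E where E: "(g has_derivative E) (at z)" "\<forall>c v. E (c *s v) = c * E v"
    using assms(2) z unfolding holomorphic_ball_def by blast
  have "((\<lambda>z. f z + g z) has_derivative (\<lambda>v. D v + E v)) (at z)"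
    using D(1) E(1) by (rule has_derivative_add)
  with D(2) E(2) show "\<exists>D. ((\<lambda>z. f z + g z) has_derivative D) (at z) \<and> (\<forall>c v. D (c *s v) = c * D v)"
    by (intro exI[of _ "\<lambda>v. D v + E v"]) (simp add: algebra_simps)
qed

lemma holomorphic_ball_mult [intro]:
  assumes "holomorphic_ball (f :: complex ^ 'd \<Rightarrow> complex)" "holomorphic_ball g"
  shows "holomorphic_ball (\<lambda>z. f z * g z)"
  unfolding holomorphic_ball_def
proof
  fix z :: "complex ^ 'd" assume z: "z \<in> ball 0 1"
  obtain D where D: "(f has_derivative D) (at z)" "\<forall>c v. D (c *s v) = c * D v"
    using assms(1) z unfolding holomorphic_ball_def by blast
  obtain E where E: "(g has_derivative E) (at z)" "\<forall>c v. E (c *s v) = c * E v"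
    using assms(2) z unfolding holomorphic_ball_def by blast
  have "((\<lambda>z. f z * g z) has_derivative (\<lambda>v. f z * E v + D v * g z)) (at z)"
    using D(1) E(1) by (rule has_derivative_mult)
  with D(2) E(2) show "\<exists>D. ((\<lambda>z. f z * g z) has_derivative D) (at z) \<and> (\<forall>c v. D (c *s v) = c * D v)"
    by (intro exI[of _ "\<lambda>v. f z * E v + D v * g z"]) (simp add: algebra_simps)
qed

lemma holomorphic_ball_cmult [intro]:
  "holomorphic_ball f \<Longrightarrow> holomorphic_ball (\<lambda>z. c * f z)"
  by (intro holomorphic_ball_mult holomorphic_ball_const)

lemma holomorphic_ball_diff [intro]:
  assumes "holomorphic_ball (f :: complex ^ 'd \<Rightarrow> complex)" "holomorphic_ball g"
  shows "holomorphic_ball (\<lambda>z. f z - g z)"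
  using holomorphic_ball_add[OF assms(1) holomorphic_ball_cmult[OF assms(2), of "-1"]] by simp

lemma holomorphic_ball_sum [intro]:
  "(\<And>i. i \<in> I \<Longrightarrow> holomorphic_ball (f i)) \<Longrightarrow> holomorphic_ball (\<lambda>z. \<Sum>i\<in>I. f i z)"
  by (induction I rule: infinite_finite_induct) auto

lemma holomorphic_ball_power [intro]:
  "holomorphic_ball f \<Longrightarrow> holomorphic_ball (\<lambda>z. f z ^ n)"
  by (induction n) auto

lemma holomorphic_ball_dilate:
  assumes "holomorphic_ball (f :: complex ^ 'd \<Rightarrow> complex)" "cmod c \<le> 1"
  shows "holomorphic_ball (\<lambda>z. f (c *s z))"
  unfolding holomorphic_ball_def
proof
  fix z :: "complex ^ 'd" assume z: "z \<in> ball 0 1"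
  have "norm (c *s z) < 1"
    using z assms(2) by (simp add: norm_vec_scalar) 
       (metis mult_left_le_one_le norm_ge_zero order_le_less_trans)
  then obtain D where D: "(f has_derivative D) (at (c *s z))" "\<forall>c v. D (c *s v) = c * D v"
    using assms(1) unfolding holomorphic_ball_def by (metis mem_ball_0)
  have "bounded_linear (\<lambda>z::complex^'d. c *s z)"
    by (rule bounded_linear_intro[where K = "cmod c"])
       (auto simp: norm_vec_scalar vec_eq_iff algebra_simps)
  from diff_chain_at[OF bounded_linear_imp_has_derivative[OF this] D(1)]
  have "((\<lambda>z. f (c *s z)) has_derivative (\<lambda>v. D (c *s v))) (at z)" by (simp add: o_def)
  with D(2) show "\<exists>D. ((\<lambda>z. f (c *s z)) has_derivative D) (at z) \<and> (\<forall>c v. D (c *s v) = c * D v)"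
    by (intro exI[of _ "\<lambda>v. D (c *s v)"]) simp
qed

lemma holomorphic_ball_continuous:
  "holomorphic_ball f \<Longrightarrow> continuous_on (ball 0 1) f"
  unfolding holomorphic_ball_def
  by (metis continuous_at_imp_continuous_on has_derivative_continuous)

lemma holomorphic_ball_bounded_cball:
  assumes "holomorphic_ball (f :: complex ^ 'd \<Rightarrow> complex)" "r < 1"
  obtains M where "M \<ge> 1" "\<And>z. norm z \<le> r \<Longrightarrow> cmod (f z) \<le> M"
proof -
  have "compact (f ` cball 0 r)"
    by (intro compact_continuous_image continuous_on_subset[OF holomorphic_ball_continuous[OF assms(1)]])
       (use assms(2) in auto)
  then obtain M where "\<forall>x\<in>f ` cball 0 r. norm x \<le> M"
    using compact_imp_bounded bounded_iff by blast
  then show ?thesis by (intro that[of "max M 1"]) (auto simp: le_max_iff_disj)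
qed

lemma slice_holomorphic:
  assumes "holomorphic_ball f" "\<And>t. t \<in> S \<Longrightarrow> norm (z + t *s v) < 1"
  shows "(\<lambda>t. f (z + t *s v)) holomorphic_on S"
  unfolding holomorphic_on_def
proof
  fix t assume "t \<in> S"
  then obtain D where "(f has_derivative D) (at (z + t *s v))" "\<forall>c v. D (c *s v) = c * D v"
    using assms unfolding holomorphic_ball_def by fastforce
  from has_derivative_slice[OF this] show "(\<lambda>t. f (z + t *s v)) field_differentiable at t within S"
    by (metis field_differentiable_at_within field_differentiable_def)
qed

lemma slice0_holomorphic:
  assumes "holomorphic_ball f" "\<And>t. t \<in> S \<Longrightarrow> norm (t *s v) < 1"
  shows "(\<lambda>t. f (t *s v)) holomorphic_on S"
  using slice_holomorphic[of f S 0 v] assms by simp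

text \<open>
  Cauchy's inequality for the first derivative of the slice of \<open>f\<close> in the direction of \<open>v\<close>.
\<close>

lemma Cauchy_estimate_derivative:
  assumes f: "holomorphic_ball f" and D: "(f has_derivative D) (at x)" "\<forall>c v. D (c *s v) = c * D v"
    and x: "norm x + \<rho> < 1" "\<rho> > 0" and s: "\<And>y. norm (y - x) \<le> \<rho> \<Longrightarrow> cmod (f y) \<le> s"
  shows "cmod (D v) \<le> s / \<rho> * norm v"
proof (cases "v = 0")
  case True
  have "D v = 0" using D(2)[rule_format, of 0 v] True by simp
  then show ?thesis by (simp add: True)
next
  case False
  define r where "r = \<rho> / norm v"
  have r: "r > 0" using False x by (simp add: r_def)
  have n: "norm (t *s v) \<le> \<rho>" if "cmod t \<le> r" for t
    using that False by (simp add: norm_vec_scalar r_def field_simps)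
  have n1: "norm (x + t *s v) < 1" if "cmod t \<le> r" for t
    using norm_triangle_ineq[of x "t *s v"] n[OF that] x(1) by linarith
  have h: "(\<lambda>t. f (x + t *s v)) holomorphic_on cball 0 r"
    by (rule slice_holomorphic[OF f]) (use n1 in auto)
  have d: "deriv (\<lambda>t. f (x + t *s v)) 0 = D v"
    by (rule DERIV_imp_deriv, rule has_derivative_slice) (use D in auto)
  have "cmod ((deriv ^^ 1) (\<lambda>t. f (x + t *s v)) 0) \<le> fact 1 * s / r ^ 1"
  proof (rule Cauchy_inequality)
    show "(\<lambda>t. f (x + t *s v)) holomorphic_on ball 0 r"
      using h by (rule holomorphic_on_subset) auto
    show "continuous_on (cball 0 r) (\<lambda>t. f (x + t *s v))"
      using h by (rule holomorphic_on_imp_continuous_on)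
    show "cmod (f (x + t *s v)) \<le> s" if "cmod (0 - t) = r" for t
      by (rule s) (use n[of t] that in simp)
  qed (use r in auto)
  then show ?thesis using d by (simp add: r_def)
qed

text \<open>
  Weierstrass' theorem in several variables. Cauchy estimates turn locally uniform convergence of the
  functions into locally uniform convergence of their derivatives, and complex homogeneity of the
  derivatives passes to the limit. Membership in \<^const>\<open>holomorphic_ball\<close> of every function that is not
  given by an algebraic formula comes from here: homogeneous components, radial derivatives, and the
  limit of the gliding hump.
\<close>

lemma holomorphic_ball_limit:
  fixes F :: "nat \<Rightarrow> complex ^ 'd \<Rightarrow> complex"
  assumes F: "\<And>n. holomorphic_ball (F n)"
    and lim: "\<And>r. r < 1 \<Longrightarrow> uniform_limit (cball 0 r) F f sequentially"
  shows "holomorphic_ball f"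
  unfolding holomorphic_ball_def
proof
  fix z :: "complex ^ 'd" assume z: "z \<in> ball 0 1"
  define D where "D n x = (SOME D. (F n has_derivative D) (at x) \<and> (\<forall>c v. D (c *s v) = c * D v))" for n x
  have D: "(F n has_derivative D n x) (at x)" "D n x (c *s v) = c * D n x v" if "norm x < 1" for n x c v
  proof -
    have "\<exists>D. (F n has_derivative D) (at x) \<and> (\<forall>c v. D (c *s v) = c * D v)"
      using F[of n] that unfolding holomorphic_ball_def by auto
    from someI_ex[OF this] show "(F n has_derivative D n x) (at x)" "D n x (c *s v) = c * D n x v"
      unfolding D_def by blast+
  qed
  define \<rho> where "\<rho> = (1 - norm z) / 3"
  have \<rho>: "\<rho> > 0" "norm z + 2 * \<rho> < 1" using z by (auto simp: \<rho>_def field_simps)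
  define S where "S = ball z \<rho>"
  have S: "norm x + \<rho> < 1" if "x \<in> S" for x
    using that \<rho> norm_triangle_sub[of x z] by (auto simp: S_def dist_norm norm_minus_commute)
  have S1: "norm x < 1" if "x \<in> S" for x using S[OF that] \<rho> by linarith
  define r where "r = norm z + 2 * \<rho>"
  have r: "r < 1" using \<rho> by (simp add: r_def)
  have Cau: "cmod (D n x h - D m x h) \<le> e * norm h"
    if x: "x \<in> S" and e: "\<And>y. norm y \<le> r \<Longrightarrow> cmod (F n y - F m y) \<le> e * \<rho>" for n m x h e
  proof -
    have *: "holomorphic_ball (\<lambda>y. F n y - F m y)" by (intro holomorphic_ball_diff F)
    have "cmod (D n x h - D m x h) \<le> (e * \<rho>) / \<rho> * norm h"
    proof (rule Cauchy_estimate_derivative[OF * has_derivative_diff[OF D(1) D(1)]])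
      show "cmod (F n y - F m y) \<le> e * \<rho>" if "norm (y - x) \<le> \<rho>" for y
      proof (rule e)
        have "norm (x - z) < \<rho>" using x by (simp add: S_def dist_norm norm_minus_commute)
        then show "norm y \<le> r"
          using that norm_triangle_sub[of y x] norm_triangle_sub[of x z] by (simp add: r_def)
      qed
    qed (use S1[OF x] S[OF x] \<rho> D(2)[OF S1[OF x]] in \<open>auto simp: algebra_simps\<close>)
    then show ?thesis using \<rho> by simp
  qed
  have ucau: "\<exists>M. \<forall>m\<ge>M. \<forall>n\<ge>M. \<forall>x\<in>S. \<forall>h. cmod (D n x h - D m x h) \<le> e * norm h" if "e > 0" for e
  proof -
    have "uniformly_Cauchy_on (cball 0 r) F"
      using lim[OF r] by (simp add: uniformly_convergent_Cauchy uniformly_convergent_on_def exI)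
    then obtain M where "\<forall>x\<in>cball 0 r. \<forall>m\<ge>M. \<forall>n\<ge>M. dist (F m x) (F n x) < e * \<rho>"
      using \<open>e > 0\<close> \<rho>(1) unfolding uniformly_Cauchy_on_def by (metis mult_pos_pos)
    then show ?thesis
      by (intro exI[of _ M]) (auto intro!: Cau simp: dist_norm intro: less_imp_le)
  qed
  define G where "G x h = lim (\<lambda>n. D n x h)" for x h
  have conv: "(\<lambda>n. D n x h) \<longlonglongrightarrow> G x h" if x: "x \<in> S" for x h
  proof -
    have "Cauchy (\<lambda>n. D n x h)"
    proof (rule metric_CauchyI)
      fix e :: real assume "e > 0"
      then have "e / (norm h + 1) > 0" by (simp add: add_nonneg_pos)
      from ucau[OF this] obtain M where M: "\<And>m n. m \<ge> M \<Longrightarrow> n \<ge> M \<Longrightarrow> cmod (D n x h - D m x h) \<le> e / (norm h + 1) * norm h"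
        using x by meson
      have "e / (norm h + 1) * norm h < e" using \<open>e > 0\<close>
        by (simp add: divide_less_eq add_nonneg_pos)
      then show "\<exists>M. \<forall>m\<ge>M. \<forall>n\<ge>M. dist (D m x h) (D n x h) < e"
        using M unfolding dist_norm by (meson order_le_less_trans)
    qed
    then show ?thesis unfolding G_def by (rule convergent_LIMSEQ_iff[THEN iffD1, OF Cauchy_convergent])
  qed
  have ev: "\<forall>\<^sub>F n in sequentially. \<forall>x\<in>S. \<forall>h. norm (D n x h - G x h) \<le> e * norm h" if "e > 0" for e
  proof -
    obtain M where M: "\<And>m n x h. m \<ge> M \<Longrightarrow> n \<ge> M \<Longrightarrow> x \<in> S \<Longrightarrow> cmod (D n x h - D m x h) \<le> e * norm h"
      using ucau[OF \<open>e > 0\<close>] by meson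
    have "norm (D n x h - G x h) \<le> e * norm h" if "n \<ge> M" "x \<in> S" for n x h
    proof (rule tendsto_upperbound)
      show "(\<lambda>m. norm (D n x h - D m x h)) \<longlonglongrightarrow> norm (D n x h - G x h)"
        by (intro tendsto_intros conv that)
      show "\<forall>\<^sub>F m in sequentially. norm (D n x h - D m x h) \<le> e * norm h"
        using eventually_ge_at_top[of M] by eventually_elim (use M that in auto)
    qed simp
    then show ?thesis unfolding eventually_sequentially by blast
  qed
  have zS: "z \<in> S" using \<rho> by (simp add: S_def)
  have ptw: "(\<lambda>n. F n x) \<longlonglongrightarrow> f x" if "x \<in> S" for x
    using tendsto_uniform_limitI[OF lim[of "norm x"], of x] S1[OF that] by simp
  have "\<exists>g. \<forall>x\<in>S. (\<lambda>n. F n x) \<longlonglongrightarrow> g x \<and> (g has_derivative G x) (at x within S)"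
  proof (rule has_derivative_sequence)
    show "(F n has_derivative D n x) (at x within S)" if "x \<in> S" for n x
      by (rule has_derivative_at_withinI[OF D(1)[OF S1[OF that]]])
    show "\<forall>\<^sub>F n in sequentially. \<forall>x\<in>S. \<forall>h. norm (D n x h - G x h) \<le> e * norm h" if "e > 0" for e
      by (rule ev[OF that])
  qed (use zS ptw[OF zS] in \<open>auto simp: S_def\<close>)
  then obtain g where g: "\<And>x. x \<in> S \<Longrightarrow> (\<lambda>n. F n x) \<longlonglongrightarrow> g x" "(g has_derivative G z) (at z within S)"
    using zS by blast
  have "(f has_derivative G z) (at z within S)"
    by (rule has_derivative_transform[OF zS _ g(2)]) (use g(1) ptw LIMSEQ_unique in blast)
  then have "(f has_derivative G z) (at z)"
    using at_within_open[OF zS] by (simp add: S_def)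
  moreover have "G z (c *s v) = c * G z v" for c v
  proof (rule LIMSEQ_unique[OF conv[OF zS]])
    show "(\<lambda>n. D n z (c *s v)) \<longlonglongrightarrow> c * G z v"
      using D(2)[OF S1[OF zS]] by (simp add: tendsto_mult_left conv zS)
  qed
  ultimately show "\<exists>D. (f has_derivative D) (at z) \<and> (\<forall>c v. D (c *s v) = c * D v)" by blast
qed

lemma uniform_limit_bound:
  fixes F :: "nat \<Rightarrow> 'a \<Rightarrow> complex" and b :: "nat \<Rightarrow> real"
  assumes "b \<longlonglongrightarrow> 0" "\<And>k z. k \<ge> K \<Longrightarrow> z \<in> S \<Longrightarrow> cmod (F k z - g z) \<le> b k"
  shows "uniform_limit S F g sequentially"
proof (rule uniform_limitI)
  fix e :: real assume "e > 0"
  from order_tendstoD(2)[OF assms(1) this] eventually_ge_at_top[of K]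
  show "\<forall>\<^sub>F k in sequentially. \<forall>z\<in>S. dist (F k z) (g z) < e"
  proof eventually_elim
    case (elim k)
    then show ?case unfolding dist_norm by (meson order_le_less_trans assms(2))
  qed
qed

section \<open>Homogeneous expansion and the radial derivative\<close>

text \<open>
  The \<open>n\<close>-th component of the homogeneous expansion of \<open>f\<close> at the origin, read off from the one-variable
  power series along the complex line through \<open>w\<close>. It is defined for all \<open>w\<close>, also outside the ball,
  so that it can be evaluated on the unit sphere.
\<close>

definition homog_part :: "nat \<Rightarrow> (complex ^ 'd \<Rightarrow> complex) \<Rightarrow> complex ^ 'd \<Rightarrow> complex" where
  "homog_part n f w = fps_nth (fps_expansion (\<lambda>t. f (t *s w)) 0) n"

lemma small_vec_scalar:
  obtains r where "r > 0" "\<And>t. cmod t < r \<Longrightarrow> norm (t *s (w :: complex ^ 'd)) < 1"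
proof (rule that[of "1 / (norm w + 1)"])
  fix t assume "cmod t < 1 / (norm w + 1)"
  then have "cmod t * (norm w + 1) < 1" by (simp add: pos_less_divide_eq add_nonneg_pos)
  then show "norm (t *s w) < 1" 
    by (simp add: norm_vec_scalar algebra_simps) (smt (verit) norm_ge_zero)
qed (simp add: add_nonneg_pos)

lemma slice_has_fps_expansion:
  assumes "holomorphic_ball f"
  shows "(\<lambda>t. f (t *s w)) has_fps_expansion Abs_fps (\<lambda>n. homog_part n f w)"
proof -
  obtain r where r: "r > 0" "\<And>t. cmod t < r \<Longrightarrow> norm (t *s w) < 1"
    using small_vec_scalar by blast
  have "(\<lambda>t. f (t *s w)) holomorphic_on ball 0 r"
    by (rule slice0_holomorphic[OF assms]) (use r in auto)
  then have "(\<lambda>t. f (t *s w)) has_fps_expansion fps_expansion (\<lambda>t. f (t *s w)) 0"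
    by (intro has_fps_expansion_fps_expansion[of "ball 0 r"]) (use r in auto)
  moreover have "Abs_fps (\<lambda>n. homog_part n f w) = fps_expansion (\<lambda>t. f (t *s w)) 0"
    by (simp add: fps_eq_iff homog_part_def)
  ultimately show ?thesis by simp
qed

lemma homog_part_eqI:
  "(\<lambda>t. f (t *s w)) has_fps_expansion F \<Longrightarrow> homog_part n f w = fps_nth F n"
  by (simp add: homog_part_def fps_expansion_eqI)

lemma homog_part_cong:
  assumes "\<And>z. z \<in> ball 0 1 \<Longrightarrow> f z = g z"
  shows "homog_part n f w = homog_part n (g :: complex ^ 'd \<Rightarrow> complex) w"
proof -
  obtain r where r: "r > 0" "\<And>t. cmod t < r \<Longrightarrow> norm (t *s w) < 1"
    using small_vec_scalar by blast
  have "\<forall>\<^sub>F t in nhds 0. f (t *s w) = g (t *s w)"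
    unfolding eventually_nhds_metric
    by (rule exI[of _ r]) (use r assms in auto)
  then show ?thesis unfolding homog_part_def by (simp cong: fps_expansion_cong)
qed

lemma homog_part_add:
  assumes "holomorphic_ball f" "holomorphic_ball g"
  shows "homog_part n (\<lambda>z. f z + g z) w = homog_part n f w + homog_part n g w"
  using homog_part_eqI[of "\<lambda>z. f z + g z" w,
      OF has_fps_expansion_add[OF slice_has_fps_expansion[OF assms(1)] slice_has_fps_expansion[OF assms(2)]]]
  by simp

lemma homog_part_diff:
  assumes "holomorphic_ball f" "holomorphic_ball g"
  shows "homog_part n (\<lambda>z. f z - g z) w = homog_part n f w - homog_part n g w"
  using homog_part_eqI[of "\<lambda>z. f z - g z" w,
      OF has_fps_expansion_diff[OF slice_has_fps_expansion[OF assms(1)] slice_has_fps_expansion[OF assms(2)]]]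
  by simp

lemma homog_part_cmult:
  assumes "holomorphic_ball f"
  shows "homog_part n (\<lambda>z. c * f z) w = c * homog_part n f w"
  using homog_part_eqI[of "\<lambda>z. c * f z" w,
      OF has_fps_expansion_cmult_left[OF slice_has_fps_expansion[OF assms]]] by simp

lemma homog_part_sums_slice:
  assumes "holomorphic_ball f" "cmod t * norm w < 1"
  shows "(\<lambda>n. homog_part n f w * t ^ n) sums f (t *s w)"
proof -
  obtain r where r: "cmod t < r" "r * norm w \<le> 1"
  proof (cases "w = 0")
    case True
    then show ?thesis using that[of "cmod t + 1"] by simp
  next
    case False
    then show ?thesis using that[of "1 / norm w"] assms(2) by (simp add: field_simps)
  qed
  have n: "norm (s *s w) < 1" if "cmod s < r" for s
  proof (cases "w = 0")
    case False
    then have "cmod s * norm w < r * norm w" using that by simp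
    then show ?thesis using r(2) by (simp add: norm_vec_scalar)
  qed simp
  have "(\<lambda>t. f (t *s w)) holomorphic_on eball 0 (ereal r)"
    using slice0_holomorphic[OF assms(1), of "ball 0 r" w] n by simp
  from has_fps_expansion_imp_sums_complex[OF slice_has_fps_expansion[OF assms(1)] this] r(1)
  show ?thesis by simp
qed

lemma homog_part_unique:
  assumes "r > 0" "\<And>t. 0 < cmod t \<Longrightarrow> cmod t < r \<Longrightarrow> (\<lambda>n. c n * t ^ n) sums f (t *s w)" "f 0 = c 0"
  shows "homog_part n f w = c n"
proof -
  have s: "(\<lambda>n. c n * t ^ n) sums f (t *s w)" if "cmod t < r" for t
    by (cases "t = 0") (use assms that sums_If_finite_set[of "{0}" c] in 
       \<open>auto simp: power_0_left if_distrib cong: if_cong\<close>)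
  have "(\<lambda>t. f (t *s w)) has_fps_expansion Abs_fps c"
    unfolding has_fps_expansion_def
  proof
    have "ereal (r/2) \<le> fps_conv_radius (Abs_fps c)"
    proof -
      have "summable (\<lambda>n. fps_nth (Abs_fps c) n * of_real (r/2) ^ n)"
        using s[of "of_real (r/2)"] assms(1) by (simp add: sums_iff)
      from conv_radius_geI[OF this] show ?thesis using assms(1) by (simp add: fps_conv_radius_def)
    qed
    then show "0 < fps_conv_radius (Abs_fps c)" using assms(1)
      by (intro order_less_le_trans[OF _ \<open>ereal (r/2) \<le> _\<close>]) simp
    show "\<forall>\<^sub>F t in nhds 0. eval_fps (Abs_fps c) t = f (t *s w)"
      unfolding eventually_nhds_metric
      by (rule exI[of _ r]) (use assms(1) s in \<open>auto simp: eval_fps_def sums_iff\<close>)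
  qed
  from homog_part_eqI[OF this] show ?thesis by simp
qed

lemma homog_part_scale:
  assumes "holomorphic_ball f"
  shows "homog_part n f (c *s w) = c ^ n * homog_part n f w"
proof -
  obtain r where r: "r > 0" "\<And>t. cmod t < r \<Longrightarrow> norm (t *s (c *s w)) < 1"
    using small_vec_scalar by blast
  show ?thesis
  proof (rule homog_part_unique[OF r(1)])
    fix t assume "cmod t < r"
    from r(2)[OF this] have "cmod (t * c) * norm w < 1" by (simp add: norm_vec_scalar norm_mult)
    from homog_part_sums_slice[OF assms this]
    show "(\<lambda>n. c ^ n * homog_part n f w * t ^ n) sums f (t *s (c *s w))"
      by (simp add: power_mult_distrib algebra_simps)
  next
    show "f 0 = c ^ 0 * homog_part 0 f w"
      using homog_part_sums_slice[OF assms, of 0 w] sums_If_finite_set[of "{0}" "\<lambda>n. homog_part n f w"]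
      by (simp add: power_0_left if_distrib cong: if_cong) (use sums_unique2 in blast)
  qed
qed

lemma homog_part_bound:
  assumes f: "holomorphic_ball f" and s: "\<And>z. norm z \<le> r \<Longrightarrow> cmod (f z) \<le> s" and "r < 1"
    and w: "norm w \<le> r"
  shows "cmod (homog_part n f w) \<le> s"
proof -
  have n: "norm (t *s w) \<le> r" if "cmod t \<le> 1" for t
    using mult_mono[OF that w] w by (simp add: norm_vec_scalar)
  have h: "(\<lambda>t. f (t *s w)) holomorphic_on cball 0 1"
    by (rule slice0_holomorphic[OF f]) (use n \<open>r < 1\<close> in fastforce)
  have "cmod ((deriv ^^ n) (\<lambda>t. f (t *s w)) 0) \<le> fact n * s / 1 ^ n"
  proof (rule Cauchy_inequality)
    show "(\<lambda>t. f (t *s w)) holomorphic_on ball 0 1"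
      using h by (rule holomorphic_on_subset) auto
    show "continuous_on (cball 0 1) (\<lambda>t. f (t *s w))"
      using h by (rule holomorphic_on_imp_continuous_on)
    show "cmod (f (t *s w)) \<le> s" if "cmod (0 - t) = 1" for t
      by (rule s) (use n[of t] that in simp)
  qed auto
  then show ?thesis by (simp add: homog_part_def fps_expansion_def norm_divide field_simps)
qed

lemma homog_part_bound_ratio:
  assumes f: "holomorphic_ball f" and s: "\<And>z. norm z \<le> r \<Longrightarrow> cmod (f z) \<le> s" and "0 < r" "r < 1"
  shows "cmod (homog_part n f w) \<le> s * (norm w / r) ^ n"
proof (cases "w = 0")
  case True
  then have "homog_part n f w = 0 ^ n * homog_part n f w" using homog_part_scale[OF f, of n 0 w] by simp
  moreover have "cmod (homog_part n f w) \<le> s"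
    using homog_part_bound[OF f s \<open>r < 1\<close>, of w n] \<open>0 < r\<close> True by simp
  ultimately show ?thesis using True by (cases n) auto
next
  case False
  define c where "c = r / norm w"
  have c: "c > 0" using False \<open>0 < r\<close> by (simp add: c_def)
  have "cmod (homog_part n f (of_real c *s w)) \<le> s"
    by (rule homog_part_bound[OF f s \<open>r < 1\<close>]) (use c False \<open>0 < r\<close> in \<open>simp_all add: norm_vec_scalar c_def norm_divide\<close>)
  then have "c ^ n * cmod (homog_part n f w) \<le> s"
    using c by (simp add: homog_part_scale[OF f] norm_mult norm_power)
  then have "cmod (homog_part n f w) \<le> s / c ^ n" using c by (simp add: field_simps)
  also have "\<dots> = s * (norm w / r) ^ n" by (simp add: c_def power_divide)
  finally show ?thesis .
qed

text \<open>
  By induction on \<open>n\<close>: the components of order below \<open>n\<close> being holomorphic, \<open>homog_part n f z\<close> is the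
  locally uniform limit for \<open>t \<longlonglongrightarrow> 0\<close> of \<open>(f (t z) - \<Sum>j<n. t\<^sup>j homog_part j f z) / t\<^sup>n\<close>.
\<close>

lemma holomorphic_ball_homog_part:
  assumes f: "holomorphic_ball f"
  shows "holomorphic_ball (homog_part n f)"
proof (induction n rule: less_induct)
  case (less n)
  define F where "F k z = (f (of_real (1 / (k+2)) *s z) - (\<Sum>j<n. of_real (1 / (k+2)) ^ j * homog_part j f z))
                     / of_real (1 / (k+2)) ^ n" for k :: nat and z
  show ?case
  proof (rule holomorphic_ball_limit[of F])
    fix k :: nat
    have "cmod (of_real (1 / (k+2))) \<le> 1" unfolding norm_of_real by simp
    then have "holomorphic_ball (\<lambda>z. (1 / of_real (1 / (k+2)) ^ n) * (f (of_real (1 / (k+2)) *s z) - (\<Sum>j<n. of_real (1 / (k+2)) ^ j * homog_part j f z)))"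
      by (intro holomorphic_ball_cmult holomorphic_ball_diff holomorphic_ball_sum holomorphic_ball_dilate f less) auto
    then show "holomorphic_ball (F k)" by (simp add: F_def [abs_def])
  next
    fix r :: real assume r: "r < 1"
    obtain M where M: "M \<ge> 1" "\<And>z. norm z \<le> r \<Longrightarrow> cmod (f z) \<le> M"
      using holomorphic_ball_bounded_cball[OF f r] by blast
    have est: "cmod (F k z - homog_part n f z) \<le> 2 * M * (1 / (real k + 2))" if z: "z \<in> cball 0 r" for k z
    proof -
      define t :: real where "t = 1 / (real k + 2)"
      have t: "0 < t" "t \<le> 1/2" by (auto simp: t_def field_simps)
      define c where "c j = homog_part j f z" for j
      have c: "cmod (c j) \<le> M" for j
        unfolding c_def by (rule homog_part_bound[OF f M(2) r]) (use z in auto)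
      have "t * norm z < 1" using mult_mono[of t 1 "norm z" r] t z r by (auto intro: order_le_less_trans)
      then have "(\<lambda>j. c j * of_real t ^ j) sums f (of_real t *s z)"
        unfolding c_def by (intro homog_part_sums_slice[OF f]) (use t in auto)
      from sums_split_initial_segment[OF this, of "Suc n"]
      have s1: "(\<lambda>j. c (j + Suc n) * of_real t ^ (j + Suc n)) sums
                 (f (of_real t *s z) - (\<Sum>j<Suc n. c j * of_real t ^ j))" .
      have s2: "(\<lambda>j. M * t ^ Suc n * t ^ j) sums (M * t ^ Suc n * (1 / (1 - t)))"
        by (intro sums_mult geometric_sums) (use t in auto)
      have "cmod (f (of_real t *s z) - (\<Sum>j<Suc n. c j * of_real t ^ j)) \<le> M * t ^ Suc n * (1 / (1 - t))"
        unfolding sums_unique[OF s1] sums_unique[OF s2]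
      proof (rule norm_suminf_le)
        show "cmod (c (j + Suc n) * of_real t ^ (j + Suc n)) \<le> M * t ^ Suc n * t ^ j" for j
          using c[of "j + Suc n"] t by (simp add: norm_mult norm_power power_add mult_right_mono algebra_simps)
      qed (use s2 in \<open>simp add: sums_iff\<close>)
      also have "\<dots> \<le> M * t ^ Suc n * 2" using t M(1) by (intro mult_left_mono) (auto simp: field_simps)
      finally have "cmod (f (of_real t *s z) - (\<Sum>j<Suc n. c j * of_real t ^ j)) / t ^ n \<le> 2 * M * t"
        using t by (simp add: field_simps)
      moreover have "F k z - homog_part n f z = (f (of_real t *s z) - (\<Sum>j<Suc n. c j * of_real t ^ j)) / of_real t ^ n"
      proof -
        have "F k z = (f (of_real t *s z) - (\<Sum>j<n. of_real t ^ j * homog_part j f z)) / of_real t ^ n"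
          by (simp add: F_def t_def add.commute)
        then show ?thesis
          using t by (simp add: c_def diff_divide_distrib add_divide_distrib mult.commute)
      qed
      ultimately have "cmod (F k z - homog_part n f z) \<le> 2 * M * t"
        using t by (simp add: norm_divide norm_power)
      then show ?thesis by (simp add: t_def)
    qed
    have "(\<lambda>k. 2 * M * (1 / (real k + 2))) \<longlonglongrightarrow> 0" by real_asymp
    then show "uniform_limit (cball 0 r) F (homog_part n f) sequentially"
      by (rule uniform_limit_bound[where K = 0]) (rule est)
  qed
qed

text \<open>
  Euler's field at \<open>z\<close> is the total derivative in the direction of \<open>z\<close>.
\<close>

lemma radial_deriv_eq:
  assumes "(f has_derivative D) (at z)" "\<forall>c v. D (c *s v) = c * D v"
  shows "radial_deriv f z = D (z :: complex ^ 'd)"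
proof -
  interpret D: bounded_linear D using assms(1) by (rule has_derivative_bounded_linear)
  have p: "partial_deriv j f z = D (axis j 1)" for j
    unfolding partial_deriv_def
    by (rule DERIV_imp_deriv, rule has_derivative_slice) (use assms in auto)
  have "z = (\<Sum>j\<in>UNIV. z $ j *s axis j 1)"
    by (simp add: vec_eq_iff axis_def if_distrib sum.delta cong: if_cong)
  then have "D z = D (\<Sum>j\<in>UNIV. z $ j *s axis j 1)" by simp
  also have "\<dots> = (\<Sum>j\<in>UNIV. z $ j * D (axis j 1))"
    by (simp add: D.sum assms(2))
  finally show ?thesis by (simp add: radial_deriv_def p)
qed

lemma has_field_derivative_slice_radial:
  assumes "holomorphic_ball f" "norm (t *s w) < 1"
  shows "\<exists>d. ((\<lambda>t. f (t *s w)) has_field_derivative d) (at t) \<and> t * d = radial_deriv f (t *s w)"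
proof -
  obtain D where D: "(f has_derivative D) (at (t *s w))" "\<forall>c v. D (c *s v) = c * D v"
    using assms unfolding holomorphic_ball_def by (metis mem_ball_0)
  have "((\<lambda>t. f (0 + t *s w)) has_field_derivative D w) (at t)"
    by (rule has_derivative_slice) (use D in auto)
  then show ?thesis using radial_deriv_eq[OF D] D(2) by auto
qed

text \<open>
  Termwise differentiation at \<open>t = 1\<close> of the power series of \<open>t \<mapsto> f (t w)\<close>, which converges in a disc
  of radius larger than \<open>1\<close>.
\<close>

lemma homog_part_radial_sums:
  assumes f: "holomorphic_ball f" and "norm w < 1"
  shows "(\<lambda>n. of_nat n * homog_part n f w) sums radial_deriv f w"
proof -
  define r where "r = 2 / (1 + norm w)"
  have "1 + norm w > 0" by (simp add: add_pos_nonneg)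
  then have r: "r > 1" "r * norm w < 1"
    using assms(2) by (simp_all add: r_def divide_less_eq less_divide_eq)
  obtain d where d: "((\<lambda>t. f (t *s w)) has_field_derivative d) (at 1)" "d = radial_deriv f w"
    using has_field_derivative_slice_radial[OF f, of 1 w] assms(2) by auto
  have "((\<lambda>t. \<Sum>n. homog_part n f w * t ^ n) has_field_derivative (\<Sum>n. diffs (\<lambda>n. homog_part n f w) n * 1 ^ n)) (at 1)"
    by (rule termdiffs_strong[of _ "of_real r"])
       (use r homog_part_sums_slice[OF f, of "of_real r" w] in \<open>auto simp: sums_iff\<close>)
  moreover have "\<forall>\<^sub>F t in nhds 1. f (t *s w) = (\<Sum>n. homog_part n f w * t ^ n)"
  proof -
    have "cmod t * norm w < 1" if "dist t 1 < r - 1" for t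
    proof -
      have "cmod t \<le> r" using that norm_triangle_sub[of t 1] by (simp add: dist_norm)
      then have "cmod t * norm w \<le> r * norm w" by (simp add: mult_right_mono)
      with r show ?thesis by simp
    qed
    then show ?thesis unfolding eventually_nhds_metric
      using r(1) homog_part_sums_slice[OF f, THEN sums_unique]
      by (intro exI[of _ "r - 1"]) simp
  qed
  ultimately have "((\<lambda>t. f (t *s w)) has_field_derivative (\<Sum>n. diffs (\<lambda>n. homog_part n f w) n * 1 ^ n)) (at 1)"
    by (subst DERIV_cong_ev[OF refl _ refl])
  from DERIV_unique[OF d(1) this] have R: "radial_deriv f w = (\<Sum>n. diffs (\<lambda>n. homog_part n f w) n)"
    by (simp only: d(2) power_one mult_1_right)
  have "summable (\<lambda>n. diffs (\<lambda>n. homog_part n f w) n * 1 ^ n)"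
  proof (rule termdiff_converges[of _ r])
    show "summable (\<lambda>n. homog_part n f w * t ^ n)" if "cmod t < r" for t
    proof -
      have "cmod t * norm w \<le> r * norm w" using that by (intro mult_right_mono) auto
      with r have "cmod t * norm w < 1" by linarith
      from homog_part_sums_slice[OF f this] show ?thesis by (simp add: sums_iff)
    qed
  qed (use r in simp)
  then have "(\<lambda>n. diffs (\<lambda>n. homog_part n f w) n) sums radial_deriv f w"
    unfolding R by (simp add: summable_sums)
  then have "(\<lambda>n. of_nat (Suc n) * homog_part (Suc n) f w) sums radial_deriv f w" by (simp add: diffs_def)
  then show ?thesis using sums_Suc_iff[of "\<lambda>n. of_nat n * homog_part n f w" "radial_deriv f w"] by simp
qed

lemma holomorphic_ball_radial_deriv:
  assumes f: "holomorphic_ball f"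
  shows "holomorphic_ball (radial_deriv f)"
proof (rule holomorphic_ball_limit[of "\<lambda>m z. \<Sum>n<m. of_nat n * homog_part n f z"])
  show "holomorphic_ball (\<lambda>z. \<Sum>n<m. of_nat n * homog_part n f z)" for m
    by (intro holomorphic_ball_sum holomorphic_ball_cmult holomorphic_ball_homog_part f)
next
  fix r :: real assume "r < 1"
  define q where "q = max 0 r"
  define p where "p = (q + 1) / 2"
  have p: "0 < p" "p < 1" "0 \<le> q" "q < p" using \<open>r < 1\<close> by (auto simp: p_def q_def)
  obtain M where M: "M \<ge> 1" "\<And>z. norm z \<le> p \<Longrightarrow> cmod (f z) \<le> M"
    using holomorphic_ball_bounded_cball[OF f p(2)] by blast
  have "uniform_limit (cball 0 r) (\<lambda>m z. \<Sum>n<m. of_nat n * homog_part n f z) (\<lambda>z. \<Sum>n. of_nat n * homog_part n f z) sequentially"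
  proof (rule Weierstrass_m_test)
    show "norm (of_nat n * homog_part n f z) \<le> M * (real n * (q / p) ^ n)" if "z \<in> cball 0 r" for n z
    proof -
      have "cmod (homog_part n f z) \<le> M * (norm z / p) ^ n"
        by (rule homog_part_bound_ratio[OF f M(2) p(1,2)])
      also have "\<dots> \<le> M * (q / p) ^ n"
        using that M(1) p by (intro mult_left_mono power_mono divide_right_mono) (auto simp: q_def)
      finally have "real n * cmod (homog_part n f z) \<le> real n * (M * (q / p) ^ n)"
        by (rule mult_left_mono) simp
      then show ?thesis by (simp add: norm_mult mult.left_commute)
    qed
    have "summable (\<lambda>n. diffs (\<lambda>n. 1 :: real) n * (q / p) ^ n)"
      by (rule termdiff_converges[of _ 1]) (use p in \<open>auto simp: summable_geometric\<close>)
    then have "summable (\<lambda>n. real (Suc n) * (q / p) ^ n * (q / p))" 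
      by (intro summable_mult2) (simp add: diffs_def)
    then have "summable (\<lambda>n. real (Suc n) * (q / p) ^ (Suc n))" by (simp add: mult_ac)
    then have "summable (\<lambda>n. real n * (q / p) ^ n)"
      by (rule summable_Suc_iff[of "\<lambda>n. real n * (q / p) ^ n", THEN iffD1])
    then show "summable (\<lambda>n. M * (real n * (q / p) ^ n))"
      by (rule summable_mult)
  qed
  then show "uniform_limit (cball 0 r) (\<lambda>m z. \<Sum>n<m. of_nat n * homog_part n f z) (radial_deriv f) sequentially"
  proof (rule uniform_limit_cong'[THEN iffD1, rotated 2])
    show "(\<Sum>n. of_nat n * homog_part n f z) = radial_deriv f z" if "z \<in> cball 0 r" for z
      using homog_part_radial_sums[OF f, of z] \<open>r < 1\<close> that by (simp add: sums_iff)
  qed simp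
qed

lemma homog_part_radial_deriv:
  assumes f: "holomorphic_ball f"
  shows "homog_part n (radial_deriv f) w = of_nat n * homog_part n f w"
proof -
  obtain r where r: "r > 0" "\<And>t. cmod t < r \<Longrightarrow> norm (t *s w) < 1"
    using small_vec_scalar by blast
  show ?thesis
  proof (rule homog_part_unique[OF r(1)])
    show "(\<lambda>n. of_nat n * homog_part n f w * t ^ n) sums radial_deriv f (t *s w)" if "cmod t < r" for t
      using homog_part_radial_sums[OF f r(2)[OF that]] by (simp add: homog_part_scale[OF f] mult_ac)
    show "radial_deriv f 0 = of_nat 0 * homog_part 0 f w" by (simp add: radial_deriv_def)
  qed
qed

lemma radial_deriv_mult:
  assumes "holomorphic_ball f" "holomorphic_ball g" "z \<in> ball 0 1"
  shows "radial_deriv (\<lambda>z. f z * g z) z = f z * radial_deriv g z + radial_deriv f z * g z"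
proof -
  obtain D where D: "(f has_derivative D) (at z)" "\<forall>c v. D (c *s v) = c * D v"
    using assms(1,3) unfolding holomorphic_ball_def by blast
  obtain E where E: "(g has_derivative E) (at z)" "\<forall>c v. E (c *s v) = c * E v"
    using assms(2,3) unfolding holomorphic_ball_def by blast
  have "((\<lambda>z. f z * g z) has_derivative (\<lambda>v. f z * E v + D v * g z)) (at z)"
    using D(1) E(1) by (rule has_derivative_mult)
  from radial_deriv_eq[OF this] show ?thesis
    using D E by (simp add: radial_deriv_eq[OF D] radial_deriv_eq[OF E] algebra_simps)
qed

lemma radial_deriv_cong:
  assumes "\<And>z :: complex ^ 'd. z \<in> ball 0 1 \<Longrightarrow> f z = g z" "holomorphic_ball f" "(z :: complex ^ 'd) \<in> ball 0 1"
  shows "radial_deriv f z = radial_deriv g z"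
proof -
  have g: "holomorphic_ball g" using holomorphic_ball_cong[OF assms(1,2)] .
  have "(\<lambda>n. of_nat n * homog_part n f z) sums radial_deriv g z"
    using homog_part_radial_sums[OF g] assms(3) homog_part_cong[OF assms(1), where w = z] by simp
  moreover have "(\<lambda>n. of_nat n * homog_part n f z) sums radial_deriv f z"
    using homog_part_radial_sums[OF assms(2)] assms(3) by simp
  ultimately show ?thesis by (rule sums_unique2[symmetric])
qed

lemma homog_part_sum:
  assumes "\<And>i. i \<in> I \<Longrightarrow> holomorphic_ball (f i)"
  shows "homog_part n (\<lambda>z. \<Sum>i\<in>I. f i z) w = (\<Sum>i\<in>I. homog_part n (f i) w)"
  using assms
proof (induction I rule: infinite_finite_induct)
  case (insert i I)
  then show ?case by (simp add: homog_part_add holomorphic_ball_sum)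
next
  case empty
  then show ?case using homog_part_cmult[of "\<lambda>_. 0" n 0 w] by simp
next
  case (infinite I)
  then show ?case using homog_part_cmult[of "\<lambda>_. 0" n 0 w] by simp
qed

lemma homog_part_homog_part:
  assumes "holomorphic_ball f"
  shows "homog_part n (homog_part j f) w = (if n = j then homog_part j f w else 0)"
proof (rule homog_part_unique[of 1])
  fix t :: complex
  have "(\<lambda>i. if i = j then homog_part j f w * t ^ i else 0) sums (homog_part j f w * t ^ j)"
    by (rule sums_single)
  then show "(\<lambda>n. (if n = j then homog_part j f w else 0) * t ^ n) sums homog_part j f (t *s w)"
    by (simp add: homog_part_scale[OF assms] mult.commute if_distrib[of "\<lambda>x. _ * x"] cong: if_cong)
next
  show "homog_part j f 0 = (if 0 = j then homog_part j f w else 0)"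
    using homog_part_scale[OF assms, of j 0 w] by (cases j) auto
qed simp

text \<open>
  Truncation of the expansion is a projection; this splits a function into low and high degrees.
\<close>

lemma homog_part_taylor:
  assumes "holomorphic_ball f"
  shows "homog_part n (\<lambda>z. \<Sum>j<m. homog_part j f z) w = (if n < m then homog_part n f w else 0)"
  by (simp add: homog_part_sum holomorphic_ball_homog_part assms homog_part_homog_part sum.delta)

text \<open>
  The bound is uniform in the degree \<open>m\<close>, since it comes from a convergent geometric majorant.
\<close>

lemma taylor_bounded:
  assumes f: "holomorphic_ball f" and "r < 1"
  obtains s where "s \<ge> 0" "\<And>m z. norm z \<le> r \<Longrightarrow> cmod (\<Sum>j<m. homog_part j f z) \<le> s"
proof -
  define q where "q = max 0 r"
  define p where "p = (q + 1) / 2"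
  have p: "0 < p" "p < 1" "0 \<le> q" "q < p" using \<open>r < 1\<close> by (auto simp: p_def q_def)
  obtain M where M: "M \<ge> 1" "\<And>z. norm z \<le> p \<Longrightarrow> cmod (f z) \<le> M"
    using holomorphic_ball_bounded_cball[OF f p(2)] by blast
  have sm: "summable (\<lambda>n. M * (q / p) ^ n)" using p by (intro summable_mult summable_geometric) simp
  show ?thesis
  proof
    show "0 \<le> (\<Sum>n. M * (q / p) ^ n)" using M p by (intro suminf_nonneg sm) simp
    fix m z assume z: "norm (z :: complex ^ 'a) \<le> r"
    have "cmod (\<Sum>j<m. homog_part j f z) \<le> (\<Sum>j<m. M * (q / p) ^ j)"
    proof (rule sum_norm_le)
      fix j
      have "cmod (homog_part j f z) \<le> M * (norm z / p) ^ j"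
        by (rule homog_part_bound_ratio[OF f M(2) p(1,2)])
      also have "\<dots> \<le> M * (q / p) ^ j"
        using z M(1) p by (intro mult_left_mono power_mono divide_right_mono) (auto simp: q_def)
      finally show "cmod (homog_part j f z) \<le> M * (q / p) ^ j" .
    qed
    also have "\<dots> \<le> (\<Sum>n. M * (q / p) ^ n)"
      using M p by (intro sum_le_suminf sm) auto
    finally show "cmod (\<Sum>j<m. homog_part j f z) \<le> (\<Sum>n. M * (q / p) ^ n)" .
  qed
qed

section \<open>The rotation-invariant measure on the sphere\<close>

lemma orthogonal_transformation_vec_scalar:
  assumes "cmod c = 1"
  shows "orthogonal_transformation (\<lambda>w :: complex ^ 'd. c *s w)"
  unfolding orthogonal_transformation
  by (auto simp: norm_vec_scalar assms vec_eq_iff algebra_simps intro!: linearI)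

text \<open>
  The reflection in the hyperplane orthogonal to \<open>a - b\<close> exchanges \<open>a\<close> and \<open>b\<close>.
\<close>

lemma orthogonal_transformation_moves_sphere:
  fixes a b :: "'a :: euclidean_space"
  assumes "norm a = norm b"
  obtains U where "orthogonal_transformation U" "U a = b"
proof (cases "a = b")
  case True
  then show ?thesis using that[of "\<lambda>x. x"] by simp
next
  case False
  define v where "v = a - b"
  have v: "v \<bullet> v \<noteq> 0" using False by (simp add: v_def)
  define U where "U x = x - (2 * (x \<bullet> v) / (v \<bullet> v)) *\<^sub>R v" for x
  have ab: "a \<bullet> a = b \<bullet> b" using assms by (simp add: dot_square_norm)
  have "2 * (a \<bullet> v) = v \<bullet> v" using ab by (simp add: v_def inner_diff inner_commute)
  then have "U a = b" using v by (simp add: U_def) (simp add: v_def)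
  moreover have "orthogonal_transformation U"
    unfolding orthogonal_transformation_def
  proof
    show "linear U" unfolding U_def
      by (rule linearI) (simp_all add: inner_add_left algebra_simps add_divide_distrib)
    show "\<forall>x y. U x \<bullet> U y = x \<bullet> y"
    proof (intro allI)
      fix x y
      define k where "k = 2 / (v \<bullet> v)"
      have U: "U z = z - (k * (z \<bullet> v)) *\<^sub>R v" for z by (simp add: U_def k_def)
      have "U x \<bullet> U y = x \<bullet> y + (k * (v \<bullet> v) - 2) * (k * (x \<bullet> v) * (y \<bullet> v))"
        unfolding U inner_diff_left inner_diff_right inner_scaleR_left inner_scaleR_right
          inner_commute[of v y] by (simp only: algebra_simps)
      then show "U x \<bullet> U y = x \<bullet> y" using v by (simp add: k_def)
    qed
  qed
  ultimately show ?thesis using that by blast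
qed

locale sphere_measure =
  fixes \<sigma> :: "(complex ^ 'd) measure"
  assumes rotation_invariant: "rotation_invariant_sphere_measure \<sigma>"
begin

lemma sets_sphere: "sets \<sigma> = sets (restrict_space borel (sphere 0 1))"
  using rotation_invariant by (simp add: rotation_invariant_sphere_measure_def)

lemma space_sphere: "space \<sigma> = sphere 0 1"
  using sets_eq_imp_space_eq[OF sets_sphere] by (simp add: space_restrict_space)

lemma emeasure_space_1: "emeasure \<sigma> (space \<sigma>) = 1"
  using rotation_invariant by (simp add: rotation_invariant_sphere_measure_def space_sphere)

sublocale finite_measure \<sigma>
  by (rule finite_measureI) (simp add: emeasure_space_1)

lemma measure_space_1: "measure \<sigma> (space \<sigma>) = 1"
  by (simp add: measure_def emeasure_space_1)

lemma measurable_continuous_on_sphere: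
  "continuous_on (sphere 0 1) f \<Longrightarrow> (f :: _ \<Rightarrow> 'b :: topological_space) \<in> borel_measurable \<sigma>"
  using borel_measurable_continuous_on_restrict measurable_cong_sets[OF sets_sphere refl] by blast

lemma integrable_continuous_on_sphere:
  fixes f :: "complex ^ 'd \<Rightarrow> 'b :: {banach, second_countable_topology}"
  assumes "continuous_on (sphere 0 1) f"
  shows "integrable \<sigma> f"
proof -
  have "bounded (f ` sphere 0 1)"
    by (intro compact_imp_bounded compact_continuous_image assms) auto
  then obtain B where "\<forall>x\<in>sphere 0 1. norm (f x) \<le> B" by (auto simp: bounded_iff)
  then show ?thesis
    by (intro integrable_const_bound[of _ B] measurable_continuous_on_sphere assms)
       (auto simp: space_sphere intro!: AE_I2)
qed

lemma measurable_rotation: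
  assumes "orthogonal_transformation U"
  shows "U \<in> measurable \<sigma> \<sigma>"
proof -
  have "U \<in> measurable (restrict_space borel (sphere 0 1)) (restrict_space borel (sphere 0 1))"
    using assms
    by (intro measurable_restrict_space2 borel_measurable_continuous_on_restrict linear_continuous_on)
       (auto simp: space_restrict_space orthogonal_transformation_norm linear_conv_bounded_linear
          dest: orthogonal_transformation_linear)
  then show ?thesis by (simp add: measurable_cong_sets[OF sets_sphere sets_sphere])
qed

lemma distr_rotation: "orthogonal_transformation U \<Longrightarrow> distr \<sigma> \<sigma> U = \<sigma>"
  using rotation_invariant by (simp add: rotation_invariant_sphere_measure_def)

lemma integral_rotation:
  fixes f :: "complex ^ 'd \<Rightarrow> 'b :: {banach, second_countable_topology}"
  assumes "orthogonal_transformation U" "continuous_on (sphere 0 1) f"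
  shows "(\<integral>w. f (U w) \<partial>\<sigma>) = (\<integral>w. f w \<partial>\<sigma>)"
  using integral_distr[OF measurable_rotation[OF assms(1)] measurable_continuous_on_sphere[OF assms(2)]]
  by (simp add: distr_rotation[OF assms(1)])

lemma cap_sets: "sphere 0 1 \<inter> ball w \<delta> \<in> sets \<sigma>"
  by (simp add: sets_sphere sets_restrict_space image_iff) (metis borel_open open_ball)

text \<open>
  Rotations move every cap of radius \<open>\<delta>\<close> to every other one, so all of them have the same measure, and
  finitely many of them cover the sphere.
\<close>

lemma cap_pos:
  assumes "norm w = 1" "\<delta> > 0"
  shows "measure \<sigma> (sphere 0 1 \<inter> ball w \<delta>) > 0"
proof (rule ccontr)
  define cap where "cap v = sphere 0 1 \<inter> ball v \<delta>" for v :: "complex ^ 'd"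
  assume "\<not> measure \<sigma> (sphere 0 1 \<inter> ball w \<delta>) > 0"
  then have 0: "emeasure \<sigma> (cap w) = 0"
    by (simp add: cap_def emeasure_eq_measure not_less order_antisym)
  have eq: "emeasure \<sigma> (cap v) = 0" if "norm v = 1" for v
  proof -
    obtain U where U: "orthogonal_transformation U" "U w = v"
      by (rule orthogonal_transformation_moves_sphere[of w v]) (use assms(1) \<open>norm v = 1\<close> in auto)
    have "norm (U x - v) = norm (x - w)" for x
      using orthogonal_transformation_norm[OF U(1), of "x - w"]
        linear_diff[OF orthogonal_transformation_linear[OF U(1)], of x w] U(2) by simp
    then have "U -` cap v \<inter> space \<sigma> = cap w"
      by (auto simp: cap_def space_sphere dist_norm norm_minus_commute orthogonal_transformation_norm[OF U(1)])
    moreover have "emeasure (distr \<sigma> \<sigma> U) (cap v) = emeasure \<sigma> (U -` cap v \<inter> space \<sigma>)"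
      by (rule emeasure_distr[OF measurable_rotation[OF U(1)]]) (simp add: cap_def cap_sets)
    ultimately show ?thesis using 0 by (simp add: distr_rotation[OF U(1)])
  qed
  have cover: "sphere 0 1 \<subseteq> (\<Union>v\<in>sphere (0 :: complex ^ 'd) 1. ball v \<delta>)" using assms(2) by force
  have op: "open (ball v \<delta>)" for v :: "complex ^ 'd" by simp
  obtain T :: "(complex ^ 'd) set" where T: "T \<subseteq> sphere 0 1" "finite T" "sphere 0 1 \<subseteq> (\<Union>v\<in>T. ball v \<delta>)"
    by (rule compactE_image[OF compact_sphere op cover]) (rule that)
  have "emeasure \<sigma> (sphere 0 1) \<le> emeasure \<sigma> (\<Union>v\<in>T. cap v)"
    using T by (intro emeasure_mono sets.finite_UN) (auto simp: cap_def cap_sets)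
  also have "\<dots> \<le> (\<Sum>v\<in>T. emeasure \<sigma> (cap v))"
    by (intro emeasure_subadditive_finite T) (auto simp: cap_def cap_sets)
  also have "\<dots> = 0" using T(1) eq by (intro sum.neutral) auto
  finally show False using emeasure_space_1 by (simp add: space_sphere)
qed

lemma homog_part_continuous_on_sphere:
  assumes "holomorphic_ball (f :: complex ^ 'd \<Rightarrow> complex)"
  shows "continuous_on (sphere 0 1) (homog_part n f)"
proof -
  have "continuous_on (sphere 0 1) (\<lambda>w. 2 ^ n * homog_part n f ((1/2) *\<^sub>R w))"
    by (intro continuous_intros
          continuous_on_compose2[OF holomorphic_ball_continuous[OF holomorphic_ball_homog_part[OF assms]]]) auto
  then show ?thesis
    by (simp add: scaleR_eq_vec_scalar homog_part_scale[OF assms] power_divide)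
qed

text \<open>
  The rotation \<open>w \<mapsto> c w\<close> multiplies the integral by \<open>c\<^sup>n cnj (c\<^sup>m)\<close>, and \<open>c\<close> can be chosen such that
  this factor is \<open>-1\<close>.
\<close>

lemma homog_part_orthogonal:
  assumes "holomorphic_ball (f :: complex ^ 'd \<Rightarrow> complex)" "n \<noteq> m"
  shows "(\<integral>w. homog_part n f w * cnj (homog_part m f w) \<partial>\<sigma>) = 0"
  using assms(2)
proof (induction n m rule: linorder_wlog)
  case (le n m)
  define I where "I = (\<integral>w. homog_part n f w * cnj (homog_part m f w) \<partial>\<sigma>)"
  \<comment> \<open>then \<open>c\<^sup>m = - c\<^sup>n\<close>\<close>
  define c where "c = cis (pi / real (m - n))"
  have c: "cmod c = 1" by (simp add: c_def)
  have "real (m - n) \<noteq> 0" using le by simp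
  then have "real (m - n) * (pi / real (m - n)) = pi" by (metis nonzero_mult_div_cancel_left times_divide_eq_right)
  then have "c ^ (m - n) = - 1" by (simp only: c_def Complex.DeMoivre cis_pi)
  then have c2: "c ^ m = - (c ^ n)" using le by (metis le_add_diff_inverse mult_minus1_right power_add)
  have "I = (\<integral>w. homog_part n f (c *s w) * cnj (homog_part m f (c *s w)) \<partial>\<sigma>)"
    unfolding I_def
    by (rule integral_rotation[symmetric, OF orthogonal_transformation_vec_scalar[OF c]])
       (intro continuous_intros homog_part_continuous_on_sphere assms)
  also have "\<dots> = (\<integral>w. (c ^ n * cnj (c ^ m)) * (homog_part n f w * cnj (homog_part m f w)) \<partial>\<sigma>)"
    by (simp add: homog_part_scale[OF assms(1)] mult_ac)
  also have "\<dots> = (c ^ n * cnj (c ^ m)) * I" by (simp add: I_def)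
  also have "c ^ n * cnj (c ^ m) = - of_real ((cmod (c ^ n))\<^sup>2)"
    by (simp add: c2 complex_norm_square[symmetric] del: complex_cnj_power)
  also have "\<dots> = - 1" by (simp add: norm_power c)
  finally show ?case by (simp add: I_def)
next
  case (sym n m)
  have "cnj (\<integral>w. homog_part m f w * cnj (homog_part n f w) \<partial>\<sigma>) = (\<integral>w. homog_part n f w * cnj (homog_part m f w) \<partial>\<sigma>)"
    by (simp add: Bochner_Integration.integral_cnj[symmetric] mult.commute)
  with sym show ?case by (metis complex_cnj_zero)
qed

text \<open>
  The squared norm in \<open>L\<^sup>2(\<sigma>)\<close> of the \<open>n\<close>-th homogeneous component.
\<close>

definition energy :: "nat \<Rightarrow> (complex ^ 'd \<Rightarrow> complex) \<Rightarrow> real" where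
  "energy n f = (\<integral>w. (cmod (homog_part n f w))\<^sup>2 \<partial>\<sigma>)"

lemma energy_nonneg [simp]: "energy n f \<ge> 0"
  unfolding energy_def by (intro Bochner_Integration.integral_nonneg) simp

lemma energy_cong: "(\<And>z. z \<in> ball 0 1 \<Longrightarrow> f z = g z) \<Longrightarrow> energy n f = energy n g"
  unfolding energy_def using homog_part_cong[of f g] by simp

lemma energy_integrable:
  "holomorphic_ball f \<Longrightarrow> integrable \<sigma> (\<lambda>w. (cmod (homog_part n f w))\<^sup>2)"
  by (intro integrable_continuous_on_sphere continuous_intros homog_part_continuous_on_sphere)

lemma energy_cmult: "holomorphic_ball f \<Longrightarrow> energy n (\<lambda>z. c * f z) = (cmod c)\<^sup>2 * energy n f"
  unfolding energy_def by (simp add: homog_part_cmult norm_mult power_mult_distrib)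

lemma energy_radial_deriv:
  "holomorphic_ball f \<Longrightarrow> energy n (radial_deriv f) = (real n)\<^sup>2 * energy n f"
  unfolding energy_def by (simp add: homog_part_radial_deriv norm_mult power_mult_distrib)

lemma energy_parallelogram:
  assumes "holomorphic_ball f" "holomorphic_ball g"
  shows "energy n (\<lambda>z. f z + g z) + energy n (\<lambda>z. f z - g z) = 2 * energy n f + 2 * energy n g"
proof -
  have "energy n (\<lambda>z. f z + g z) + energy n (\<lambda>z. f z - g z)
      = (\<integral>w. (cmod (homog_part n (\<lambda>z. f z + g z) w))\<^sup>2 + (cmod (homog_part n (\<lambda>z. f z - g z) w))\<^sup>2 \<partial>\<sigma>)"
    unfolding energy_def
    by (rule Bochner_Integration.integral_add[symmetric]) (intro energy_integrable holomorphic_ball_add holomorphic_ball_diff assms)+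
  also have "\<dots> = (\<integral>w. 2 * (cmod (homog_part n f w))\<^sup>2 + 2 * (cmod (homog_part n g w))\<^sup>2 \<partial>\<sigma>)"
  proof (rule arg_cong[where f = "integral\<^sup>L \<sigma>"], rule ext)
    fix w
    have "(cmod (a + b))\<^sup>2 + (cmod (a - b))\<^sup>2 = 2 * (cmod a)\<^sup>2 + 2 * (cmod b)\<^sup>2" for a b
      by (simp add: cmod_power2) (simp add: power2_eq_square algebra_simps)
    then show "(cmod (homog_part n (\<lambda>z. f z + g z) w))\<^sup>2 + (cmod (homog_part n (\<lambda>z. f z - g z) w))\<^sup>2
        = 2 * (cmod (homog_part n f w))\<^sup>2 + 2 * (cmod (homog_part n g w))\<^sup>2"
      by (simp add: homog_part_add homog_part_diff assms)
  qed
  also have "\<dots> = 2 * energy n f + 2 * energy n g"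
    unfolding energy_def using energy_integrable[OF assms(1)] energy_integrable[OF assms(2)] by simp
  finally show ?thesis .
qed

text \<open>
  The free parameter \<open>\<delta>\<close> replaces the triangle inequality for the norm itself: with small \<open>\<delta>\<close>, adding
  a small \<open>g\<close> changes the squared norm of \<open>f\<close> only slightly.
\<close>

lemma energy_add_le:
  assumes "holomorphic_ball f" "holomorphic_ball g" "\<delta> > 0"
  shows "energy n (\<lambda>z. f z + g z) \<le> (1 + \<delta>) * energy n f + (1 + 1 / \<delta>) * energy n g"
proof -
  have p: "(cmod (a + b))\<^sup>2 \<le> (1 + \<delta>) * (cmod a)\<^sup>2 + (1 + 1 / \<delta>) * (cmod b)\<^sup>2" for a b
  proof -
    have "(cmod (a + b))\<^sup>2 \<le> (cmod a + cmod b)\<^sup>2" by (intro power_mono norm_triangle_ineq) simp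
    moreover have "0 \<le> (\<delta> * cmod a - cmod b)\<^sup>2 / \<delta>" using assms(3) by simp
    moreover have "(\<delta> * cmod a - cmod b)\<^sup>2 / \<delta> = \<delta> * (cmod a)\<^sup>2 + (cmod b)\<^sup>2 / \<delta> - 2 * cmod a * cmod b"
      using assms(3) by (simp add: field_simps power2_eq_square)
    ultimately show ?thesis by (simp add: power2_sum algebra_simps)
  qed
  have "energy n (\<lambda>z. f z + g z) \<le> (\<integral>w. (1 + \<delta>) * (cmod (homog_part n f w))\<^sup>2 + (1 + 1 / \<delta>) * (cmod (homog_part n g w))\<^sup>2 \<partial>\<sigma>)"
    unfolding energy_def homog_part_add[OF assms(1,2)]
    by (intro integral_mono p Bochner_Integration.integrable_add integrable_mult_right energy_integrable assms
         integrable_continuous_on_sphere continuous_intros homog_part_continuous_on_sphere)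
  also have "\<dots> = (1 + \<delta>) * energy n f + (1 + 1 / \<delta>) * energy n g"
    unfolding energy_def using energy_integrable[OF assms(1)] energy_integrable[OF assms(2)] by simp
  finally show ?thesis .
qed

lemma energy_add_le2:
  assumes "holomorphic_ball f" "holomorphic_ball g"
  shows "energy n (\<lambda>z. f z + g z) \<le> 2 * energy n f + 2 * energy n g"
  using energy_add_le[OF assms, of 1] by simp

lemma energy_bound:
  assumes f: "holomorphic_ball f" and s: "\<And>z. norm z \<le> r \<Longrightarrow> cmod (f z) \<le> s" and r: "0 < r" "r < 1"
  shows "energy n f \<le> s\<^sup>2 / r ^ (2 * n)"
proof -
  have "energy n f \<le> (\<integral>w. s\<^sup>2 / r ^ (2 * n) \<partial>\<sigma>)"
    unfolding energy_def
  proof (rule integral_mono[OF energy_integrable[OF f]])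
    fix w assume "w \<in> space \<sigma>"
    then have "cmod (homog_part n f w) \<le> s * (1 / r) ^ n"
      using homog_part_bound_ratio[OF f s r, where w = w and n = n] by (simp add: space_sphere)
    from power_mono[OF this, of 2] show "(cmod (homog_part n f w))\<^sup>2 \<le> s\<^sup>2 / r ^ (2 * n)"
      by (simp add: power_mult_distrib power_divide power_mult[symmetric] mult.commute)
  qed simp
  then show ?thesis by (simp add: measure_space_1)
qed

lemma parseval_finite:
  assumes f: "holomorphic_ball f"
  shows "(\<integral>w. (cmod (\<Sum>n<M. homog_part n f w * of_real r ^ n))\<^sup>2 \<partial>\<sigma>) = (\<Sum>n<M. r ^ (2 * n) * energy n f)"
proof -
  define a where "a n w = homog_part n f w * of_real r ^ n" for n w
  have int: "integrable \<sigma> (\<lambda>w. a n w * cnj (a m w))" for n m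
    unfolding a_def by (intro integrable_continuous_on_sphere continuous_intros homog_part_continuous_on_sphere f)
  have I: "(\<integral>w. a n w * cnj (a m w) \<partial>\<sigma>) = (if m = n then of_real (r ^ (2 * n) * energy n f) else 0)" for n m
  proof -
    have "(\<integral>w. a n w * cnj (a m w) \<partial>\<sigma>) = (\<integral>w. of_real (r ^ n * r ^ m) * (homog_part n f w * cnj (homog_part m f w)) \<partial>\<sigma>)"
      by (simp add: a_def mult_ac)
    also have "\<dots> = of_real (r ^ n * r ^ m) * (\<integral>w. homog_part n f w * cnj (homog_part m f w) \<partial>\<sigma>)" by simp
    also have "\<dots> = (if m = n then of_real (r ^ (2 * n) * energy n f) else 0)"
    proof (cases "m = n")
      case True
      have "(\<integral>w. homog_part n f w * cnj (homog_part n f w) \<partial>\<sigma>) = of_real (energy n f)"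
        unfolding energy_def integral_complex_of_real[symmetric] complex_norm_square ..
      with True show ?thesis by (simp add: power_add[symmetric] mult_2)
    qed (use homog_part_orthogonal[OF f, of n m] in auto)
    finally show ?thesis .
  qed
  have "complex_of_real (\<integral>w. (cmod (\<Sum>n<M. a n w))\<^sup>2 \<partial>\<sigma>) = (\<integral>w. (\<Sum>n<M. \<Sum>m<M. a n w * cnj (a m w)) \<partial>\<sigma>)"
    unfolding integral_complex_of_real[symmetric] complex_norm_square cnj_sum sum_product ..
  also have "\<dots> = (\<Sum>n<M. \<Sum>m<M. (\<integral>w. a n w * cnj (a m w) \<partial>\<sigma>))"
    using int by (simp add: Bochner_Integration.integral_sum)
  also have "\<dots> = of_real (\<Sum>n<M. r ^ (2 * n) * energy n f)"
    unfolding I by (simp add: sum.delta)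
  finally show ?thesis unfolding a_def of_real_eq_iff .
qed

lemma parseval:
  assumes f: "holomorphic_ball f" and r: "0 \<le> r" "r < 1"
  shows "(\<lambda>n. r ^ (2 * n) * energy n f) sums (\<integral>w. (cmod (f (r *\<^sub>R w)))\<^sup>2 \<partial>\<sigma>)"
proof -
  define p where "p = (r + 1) / 2"
  have p: "0 < p" "p < 1" "r < p" using r by (auto simp: p_def)
  obtain M where M: "M \<ge> 1" "\<And>z. norm z \<le> p \<Longrightarrow> cmod (f z) \<le> M"
    using holomorphic_ball_bounded_cball[OF f p(2)] by blast
  define S where "S k w = (\<Sum>n<k. homog_part n f w * of_real r ^ n)" for k w
  have conv: "(\<lambda>k. S k w) \<longlonglongrightarrow> f (r *\<^sub>R w)" if "norm w = 1" for w
    using homog_part_sums_slice[OF f, of "of_real r" w] r that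
    unfolding S_def by (simp add: sums_def scaleR_eq_vec_scalar)
  have bd: "cmod (S k w) \<le> M * (1 / (1 - r / p))" if "norm w = 1" for k w
  proof -
    have "cmod (S k w) \<le> (\<Sum>n<k. M * (r / p) ^ n)"
      unfolding S_def
    proof (rule sum_norm_le)
      fix n
      have "cmod (homog_part n f w) \<le> M * (1 / p) ^ n"
        using homog_part_bound_ratio[OF f M(2) p(1,2), where w = w and n = n] that by simp
      then have "cmod (homog_part n f w) * r ^ n \<le> M * (1 / p) ^ n * r ^ n" using r by (intro mult_right_mono) auto
      then show "cmod (homog_part n f w * of_real r ^ n) \<le> M * (r / p) ^ n"
        using r by (simp add: norm_mult norm_power power_divide)
    qed
    also have "\<dots> \<le> (\<Sum>n. M * (r / p) ^ n)"
      using p r M by (intro sum_le_suminf summable_mult summable_geometric) auto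
    also have "\<dots> = M * (1 / (1 - r / p))"
      using p r by (subst suminf_mult) (auto simp: suminf_geometric summable_geometric)
    finally show ?thesis .
  qed
  define K where "K = M * (1 / (1 - r / p))"
  have "(\<lambda>k. \<integral>w. (cmod (S k w))\<^sup>2 \<partial>\<sigma>) \<longlonglongrightarrow> (\<integral>w. (cmod (f (r *\<^sub>R w)))\<^sup>2 \<partial>\<sigma>)"
  proof (rule integral_dominated_convergence[where w = "\<lambda>_. K\<^sup>2"])
    show "(\<lambda>w. (cmod (f (r *\<^sub>R w)))\<^sup>2) \<in> borel_measurable \<sigma>"
      by (intro measurable_continuous_on_sphere continuous_intros
            continuous_on_compose2[OF holomorphic_ball_continuous[OF f]]) (use r in auto)
    show "(\<lambda>w. (cmod (S k w))\<^sup>2) \<in> borel_measurable \<sigma>" for k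
      unfolding S_def
      by (intro measurable_continuous_on_sphere continuous_intros homog_part_continuous_on_sphere f)
    show "AE w in \<sigma>. (\<lambda>k. (cmod (S k w))\<^sup>2) \<longlonglongrightarrow> (cmod (f (r *\<^sub>R w)))\<^sup>2"
      by (intro AE_I2 tendsto_intros conv) (simp add: space_sphere)
    show "AE w in \<sigma>. norm ((cmod (S k w))\<^sup>2) \<le> K\<^sup>2" for k
      by (intro AE_I2) (use bd in \<open>auto simp: space_sphere K_def intro!: power_mono\<close>)
  qed auto
  then show ?thesis
    unfolding S_def parseval_finite[OF f] sums_def .
qed

end

section \<open>The Besov norm as a weighted sum over homogeneous components\<close>

locale radial_besov = sphere_measure \<sigma> for \<sigma> :: "(complex ^ 'd) measure" +
  fixes \<mu> :: "real measure"
  assumes admissible: "admissible_radial_part \<mu>"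
begin

sublocale radial: finite_measure \<mu>
  using admissible by (simp add: admissible_radial_part_def)

lemma sets_radial: "sets \<mu> = sets (restrict_space borel {0..1})"
  using admissible by (simp add: admissible_radial_part_def)

lemma space_radial: "space \<mu> = {0..1}"
  using sets_eq_imp_space_eq[OF sets_radial] by (simp add: space_restrict_space)

lemma measurable_radial: "f \<in> borel_measurable borel \<Longrightarrow> f \<in> borel_measurable \<mu>"
  using measurable_restrict_space1 measurable_cong_sets[OF sets_radial refl] by blast

definition moment :: "nat \<Rightarrow> real" where
  "moment n = (\<integral>r. r ^ (2 * n) \<partial>\<mu>)"

lemma moment_integrable: "integrable \<mu> (\<lambda>r. r ^ (2 * n))"
  by (rule radial.integrable_const_bound[of _ 1])
     (auto simp: space_radial power_le_one intro!: AE_I2 measurable_radial)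

lemma moment_nonneg [simp]: "moment n \<ge> 0"
  unfolding moment_def by (intro Bochner_Integration.integral_nonneg) simp

lemma ennreal_moment: "ennreal (moment n) = (\<integral>\<^sup>+ r. ennreal (r ^ (2 * n)) \<partial>\<mu>)"
  unfolding moment_def by (rule nn_integral_eq_integral[symmetric, OF moment_integrable]) simp

text \<open>
  As \<open>\<mu>\<close> has mass arbitrarily close to \<open>1\<close>, the moments decay more slowly than every geometric sequence.
\<close>

lemma moment_lower:
  assumes "0 < r" "r < 1"
  shows "r ^ (2 * n) * measure \<mu> {r<..1} \<le> moment n" "measure \<mu> {r<..1} > 0"
proof -
  have s: "{r<..1} \<in> sets \<mu>"
    unfolding sets_radial by (subst sets_restrict_space_iff) (use assms in auto)
  have "r ^ (2 * n) * measure \<mu> {r<..1} = (\<integral>t. r ^ (2 * n) * indicator {r<..1} t \<partial>\<mu>)"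
    using s by simp
  also have "\<dots> \<le> moment n" unfolding moment_def
  proof (rule integral_mono[OF _ moment_integrable])
    show "integrable \<mu> (\<lambda>t. r ^ (2 * n) * indicator {r<..1} t)"
      using s by (intro integrable_mult_right integrable_real_indicator) (auto simp: less_top[symmetric])
  qed (use assms in \<open>auto simp: indicator_def intro!: power_mono\<close>)
  finally show "r ^ (2 * n) * measure \<mu> {r<..1} \<le> moment n" .
  have "emeasure \<mu> {r<..1} > 0" using admissible assms by (simp add: admissible_radial_part_def)
  then show "measure \<mu> {r<..1} > 0" by (simp add: radial.emeasure_eq_measure)
qed

definition sphere_mean :: "(complex ^ 'd \<Rightarrow> complex) \<Rightarrow> real \<Rightarrow> ennreal" where
  "sphere_mean f r = (\<integral>\<^sup>+ w. ennreal ((cmod (f (r *\<^sub>R w)))\<^sup>2) \<partial>\<sigma>)"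

lemma sphere_mean_eq:
  assumes f: "holomorphic_ball f" and r: "0 \<le> r" "r < 1"
  shows "sphere_mean f r = (\<Sum>n. ennreal (r ^ (2 * n) * energy n f))"
proof -
  have "integrable \<sigma> (\<lambda>w. (cmod (f (r *\<^sub>R w)))\<^sup>2)"
    by (intro integrable_continuous_on_sphere continuous_intros
          continuous_on_compose2[OF holomorphic_ball_continuous[OF f]]) (use r in auto)
  then have "sphere_mean f r = ennreal (\<integral>w. (cmod (f (r *\<^sub>R w)))\<^sup>2 \<partial>\<sigma>)"
    unfolding sphere_mean_def by (intro nn_integral_eq_integral) auto
  also have "\<dots> = (\<Sum>n. ennreal (r ^ (2 * n) * energy n f))"
    using parseval[OF f r] r by (intro suminf_ennreal_eq[symmetric]) auto
  finally show ?thesis .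
qed

lemma hardy_norm_sq_sphere_mean: "hardy_norm_sq \<sigma> f = (SUP r\<in>{0<..<1}. sphere_mean f r)"
  by (simp add: hardy_norm_sq_def sphere_mean_def)

lemma hardy_norm_sq_eq:
  assumes f: "holomorphic_ball f"
  shows "hardy_norm_sq \<sigma> f = (\<Sum>n. ennreal (energy n f))"
proof (rule antisym)
  have "hardy_norm_sq \<sigma> f = (SUP r\<in>{0<..<1}. sphere_mean f r)"
    by (rule hardy_norm_sq_sphere_mean)
  also have "\<dots> = (SUP r\<in>{0<..<1}. \<Sum>n. ennreal (r ^ (2 * n) * energy n f))"
    by (intro SUP_cong refl sphere_mean_eq f) auto
  finally have eq: "hardy_norm_sq \<sigma> f = (SUP r\<in>{0<..<1}. \<Sum>n. ennreal (r ^ (2 * n) * energy n f))" .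
  show "hardy_norm_sq \<sigma> f \<le> (\<Sum>n. ennreal (energy n f))"
    unfolding eq
    by (intro SUP_least suminf_le ennreal_leI mult_left_le_one_le summableI) (auto simp: power_le_one)
  have "(\<Sum>n<M. ennreal (energy n f)) \<le> hardy_norm_sq \<sigma> f" for M
  proof -
    have "((\<lambda>r. \<Sum>n<M. r ^ (2 * n) * energy n f) \<longlongrightarrow> (\<Sum>n<M. 1 ^ (2 * n) * energy n f)) (at_left 1)"
      by (intro tendsto_intros)
    then have "((\<lambda>r. ennreal (\<Sum>n<M. r ^ (2 * n) * energy n f)) \<longlongrightarrow> ennreal (\<Sum>n<M. energy n f)) (at_left 1)"
      by (intro tendsto_ennrealI) simp
    moreover have "\<forall>\<^sub>F r in at_left (1::real). r \<in> {0<..<1}"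
      by (rule eventually_at_left_real) simp
    then have "\<forall>\<^sub>F r in at_left 1. ennreal (\<Sum>n<M. r ^ (2 * n) * energy n f) \<le> hardy_norm_sq \<sigma> f"
    proof eventually_elim
      case (elim r)
      have "ennreal (\<Sum>n<M. r ^ (2 * n) * energy n f) = (\<Sum>n<M. ennreal (r ^ (2 * n) * energy n f))"
        using elim by (intro sum_ennreal[symmetric]) auto
      also have "\<dots> \<le> (\<Sum>n. ennreal (r ^ (2 * n) * energy n f))" by (rule sum_le_suminf) auto
      also have "\<dots> \<le> hardy_norm_sq \<sigma> f" unfolding eq using elim by (intro SUP_upper)
      finally show ?case .
    qed
    ultimately have "ennreal (\<Sum>n<M. energy n f) \<le> hardy_norm_sq \<sigma> f"
      by (rule tendsto_upperbound) (simp add: trivial_limit_at_left_real)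
    then show ?thesis by (simp add: sum_ennreal)
  qed
  then show "(\<Sum>n. ennreal (energy n f)) \<le> hardy_norm_sq \<sigma> f"
    by (intro suminf_le_const summableI)
qed

lemma measurable_ball_indicator:
  assumes "holomorphic_ball (f :: complex ^ 'd \<Rightarrow> complex)"
  shows "(\<lambda>z. ennreal ((cmod (f z))\<^sup>2) * indicator (ball 0 1) z) \<in> borel_measurable borel"
proof -
  have "(\<lambda>z. indicator (ball 0 1) z *\<^sub>R (cmod (f z))\<^sup>2) \<in> borel_measurable borel"
    by (intro borel_measurable_continuous_on_indicator continuous_intros
          holomorphic_ball_continuous assms) simp
  then have "(\<lambda>z. ennreal (indicator (ball 0 1) z *\<^sub>R (cmod (f z))\<^sup>2)) \<in> borel_measurable borel"
    by measurable
  also have "(\<lambda>z. ennreal (indicator (ball 0 1) z *\<^sub>R (cmod (f z))\<^sup>2))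
      = (\<lambda>z. ennreal ((cmod (f z))\<^sup>2) * indicator (ball 0 1) z)"
    by (auto simp: indicator_def fun_eq_iff)
  finally show ?thesis .
qed

text \<open>
  The integral over the open ball gives the part of the moment coming from \<open>[0, 1)\<close>. The Hardy space
  term supplies exactly the missing contribution of the point \<open>1\<close>, where \<open>r\<^sup>2\<^sup>n = 1\<close>.
\<close>

lemma L2_norm_sq_eq:
  assumes f: "holomorphic_ball (f :: complex ^ 'd \<Rightarrow> complex)"
  shows "L2_norm_sq \<mu> \<sigma> f = (\<Sum>n. ennreal (moment n * energy n f))"
proof -
  define F where "F z = ennreal ((cmod (f z))\<^sup>2) * indicator (ball 0 1) z" for z
  define P where "P = (\<lambda>(r :: real, w :: complex ^ 'd). r *\<^sub>R w)"
  have F: "F \<in> borel_measurable borel"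
    unfolding F_def by (rule measurable_ball_indicator[OF f])
  have id_sphere: "(\<lambda>w. w) \<in> borel_measurable \<sigma>" by (rule measurable_continuous_on_sphere) (rule continuous_on_id)
  have id_radial: "(\<lambda>r. r) \<in> borel_measurable \<mu>" by (rule measurable_radial) simp
  have "P \<in> borel_measurable (\<mu> \<Otimes>\<^sub>M \<sigma>)"
    unfolding P_def case_prod_beta
    by (intro borel_measurable_scaleR measurable_compose[OF measurable_fst id_radial]
         measurable_compose[OF measurable_snd id_sphere])
  then have P: "P \<in> measurable (\<mu> \<Otimes>\<^sub>M \<sigma>) (restrict_space borel (cball 0 1))"
    by (intro measurable_restrict_space2)
       (auto simp: P_def space_pair_measure space_radial space_sphere)
  have "(\<integral>\<^sup>+ z\<in>ball 0 1. ennreal ((cmod (f z))\<^sup>2) \<partial>radial_measure \<mu> \<sigma>) = (\<integral>\<^sup>+ x. F (P x) \<partial>(\<mu> \<Otimes>\<^sub>M \<sigma>))"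
    unfolding radial_measure_def F_def[symmetric] P_def[symmetric]
    by (rule nn_integral_distr[OF P]) (simp add: measurable_restrict_space1[OF F])
  also have "\<dots> = (\<integral>\<^sup>+ r. \<integral>\<^sup>+ w. F (P (r, w)) \<partial>\<sigma> \<partial>\<mu>)"
    by (rule nn_integral_fst[symmetric]) (rule measurable_compose[OF P measurable_restrict_space1[OF F]])
  also have "\<dots> = (\<integral>\<^sup>+ r. indicator {..<1} r * sphere_mean f r \<partial>\<mu>)"
  proof (rule nn_integral_cong)
    fix r assume r: "r \<in> space \<mu>"
    have "(\<integral>\<^sup>+ w. F (P (r, w)) \<partial>\<sigma>) = (\<integral>\<^sup>+ w. ennreal ((cmod (f (r *\<^sub>R w)))\<^sup>2) * indicator {..<1} r \<partial>\<sigma>)"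
      using r by (intro nn_integral_cong) (auto simp: F_def P_def space_sphere space_radial indicator_def)
    also have "\<dots> = indicator {..<1} r * sphere_mean f r"
      by (auto simp: indicator_def sphere_mean_def)
    finally show "(\<integral>\<^sup>+ w. F (P (r, w)) \<partial>\<sigma>) = indicator {..<1} r * sphere_mean f r" .
  qed
  also have "\<dots> = (\<integral>\<^sup>+ r. (\<Sum>n. ennreal (energy n f) * (ennreal (r ^ (2 * n)) * indicator {..<1} r)) \<partial>\<mu>)"
  proof (rule nn_integral_cong)
    fix r assume r: "r \<in> space \<mu>"
    show "indicator {..<1} r * sphere_mean f r = (\<Sum>n. ennreal (energy n f) * (ennreal (r ^ (2 * n)) * indicator {..<1} r))"
      using sphere_mean_eq[OF f, of r] r
      by (auto simp: space_radial indicator_def ennreal_mult mult.commute)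
  qed
  also have "\<dots> = (\<Sum>n. \<integral>\<^sup>+ r. ennreal (energy n f) * (ennreal (r ^ (2 * n)) * indicator {..<1} r) \<partial>\<mu>)"
    by (intro nn_integral_suminf measurable_radial) simp
  also have "\<dots> = (\<Sum>n. ennreal (energy n f) * (\<integral>\<^sup>+ r. ennreal (r ^ (2 * n)) * indicator {..<1} r \<partial>\<mu>))"
    by (intro suminf_cong nn_integral_cmult measurable_radial) simp
  finally have 1: "(\<integral>\<^sup>+ z\<in>ball 0 1. ennreal ((cmod (f z))\<^sup>2) \<partial>radial_measure \<mu> \<sigma>) =
     (\<Sum>n. ennreal (energy n f) * (\<integral>\<^sup>+ r. ennreal (r ^ (2 * n)) * indicator {..<1} r \<partial>\<mu>))" .
  have s1: "{1} \<in> sets \<mu>" unfolding sets_radial by (subst sets_restrict_space_iff) auto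
  have m: "(\<integral>\<^sup>+ r. ennreal (r ^ (2 * n)) * indicator {..<1} r \<partial>\<mu>) + emeasure \<mu> {1} = ennreal (moment n)" for n
  proof -
    have "ennreal (moment n) = (\<integral>\<^sup>+ r. ennreal (r ^ (2 * n)) * indicator {..<1} r + indicator {1} r \<partial>\<mu>)"
      unfolding ennreal_moment
      by (intro nn_integral_cong) (auto simp: space_radial indicator_def)
    also have "\<dots> = (\<integral>\<^sup>+ r. ennreal (r ^ (2 * n)) * indicator {..<1} r \<partial>\<mu>) + (\<integral>\<^sup>+ r. indicator {1} r \<partial>\<mu>)"
      by (intro nn_integral_add measurable_radial) auto
    finally show ?thesis using s1 by simp
  qed
  have "L2_norm_sq \<mu> \<sigma> f = (\<Sum>n. ennreal (energy n f) * (\<integral>\<^sup>+ r. ennreal (r ^ (2 * n)) * indicator {..<1} r \<partial>\<mu>))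
      + (\<Sum>n. emeasure \<mu> {1} * ennreal (energy n f))"
    unfolding L2_norm_sq_def 1 hardy_norm_sq_eq[OF f] ennreal_suminf_cmult ..
  also have "\<dots> = (\<Sum>n. ennreal (energy n f) * (\<integral>\<^sup>+ r. ennreal (r ^ (2 * n)) * indicator {..<1} r \<partial>\<mu>)
      + emeasure \<mu> {1} * ennreal (energy n f))"
    by (rule suminf_add) auto
  also have "\<dots> = (\<Sum>n. ennreal (moment n * energy n f))"
    by (intro suminf_cong) (simp add: m[symmetric] ennreal_mult'' distrib_left mult.commute)
  finally show ?thesis .
qed

text \<open>
  Equivalent to the square of the Besov norm. The factor \<open>n + 1\<close> in place of \<open>n\<close> keeps the constant term
  and makes the definition uniform in \<open>k\<close>, including \<open>k = 0\<close>.
\<close>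

definition besov_norm_sq :: "nat \<Rightarrow> (complex ^ 'd \<Rightarrow> complex) \<Rightarrow> ennreal" where
  "besov_norm_sq k f = (\<Sum>n. ennreal (real (Suc n) ^ (2 * k) * (moment n * energy n f)))"

lemma holomorphic_radial_pow:
  "holomorphic_ball f \<Longrightarrow> holomorphic_ball ((radial_deriv ^^ k) f)"
  by (induction k) (auto intro: holomorphic_ball_radial_deriv)

lemma energy_radial_pow:
  "holomorphic_ball f \<Longrightarrow> energy n ((radial_deriv ^^ k) f) = real n ^ (2 * k) * energy n f"
  by (induction k) (simp_all add: energy_radial_deriv holomorphic_radial_pow power2_eq_square)

lemma besov_space_iff:
  "f \<in> besov_space \<mu> \<sigma> k \<longleftrightarrow> holomorphic_ball f \<and> besov_norm_sq k f < \<infinity>"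
proof (cases "holomorphic_ball f")
  case True
  have eq: "L2_norm_sq \<mu> \<sigma> ((radial_deriv ^^ k) f) = (\<Sum>n. ennreal (real n ^ (2 * k) * (moment n * energy n f)))"
    by (simp add: L2_norm_sq_eq holomorphic_radial_pow True energy_radial_pow mult.left_commute)
  have "L2_norm_sq \<mu> \<sigma> ((radial_deriv ^^ k) f) \<le> besov_norm_sq k f"
    unfolding eq besov_norm_sq_def
    by (intro suminf_le ennreal_leI mult_right_mono power_mono summableI) auto
  moreover have "besov_norm_sq k f \<le> ennreal (2 ^ (2 * k)) * L2_norm_sq \<mu> \<sigma> ((radial_deriv ^^ k) f) + ennreal (moment 0 * energy 0 f)"
  proof -
    have "besov_norm_sq k f = (\<Sum>n. ennreal (real (Suc (Suc n)) ^ (2 * k) * (moment (Suc n) * energy (Suc n) f)))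
             + ennreal (moment 0 * energy 0 f)"
      unfolding besov_norm_sq_def by (subst suminf_offset[of _ 1]) (auto simp: add.commute)
    also have "(\<Sum>n. ennreal (real (Suc (Suc n)) ^ (2 * k) * (moment (Suc n) * energy (Suc n) f)))
        \<le> (\<Sum>n. ennreal (2 ^ (2 * k)) * ennreal (real (Suc n) ^ (2 * k) * (moment (Suc n) * energy (Suc n) f)))"
    proof (intro suminf_le summableI)
      fix n
      have "real (Suc (Suc n)) ^ (2 * k) \<le> (2 * real (Suc n)) ^ (2 * k)" by (intro power_mono) auto
      also have "\<dots> = 2 ^ (2 * k) * real (Suc n) ^ (2 * k)" by (rule power_mult_distrib)
      finally have "real (Suc (Suc n)) ^ (2 * k) * (moment (Suc n) * energy (Suc n) f)
        \<le> 2 ^ (2 * k) * real (Suc n) ^ (2 * k) * (moment (Suc n) * energy (Suc n) f)"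
        by (rule mult_right_mono) simp
      then show "ennreal (real (Suc (Suc n)) ^ (2 * k) * (moment (Suc n) * energy (Suc n) f))
        \<le> ennreal (2 ^ (2 * k)) * ennreal (real (Suc n) ^ (2 * k) * (moment (Suc n) * energy (Suc n) f))"
        by (subst ennreal_mult[symmetric]) (auto simp: mult.assoc intro: ennreal_leI)
    qed
    also have "\<dots> \<le> ennreal (2 ^ (2 * k)) * L2_norm_sq \<mu> \<sigma> ((radial_deriv ^^ k) f)"
      unfolding eq ennreal_suminf_cmult
      by (intro mult_left_mono, subst (2) suminf_offset[of _ 1]) auto
    finally show ?thesis by (simp add: add_right_mono)
  qed
  ultimately show ?thesis
    using True by (auto simp: besov_space_def ennreal_mult_less_top intro: le_less_trans)
qed (simp add: besov_space_def)

text \<open>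
  The partial sums are continuous for locally uniform convergence, which the full norm is not; they
  serve to pass to limits.
\<close>

definition besov_norm_sq_upto :: "nat \<Rightarrow> nat \<Rightarrow> (complex ^ 'd \<Rightarrow> complex) \<Rightarrow> real" where
  "besov_norm_sq_upto k M f = (\<Sum>n<M. real (Suc n) ^ (2 * k) * (moment n * energy n f))"

lemma besov_norm_sq_upto_nonneg [simp]: "besov_norm_sq_upto k M f \<ge> 0"
  unfolding besov_norm_sq_upto_def by (intro sum_nonneg) simp

lemma besov_norm_sq_upto_le_besov_norm_sq: "ennreal (besov_norm_sq_upto k M f) \<le> besov_norm_sq k f"
proof -
  have "ennreal (besov_norm_sq_upto k M f) = (\<Sum>n<M. ennreal (real (Suc n) ^ (2 * k) * (moment n * energy n f)))"
    unfolding besov_norm_sq_upto_def by (intro sum_ennreal[symmetric]) simp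
  also have "\<dots> \<le> besov_norm_sq k f" unfolding besov_norm_sq_def by (rule sum_le_suminf) auto
  finally show ?thesis .
qed

lemma besov_norm_sq_le_const:
  assumes "\<And>M. besov_norm_sq_upto k M f \<le> B"
  shows "besov_norm_sq k f \<le> ennreal B"
  unfolding besov_norm_sq_def
proof (intro suminf_le_const summableI)
  fix M
  have "(\<Sum>n<M. ennreal (real (Suc n) ^ (2 * k) * (moment n * energy n f))) = ennreal (besov_norm_sq_upto k M f)"
    unfolding besov_norm_sq_upto_def by (intro sum_ennreal) simp
  also have "\<dots> \<le> ennreal B" using assms by (rule ennreal_leI)
  finally show "(\<Sum>n<M. ennreal (real (Suc n) ^ (2 * k) * (moment n * energy n f))) \<le> ennreal B" .
qed

lemma besov_norm_sq_cong: "(\<And>z. z \<in> ball 0 1 \<Longrightarrow> f z = g z) \<Longrightarrow> besov_norm_sq k f = besov_norm_sq k g"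
  unfolding besov_norm_sq_def using energy_cong[of f g] by simp

lemma besov_norm_sq_cmult:
  assumes "holomorphic_ball f"
  shows "besov_norm_sq k (\<lambda>z. c * f z) = ennreal ((cmod c)\<^sup>2) * besov_norm_sq k f"
  unfolding besov_norm_sq_def ennreal_suminf_cmult[symmetric]
  by (simp add: energy_cmult[OF assms] ennreal_mult[symmetric] mult_ac)

lemma besov_norm_sq_parallelogram:
  assumes "holomorphic_ball f" "holomorphic_ball g"
  shows "besov_norm_sq k (\<lambda>z. f z + g z) + besov_norm_sq k (\<lambda>z. f z - g z) = 2 * besov_norm_sq k f + 2 * besov_norm_sq k g"
proof -
  define c where "c n = real (Suc n) ^ (2 * k) * moment n" for n
  have c: "c n \<ge> 0" for n by (simp add: c_def)
  have w: "besov_norm_sq k f = (\<Sum>n. ennreal (c n * energy n f))" for f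
    by (simp add: besov_norm_sq_def c_def mult.assoc)
  have "besov_norm_sq k (\<lambda>z. f z + g z) + besov_norm_sq k (\<lambda>z. f z - g z)
     = (\<Sum>n. ennreal (c n * energy n (\<lambda>z. f z + g z)) + ennreal (c n * energy n (\<lambda>z. f z - g z)))"
    unfolding w by (rule suminf_add) auto
  also have "\<dots> = (\<Sum>n. 2 * ennreal (c n * energy n f) + 2 * ennreal (c n * energy n g))"
  proof (rule suminf_cong)
    fix n
    have "c n * energy n (\<lambda>z. f z + g z) + c n * energy n (\<lambda>z. f z - g z)
       = 2 * (c n * energy n f) + 2 * (c n * energy n g)"
      using arg_cong[OF energy_parallelogram[OF assms, of n], of "\<lambda>x. c n * x"] by (simp add: algebra_simps)
    then have "ennreal (c n * energy n (\<lambda>z. f z + g z) + c n * energy n (\<lambda>z. f z - g z))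
       = ennreal (2 * (c n * energy n f) + 2 * (c n * energy n g))" by simp
    then show "ennreal (c n * energy n (\<lambda>z. f z + g z)) + ennreal (c n * energy n (\<lambda>z. f z - g z))
       = 2 * ennreal (c n * energy n f) + 2 * ennreal (c n * energy n g)"
      using c[of n] by (simp add: ennreal_mult)
  qed
  also have "\<dots> = 2 * besov_norm_sq k f + 2 * besov_norm_sq k g"
    unfolding w ennreal_suminf_cmult[symmetric] by (rule suminf_add[symmetric]) auto
  finally show ?thesis .
qed

lemma besov_norm_sq_add_le:
  assumes "holomorphic_ball f" "holomorphic_ball g" "\<delta> > 0"
  shows "besov_norm_sq k (\<lambda>z. f z + g z) \<le> ennreal (1 + \<delta>) * besov_norm_sq k f + ennreal (1 + 1 / \<delta>) * besov_norm_sq k g"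
proof -
  define c where "c n = real (Suc n) ^ (2 * k) * moment n" for n
  have c: "c n \<ge> 0" for n by (simp add: c_def)
  have w: "besov_norm_sq k f = (\<Sum>n. ennreal (c n * energy n f))" for f
    by (simp add: besov_norm_sq_def c_def mult.assoc)
  have "besov_norm_sq k (\<lambda>z. f z + g z) \<le> (\<Sum>n. ennreal (1 + \<delta>) * ennreal (c n * energy n f) + ennreal (1 + 1 / \<delta>) * ennreal (c n * energy n g))"
    unfolding w
  proof (intro suminf_le summableI)
    fix n
    have "c n * energy n (\<lambda>z. f z + g z) \<le> (1 + \<delta>) * (c n * energy n f) + (1 + 1 / \<delta>) * (c n * energy n g)"
      using mult_left_mono[OF energy_add_le[OF assms, of n] c[of n]] by (simp add: algebra_simps)
    then have "ennreal (c n * energy n (\<lambda>z. f z + g z)) \<le> ennreal ((1 + \<delta>) * (c n * energy n f) + (1 + 1 / \<delta>) * (c n * energy n g))"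
      by (rule ennreal_leI)
    also have "\<dots> = ennreal (1 + \<delta>) * ennreal (c n * energy n f) + ennreal (1 + 1 / \<delta>) * ennreal (c n * energy n g)"
      using c[of n] assms(3) by (simp add: ennreal_mult ennreal_plus del: ennreal_plus[symmetric])
    finally show "ennreal (c n * energy n (\<lambda>z. f z + g z)) \<le> ennreal (1 + \<delta>) * ennreal (c n * energy n f) + ennreal (1 + 1 / \<delta>) * ennreal (c n * energy n g)" .
  qed
  also have "\<dots> = ennreal (1 + \<delta>) * besov_norm_sq k f + ennreal (1 + 1 / \<delta>) * besov_norm_sq k g"
    unfolding w ennreal_suminf_cmult[symmetric] by (rule suminf_add[symmetric]) auto
  finally show ?thesis .
qed

lemma besov_norm_sq_upto_add_le2:
  assumes "holomorphic_ball f" "holomorphic_ball g"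
  shows "besov_norm_sq_upto k M (\<lambda>z. f z + g z) \<le> 2 * besov_norm_sq_upto k M f + 2 * besov_norm_sq_upto k M g"
  unfolding besov_norm_sq_upto_def sum_distrib_left sum.distrib[symmetric]
proof (rule sum_mono)
  fix n
  show "real (Suc n) ^ (2 * k) * (moment n * energy n (\<lambda>z. f z + g z))
    \<le> 2 * (real (Suc n) ^ (2 * k) * (moment n * energy n f)) + 2 * (real (Suc n) ^ (2 * k) * (moment n * energy n g))"
    using mult_left_mono[OF energy_add_le2[OF assms, of n], of "real (Suc n) ^ (2 * k) * moment n"]
    by (simp add: algebra_simps)
qed

lemma besov_norm_sq_upto_bound:
  assumes "0 < r" "r < 1"
  obtains \<kappa> where "\<kappa> \<ge> 0"
    "\<And>f s. holomorphic_ball f \<Longrightarrow> (\<And>z. norm z \<le> r \<Longrightarrow> cmod (f z) \<le> s) \<Longrightarrow> besov_norm_sq_upto k M f \<le> \<kappa> * s\<^sup>2"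
proof
  define \<kappa> where "\<kappa> = (\<Sum>n<M. real (Suc n) ^ (2 * k) * (moment n / r ^ (2 * n)))"
  show "\<kappa> \<ge> 0" unfolding \<kappa>_def using assms by (intro sum_nonneg) simp
  fix f :: "complex ^ 'd \<Rightarrow> complex" and s assume f: "holomorphic_ball f" "\<And>z. norm z \<le> r \<Longrightarrow> cmod (f z) \<le> s"
  show "besov_norm_sq_upto k M f \<le> \<kappa> * s\<^sup>2"
    unfolding besov_norm_sq_upto_def \<kappa>_def sum_distrib_right
  proof (rule sum_mono)
    fix n
    show "real (Suc n) ^ (2 * k) * (moment n * energy n f) \<le> real (Suc n) ^ (2 * k) * (moment n / r ^ (2 * n)) * s\<^sup>2"
      using mult_left_mono[OF energy_bound[OF f assms, of n], of "real (Suc n) ^ (2 * k) * moment n"]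
      by (simp add: mult_ac)
  qed
qed

lemma besov_holomorphic: "f \<in> besov_space \<mu> \<sigma> k \<Longrightarrow> holomorphic_ball f"
  by (simp add: besov_space_iff)

lemma besov_cong:
  assumes "\<And>z. z \<in> ball 0 1 \<Longrightarrow> f z = g z" "f \<in> besov_space \<mu> \<sigma> k"
  shows "g \<in> besov_space \<mu> \<sigma> k"
  unfolding besov_space_iff
proof
  show "holomorphic_ball g"
    using assms(2) by (intro holomorphic_ball_cong[OF assms(1)]) (auto simp: besov_space_iff)
  have "besov_norm_sq k f = besov_norm_sq k g" by (rule besov_norm_sq_cong) (rule assms(1))
  then show "besov_norm_sq k g < \<infinity>" using assms(2) by (simp add: besov_space_iff)
qed

lemma besov_cmult: "f \<in> besov_space \<mu> \<sigma> k \<Longrightarrow> (\<lambda>z. c * f z) \<in> besov_space \<mu> \<sigma> k"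
  by (auto simp: besov_space_iff besov_norm_sq_cmult ennreal_mult_less_top)

lemma besov_add:
  assumes "f \<in> besov_space \<mu> \<sigma> k" "g \<in> besov_space \<mu> \<sigma> k"
  shows "(\<lambda>z. f z + g z) \<in> besov_space \<mu> \<sigma> k"
  using assms besov_norm_sq_add_le[of f g 1 k]
  by (auto simp: besov_space_iff ennreal_mult_less_top intro: le_less_trans)

lemma besov_diff:
  assumes "f \<in> besov_space \<mu> \<sigma> k" "g \<in> besov_space \<mu> \<sigma> k"
  shows "(\<lambda>z. f z - g z) \<in> besov_space \<mu> \<sigma> k"
  using besov_add[OF assms(1) besov_cmult[OF assms(2), of "-1"]] by simp

lemma besov_norm_sq_const: "besov_norm_sq k (\<lambda>_. c) = ennreal (moment 0 * (cmod c)\<^sup>2)"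
proof -
  have h: "homog_part n (\<lambda>_. c) w = (if n = 0 then c else 0)" for n and w :: "complex ^ 'd"
    by (rule homog_part_unique[of 1]) (use sums_single[of 0 "\<lambda>_. c"] in \<open>auto simp: if_distrib[of "\<lambda>x. x * _"] cong: if_cong\<close>)
  have "energy n (\<lambda>_. c) = (if n = 0 then (cmod c)\<^sup>2 else 0)" for n
    by (simp add: energy_def h measure_space_1)
  then have "besov_norm_sq k (\<lambda>_. c) = (\<Sum>n. if n \<in> {0} then ennreal (moment 0 * (cmod c)\<^sup>2) else 0)"
    unfolding besov_norm_sq_def by (intro suminf_cong) simp
  also have "\<dots> = (\<Sum>n\<in>{0::nat}. ennreal (moment 0 * (cmod c)\<^sup>2))"
    by (subst suminf_finite[of "{0}"]) auto
  finally show ?thesis by simp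
qed

lemma besov_const: "(\<lambda>_. c) \<in> besov_space \<mu> \<sigma> k"
  by (simp add: besov_space_iff besov_norm_sq_const)

lemma besov_multD: "\<phi> \<in> besov_mult \<mu> \<sigma> k \<Longrightarrow> f \<in> besov_space \<mu> \<sigma> k \<Longrightarrow> (\<lambda>z. \<phi> z * f z) \<in> besov_space \<mu> \<sigma> k"
  unfolding besov_mult_def by blast

lemma besov_mult_holomorphic:
  assumes "\<phi> \<in> besov_mult \<mu> \<sigma> k"
  shows "holomorphic_ball \<phi>"
proof -
  have "(\<lambda>z. \<phi> z * 1) \<in> besov_space \<mu> \<sigma> k"
    by (rule besov_multD[OF assms besov_const])
  then show ?thesis using besov_holomorphic by simp
qed

section \<open>Continuity of multiplication by a multiplier\<close>

text \<open>
  If multiplication is not continuous at \<open>0\<close>, then by scaling there are arbitrarily small functions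
  whose product with \<open>\<phi>\<close> has any prescribed norm.
\<close>

lemma small_vector_of_large_product:
  assumes \<phi>: "\<phi> \<in> besov_mult \<mu> \<sigma> N"
    and neg: "\<And>C r. C > 0 \<Longrightarrow> 0 < r \<Longrightarrow> r < 1 \<Longrightarrow> \<exists>f s. f \<in> besov_space \<mu> \<sigma> N \<and>
       (\<forall>z. norm z \<le> r \<longrightarrow> cmod (f z) \<le> s) \<and> besov_norm_sq N (\<lambda>z. \<phi> z * f z) > ennreal C * (besov_norm_sq N f + ennreal (s\<^sup>2))"
    and "K > 0" "\<eta> > 0" "0 < r" "r < 1"
  shows "\<exists>f \<in> besov_space \<mu> \<sigma> N. besov_norm_sq N f \<le> ennreal \<eta> \<and> (\<forall>z. norm z \<le> r \<longrightarrow> cmod (f z) \<le> \<eta>) \<and>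
    besov_norm_sq N (\<lambda>z. \<phi> z * f z) = ennreal K"
proof -
  \<comment> \<open>\<open>e\<close> will bound the squared norm, by \<open>\<eta>\<close>, and the square of the supremum, by \<open>\<eta>\<^sup>2\<close>\<close>
  define e where "e = min \<eta> (\<eta>\<^sup>2)"
  have e: "e > 0" "e \<le> \<eta>" "e \<le> \<eta>\<^sup>2" using \<open>\<eta> > 0\<close> by (auto simp: e_def)
  obtain f s where f: "f \<in> besov_space \<mu> \<sigma> N" "\<And>z. norm z \<le> r \<Longrightarrow> cmod (f z) \<le> s"
      "besov_norm_sq N (\<lambda>z. \<phi> z * f z) > ennreal (K / e) * (besov_norm_sq N f + ennreal (s\<^sup>2))"
    using neg[of "K / e" r] assms(3,5,6) e(1) by (auto simp: divide_pos_pos)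
  have s: "s \<ge> 0" using order_trans[OF norm_ge_zero f(2)[of 0]] \<open>0 < r\<close> by simp
  have fin: "besov_norm_sq N (\<lambda>z. \<phi> z * f z) < \<infinity>" "besov_norm_sq N f < \<infinity>"
    using besov_multD[OF \<phi> f(1)] f(1) by (auto simp: besov_space_iff)
  define w where "w = enn2real (besov_norm_sq N (\<lambda>z. \<phi> z * f z))"
  define v where "v = enn2real (besov_norm_sq N f)"
  have w: "besov_norm_sq N (\<lambda>z. \<phi> z * f z) = ennreal w" and v: "besov_norm_sq N f = ennreal v" "v \<ge> 0"
    using fin by (auto simp: w_def v_def)
  have "ennreal (K / e * (v + s\<^sup>2)) = ennreal (K / e) * (ennreal v + ennreal (s\<^sup>2))"
    using v(2) assms(3) e(1) by (subst ennreal_mult) auto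
  then have "ennreal (K / e * (v + s\<^sup>2)) < ennreal w"
    using f(3) by (simp only: v(1) w)
  then have lt: "K / e * (v + s\<^sup>2) < w" 
    using v assms(3) e(1) by (subst (asm) ennreal_less_iff) auto
  moreover have "0 \<le> K / e * (v + s\<^sup>2)" using v(2) assms(3) e(1) by simp
  ultimately have w0: "w > 0" by linarith
  define c where "c = sqrt (K / w)"
  have c: "c \<ge> 0" "c\<^sup>2 = K / w" using w0 assms(3) by (auto simp: c_def)
  have "c\<^sup>2 * (v + s\<^sup>2) \<le> e"
    using lt w0 e(1) assms(3) unfolding c(2) by (simp add: field_simps)
  moreover have "0 \<le> c\<^sup>2 * v" "0 \<le> c\<^sup>2 * s\<^sup>2" using v(2) by auto
  ultimately have cv: "c\<^sup>2 * v \<le> \<eta>" "(c * s)\<^sup>2 \<le> \<eta>\<^sup>2"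
    using e unfolding distrib_left power_mult_distrib by linarith+
  have cs: "c * s \<le> \<eta>" by (rule power2_le_imp_le[OF cv(2)]) (use \<open>\<eta> > 0\<close> in simp)
  show ?thesis
  proof (intro bexI conjI allI impI)
    show "(\<lambda>z. of_real c * f z) \<in> besov_space \<mu> \<sigma> N" by (rule besov_cmult[OF f(1)])
    show "besov_norm_sq N (\<lambda>z. of_real c * f z) \<le> ennreal \<eta>"
      using cv(1) c(1) v(2) by (simp add: besov_norm_sq_cmult besov_holomorphic[OF f(1)] v(1) ennreal_mult[symmetric] ennreal_leI)
    show "cmod (of_real c * f z) \<le> \<eta>" if "norm z \<le> r" for z
      using mult_left_mono[OF f(2)[OF that] c(1)] cs c(1) by (simp add: norm_mult)
    have "besov_norm_sq N (\<lambda>z. of_real c * (\<phi> z * f z)) = ennreal K"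
      using w0 c assms(3) by (simp add: besov_norm_sq_cmult besov_holomorphic[OF besov_multD[OF \<phi> f(1)]] w ennreal_mult[symmetric])
    then show "besov_norm_sq N (\<lambda>z. \<phi> z * (of_real c * f z)) = ennreal K" by (simp add: mult.left_commute)
  qed
qed

text \<open>
  One step of the gliding hump. A small \<open>f\<close> with large \<open>\<phi> f\<close> is added to \<open>x\<close> or subtracted from it; by the
  parallelogram law one of the two choices makes \<open>\<phi> x'\<close> large. Largeness is visible in a finite partial
  sum and hence persists for all \<open>y\<close> that are uniformly close to \<open>x'\<close> on the ball of radius \<open>1/2\<close>.
\<close>

lemma gliding_hump_step:
  assumes \<phi>: "\<phi> \<in> besov_mult \<mu> \<sigma> N"
    and small: "\<And>K \<eta> r. K > 0 \<Longrightarrow> \<eta> > 0 \<Longrightarrow> 0 < r \<Longrightarrow> r < 1 \<Longrightarrow>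
       \<exists>f \<in> besov_space \<mu> \<sigma> N. besov_norm_sq N f \<le> ennreal \<eta> \<and> (\<forall>z. norm z \<le> r \<longrightarrow> cmod (f z) \<le> \<eta>) \<and>
        besov_norm_sq N (\<lambda>z. \<phi> z * f z) = ennreal K"
    and x: "x \<in> besov_space \<mu> \<sigma> N" "besov_norm_sq N x < 1" and "\<epsilon> > 0" and r: "1/2 \<le> r" "r < 1"
  shows "\<exists>x' \<epsilon>'. x' \<in> besov_space \<mu> \<sigma> N \<and> besov_norm_sq N x' < 1 \<and> \<epsilon>' > 0 \<and> \<epsilon>' \<le> \<epsilon> / 2 \<and>
     (\<forall>z. norm z \<le> r \<longrightarrow> cmod (x' z - x z) \<le> \<epsilon> / 2) \<and>
     (\<forall>y. holomorphic_ball y \<longrightarrow> (\<forall>z. norm z \<le> 1/2 \<longrightarrow> cmod (y z - x' z) \<le> \<epsilon>') \<longrightarrow>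
        besov_norm_sq N (\<lambda>z. \<phi> z * y z) \<ge> ennreal (real k))"
proof -
  note hx = besov_holomorphic[OF x(1)] and h\<phi> = besov_mult_holomorphic[OF \<phi>]
  obtain q where q: "besov_norm_sq N x = ennreal q" "0 \<le> q" "q < 1"
    using x(2) by (cases "besov_norm_sq N x") (auto simp: ennreal_less_one_iff)
  \<comment> \<open>with these \<open>\<delta>\<close> and \<open>\<eta>\<close>, adding \<open>c f\<close> raises the squared norm by at most half of the gap \<open>1 - q\<close>\<close>
  define \<delta> where "\<delta> = (1 - q) / 4"
  have \<delta>: "\<delta> > 0" "(1 + \<delta>) * q \<le> q + (1 - q) / 4"
    using q by (auto simp: \<delta>_def distrib_right intro: mult_left_le)
  define \<eta> where "\<eta> = min (\<epsilon> / 2) ((1 - q) / 4 / (1 + 1 / \<delta>))"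
  have d1: "1 + 1 / \<delta> > 0" using \<delta>(1) by (simp add: add_pos_pos)
  have \<eta>: "\<eta> > 0" "\<eta> \<le> \<epsilon> / 2" "(1 + 1 / \<delta>) * \<eta> \<le> (1 - q) / 4"
  proof -
    show "\<eta> > 0" using \<open>\<epsilon> > 0\<close> q(3) d1 by (simp add: \<eta>_def)
    show "\<eta> \<le> \<epsilon> / 2" unfolding \<eta>_def by (rule min.cobounded1)
    have "(1 + 1 / \<delta>) * \<eta> \<le> (1 + 1 / \<delta>) * ((1 - q) / 4 / (1 + 1 / \<delta>))"
      using d1 by (intro mult_left_mono) (auto simp: \<eta>_def)
    also have "\<dots> = (1 - q) / 4"
      using d1 by (metis less_irrefl nonzero_mult_div_cancel_left times_divide_eq_right)
    finally show "(1 + 1 / \<delta>) * \<eta> \<le> (1 - q) / 4" .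
  qed
  obtain f where f: "f \<in> besov_space \<mu> \<sigma> N" "besov_norm_sq N f \<le> ennreal \<eta>"
      "\<And>z. norm z \<le> r \<Longrightarrow> cmod (f z) \<le> \<eta>" "besov_norm_sq N (\<lambda>z. \<phi> z * f z) = ennreal (2 * real k + 3)"
    using small[of "2 * real k + 3" \<eta> r] \<eta>(1) r by auto
  note hf = besov_holomorphic[OF f(1)]
  have lt1: "besov_norm_sq N (\<lambda>z. x z + c * f z) < 1" if "cmod c = 1" for c
  proof -
    have "besov_norm_sq N (\<lambda>z. x z + c * f z) \<le> ennreal (1 + \<delta>) * besov_norm_sq N x + ennreal (1 + 1 / \<delta>) * besov_norm_sq N (\<lambda>z. c * f z)"
      by (intro besov_norm_sq_add_le hx holomorphic_ball_cmult hf \<delta>)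
    also have "\<dots> \<le> ennreal (1 + \<delta>) * ennreal q + ennreal (1 + 1 / \<delta>) * ennreal \<eta>"
      using f(2) that by (intro add_mono mult_left_mono) (auto simp: besov_norm_sq_cmult[OF hf] q(1))
    also have "\<dots> = ennreal ((1 + \<delta>) * q + (1 + 1 / \<delta>) * \<eta>)"
      using q(2) \<delta>(1) \<eta>(1) by (subst ennreal_plus) (auto simp: ennreal_mult intro!: mult_nonneg_nonneg)
    also have "\<dots> < ennreal 1"
    proof (subst ennreal_less_iff)
      have "A + B < 1" if "A \<le> q + (1 - q) / 4" "B \<le> (1 - q) / 4" for A B :: real
        using that q(3) by argo
      from this[OF \<delta>(2) \<eta>(3)] show "(1 + \<delta>) * q + (1 + 1 / \<delta>) * \<eta> < 1" .
      show "0 \<le> (1 + \<delta>) * q + (1 + 1 / \<delta>) * \<eta>"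
        using q(2) \<delta>(1) \<eta>(1) by (intro add_nonneg_nonneg mult_nonneg_nonneg) auto
    qed
    finally show ?thesis by simp
  qed
  have big: "\<exists>c. cmod c = 1 \<and> besov_norm_sq N (\<lambda>z. \<phi> z * (x z + c * f z)) > ennreal (2 * real k + 2)"
  proof (rule ccontr)
    assume "\<not> ?thesis"
    then have le: "besov_norm_sq N (\<lambda>z. \<phi> z * (x z + c * f z)) \<le> ennreal (2 * real k + 2)" if "cmod c = 1" for c
      using that by (auto simp: not_less)
    have "2 * ennreal (2 * real k + 3) \<le> 2 * besov_norm_sq N (\<lambda>z. \<phi> z * x z) + 2 * besov_norm_sq N (\<lambda>z. \<phi> z * f z)"
      by (simp add: f(4))
    also have "\<dots> = besov_norm_sq N (\<lambda>z. \<phi> z * x z + \<phi> z * f z) + besov_norm_sq N (\<lambda>z. \<phi> z * x z - \<phi> z * f z)"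
      by (intro besov_norm_sq_parallelogram[symmetric] holomorphic_ball_mult h\<phi> hx hf)
    also have "\<dots> \<le> ennreal (2 * real k + 2) + ennreal (2 * real k + 2)"
      using le[of 1] le[of "-1"] by (intro add_mono) (simp_all add: algebra_simps)
    also have "\<dots> = ennreal (4 * real k + 4)" by (subst ennreal_plus[symmetric]) auto
    finally have "ennreal (2 * (2 * real k + 3)) \<le> ennreal (4 * real k + 4)"
      by (simp add: ennreal_mult)
    then show False by (subst (asm) ennreal_le_iff) auto
  qed
  then obtain c where c: "cmod c = 1" "besov_norm_sq N (\<lambda>z. \<phi> z * (x z + c * f z)) > ennreal (2 * real k + 2)" by blast
  define x' where "x' z = x z + c * f z" for z
  have x': "x' \<in> besov_space \<mu> \<sigma> N" unfolding x'_def by (intro besov_add x besov_cmult f)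
  note hx' = besov_holomorphic[OF x']
  have "\<exists>M. besov_norm_sq_upto N M (\<lambda>z. \<phi> z * x' z) > 2 * real k + 2"
  proof (rule ccontr)
    assume "\<not> ?thesis"
    then have "besov_norm_sq N (\<lambda>z. \<phi> z * x' z) \<le> ennreal (2 * real k + 2)"
      by (intro besov_norm_sq_le_const) (simp add: not_less)
    with c(2) show False by (simp add: x'_def)
  qed
  then obtain M where M: "besov_norm_sq_upto N M (\<lambda>z. \<phi> z * x' z) > 2 * real k + 2" by blast
  obtain \<kappa> where \<kappa>: "\<kappa> \<ge> 0" "\<And>f s. holomorphic_ball f \<Longrightarrow> (\<And>z. norm z \<le> 1/2 \<Longrightarrow> cmod (f z) \<le> s) \<Longrightarrow> besov_norm_sq_upto N M f \<le> \<kappa> * s\<^sup>2"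
    using besov_norm_sq_upto_bound[of "1/2" N M] by auto
  obtain L where L: "L \<ge> 1" "\<And>z. norm z \<le> 1/2 \<Longrightarrow> cmod (\<phi> z) \<le> L"
    using holomorphic_ball_bounded_cball[OF h\<phi>, of "1/2"] by auto
  \<comment> \<open>chosen so that replacing \<open>x'\<close> by \<open>y\<close> costs at most \<open>2\<close> in the partial sum of index \<open>M\<close>\<close>
  define \<epsilon>' where "\<epsilon>' = min (\<epsilon> / 2) (min 1 (1 / (\<kappa> * L\<^sup>2 + 1)))"
  have kl: "\<kappa> * L\<^sup>2 \<ge> 0" using \<kappa>(1) by simp
  have \<epsilon>': "\<epsilon>' > 0" "\<epsilon>' \<le> \<epsilon> / 2" "\<kappa> * (L * \<epsilon>')\<^sup>2 \<le> 1"
  proof -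
    show "\<epsilon>' > 0" using \<open>\<epsilon> > 0\<close> kl by (simp add: \<epsilon>'_def)
    moreover have "\<epsilon>' \<le> 1" by (simp add: \<epsilon>'_def)
    ultimately have "\<epsilon>'\<^sup>2 \<le> \<epsilon>'" by (simp add: power2_eq_square mult_left_le)
    then have "\<kappa> * L\<^sup>2 * \<epsilon>'\<^sup>2 \<le> \<kappa> * L\<^sup>2 * (1 / (\<kappa> * L\<^sup>2 + 1))"
      by (intro mult_left_mono kl) (auto simp: \<epsilon>'_def intro: order_trans)
    also have "\<dots> \<le> 1" using kl by (simp add: field_simps)
    finally show "\<kappa> * (L * \<epsilon>')\<^sup>2 \<le> 1" by (simp add: power_mult_distrib)
  qed (simp add: \<epsilon>'_def)
  have fin: "besov_norm_sq N (\<lambda>z. \<phi> z * y z) \<ge> ennreal (real k)"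
    if y: "holomorphic_ball y" "\<And>z. norm z \<le> 1/2 \<Longrightarrow> cmod (y z - x' z) \<le> \<epsilon>'" for y
  proof -
    have "besov_norm_sq_upto N M (\<lambda>z. \<phi> z * (x' z - y z)) \<le> \<kappa> * (L * \<epsilon>')\<^sup>2"
    proof (rule \<kappa>(2))
      show "cmod (\<phi> z * (x' z - y z)) \<le> L * \<epsilon>'" if "norm z \<le> 1/2" for z
        using mult_mono[OF L(2)[OF that] y(2)[OF that]] L(1) by (simp add: norm_mult norm_minus_commute)
    qed (intro holomorphic_ball_mult holomorphic_ball_diff h\<phi> hx' y)
    moreover have "besov_norm_sq_upto N M (\<lambda>z. \<phi> z * y z + \<phi> z * (x' z - y z)) \<le>
       2 * besov_norm_sq_upto N M (\<lambda>z. \<phi> z * y z) + 2 * besov_norm_sq_upto N M (\<lambda>z. \<phi> z * (x' z - y z))"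
      by (intro besov_norm_sq_upto_add_le2 holomorphic_ball_mult holomorphic_ball_diff h\<phi> hx' y)
    moreover have "(\<lambda>z. \<phi> z * y z + \<phi> z * (x' z - y z)) = (\<lambda>z. \<phi> z * x' z)" by (simp add: algebra_simps)
    ultimately have "real k \<le> besov_norm_sq_upto N M (\<lambda>z. \<phi> z * y z)" using M \<epsilon>'(3) by simp
    then show ?thesis using besov_norm_sq_upto_le_besov_norm_sq order_trans ennreal_leI by blast
  qed
  have "cmod (x' z - x z) \<le> \<epsilon> / 2" if "norm z \<le> r" for z
    using f(3)[OF that] \<eta>(2) c(1) by (simp add: x'_def norm_mult)
  moreover have "besov_norm_sq N x' < 1" unfolding x'_def by (rule lt1[OF c(1)])
  ultimately show ?thesis using x' \<epsilon>' fin by blast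
qed

text \<open>
  The limit \<open>x\<close> of the gliding hump is holomorphic, lies in the Besov space because the norms stay below
  \<open>1\<close>, and has a product with \<open>\<phi>\<close> whose norm exceeds every natural number. This contradicts the
  multiplier property of \<open>\<phi>\<close>.
\<close>

lemma besov_mult_frechet_bounded:
  assumes \<phi>: "\<phi> \<in> besov_mult \<mu> \<sigma> N"
  obtains C r where "C > 0" "0 < r" "r < 1"
    "\<And>f s. f \<in> besov_space \<mu> \<sigma> N \<Longrightarrow> (\<And>z. norm z \<le> r \<Longrightarrow> cmod (f z) \<le> s) \<Longrightarrow>
       besov_norm_sq N (\<lambda>z. \<phi> z * f z) \<le> ennreal C * (besov_norm_sq N f + ennreal (s\<^sup>2))"
proof (rule ccontr)
  assume not: "\<not> thesis"
  note outer = that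
  have neg: "\<exists>f s. f \<in> besov_space \<mu> \<sigma> N \<and> (\<forall>z. norm z \<le> r \<longrightarrow> cmod (f z) \<le> s) \<and>
      besov_norm_sq N (\<lambda>z. \<phi> z * f z) > ennreal C * (besov_norm_sq N f + ennreal (s\<^sup>2))"
    if "C > 0" "0 < r" "r < 1" for C r
  proof (rule ccontr)
    assume n: "\<not> ?thesis"
    have thesis
    proof (rule outer[OF that])
      show "besov_norm_sq N (\<lambda>z. \<phi> z * f z) \<le> ennreal C * (besov_norm_sq N f + ennreal (s\<^sup>2))"
        if "f \<in> besov_space \<mu> \<sigma> N" "\<And>z. norm z \<le> r \<Longrightarrow> cmod (f z) \<le> s" for f s
        using n that by (meson not_le)
    qed
    with not show False by blast
  qed
  note hump = gliding_hump_step[OF \<phi> small_vector_of_large_product[OF \<phi> neg]]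
  define r where "r k = 1 - 1 / (real k + 2)" for k
  have r: "1/2 \<le> r k" "r k < 1" for k by (auto simp: r_def field_simps)
  have rmono: "r i \<le> r j" if "i \<le> j" for i j using that by (simp add: r_def frac_le)
  define P where "P xe \<longleftrightarrow> fst xe \<in> besov_space \<mu> \<sigma> N \<and> besov_norm_sq N (fst xe) < 1 \<and> snd xe > 0" for xe :: "(complex ^ 'd \<Rightarrow> complex) \<times> real"
  define Q where "Q k xe xe' \<longleftrightarrow> snd xe' \<le> snd xe / 2 \<and>
      (\<forall>z. norm z \<le> r k \<longrightarrow> cmod (fst xe' z - fst xe z) \<le> snd xe / 2) \<and>
      (\<forall>y. holomorphic_ball y \<longrightarrow> (\<forall>z. norm z \<le> 1/2 \<longrightarrow> cmod (y z - fst xe' z) \<le> snd xe') \<longrightarrow>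
        besov_norm_sq N (\<lambda>z. \<phi> z * y z) \<ge> ennreal (real k))" for k and xe xe' :: "(complex ^ 'd \<Rightarrow> complex) \<times> real"
  have "\<exists>xe. \<forall>k. P (xe k) \<and> Q k (xe k) (xe (Suc k))"
  proof (rule dependent_nat_choice)
    show "\<exists>xe. P xe"
      by (rule exI[of _ "(\<lambda>_. 0, 1)"]) (simp add: P_def besov_const besov_norm_sq_const)
    fix xe k assume "P xe"
    then obtain x' e' where "x' \<in> besov_space \<mu> \<sigma> N" "besov_norm_sq N x' < 1" "e' > 0" "Q k xe (x', e')"
      using hump[where x = "fst xe" and \<epsilon> = "snd xe" and r = "r k" and k = k] r[of k] unfolding P_def Q_def fst_conv snd_conv by blast
    then show "\<exists>xe'. P xe' \<and> Q k xe xe'" by (intro exI[of _ "(x', e')"]) (simp add: P_def)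
  qed
  then obtain xe where xe: "\<And>k. P (xe k)" "\<And>k. Q k (xe k) (xe (Suc k))" by blast
  define X where "X k = fst (xe k)" for k
  define E where "E k = snd (xe k)" for k
  have X: "X k \<in> besov_space \<mu> \<sigma> N" "besov_norm_sq N (X k) < 1" "E k > 0" for k
    using xe(1)[of k] by (simp_all add: P_def X_def E_def)
  have S: "E (Suc k) \<le> E k / 2" "\<And>z. norm z \<le> r k \<Longrightarrow> cmod (X (Suc k) z - X k z) \<le> E k / 2"
     "\<And>y. holomorphic_ball y \<Longrightarrow> (\<And>z. norm z \<le> 1/2 \<Longrightarrow> cmod (y z - X (Suc k) z) \<le> E (Suc k)) \<Longrightarrow>
        besov_norm_sq N (\<lambda>z. \<phi> z * y z) \<ge> ennreal (real k)" for k
    using xe(2)[of k] unfolding Q_def X_def E_def by blast+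
  \<comment> \<open>the tolerances at least halve in each step, so all later changes together are within \<open>E i\<close>\<close>
  have near: "cmod (X j z - X i z) + E j \<le> E i" if "i \<le> j" "norm z \<le> r i" for i j z
    using that(1)
  proof (induction j rule: dec_induct)
    case (step j)
    have "norm z \<le> r j" using that(2) rmono[OF step(1)] by simp
    from S(2)[OF this] S(1)[of j] step(3) show ?case
      using norm_triangle_ineq[of "X (Suc j) z - X j z" "X j z - X i z"] by simp
  qed simp
  have E2: "E k \<le> E 0 / 2 ^ k" for k
  proof (induction k)
    case (Suc k)
    then show ?case using S(1)[of k] by simp
  qed simp
  have E0: "E \<longlonglongrightarrow> 0"
  proof (rule tendsto_sandwich)
    show "\<forall>\<^sub>F k in sequentially. 0 \<le> E k" using X(3) by (simp add: less_imp_le)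
    show "\<forall>\<^sub>F k in sequentially. E k \<le> E 0 / 2 ^ k" using E2 by simp
    show "(\<lambda>k. E 0 / 2 ^ k) \<longlonglongrightarrow> 0" by real_asymp
  qed simp
  have rr: "\<exists>i. t \<le> r i" if "t < 1" for t
  proof -
    have "r \<longlonglongrightarrow> 1" unfolding r_def by real_asymp
    from order_tendstoD(1)[OF this that] show ?thesis
      unfolding eventually_sequentially using less_imp_le by blast
  qed
  define x where "x z = lim (\<lambda>j. X j z)" for z
  have lim: "(\<lambda>j. X j z) \<longlonglongrightarrow> x z" if z: "norm z \<le> r i" for i z
  proof -
    have "Cauchy (\<lambda>j. X j z)"
    proof (rule metric_CauchyI)
      fix e :: real assume "e > 0"
      then have "\<forall>\<^sub>F k in sequentially. E k < e / 2" by (intro order_tendstoD(2)[OF E0]) simp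
      then obtain k where k: "k \<ge> i" "E k < e / 2"
        unfolding eventually_sequentially by (metis nle_le)
      have zk: "norm z \<le> r k" using z rmono[OF k(1)] by simp
      have "dist (X m z) (X n z) < e" if "m \<ge> k" "n \<ge> k" for m n
      proof -
        have "dist (X m z) (X k z) < e / 2" "dist (X n z) (X k z) < e / 2"
          using near[OF that(1) zk] near[OF that(2) zk] X(3)[of m] X(3)[of n] k(2)
          by (auto simp: dist_norm)
        then show ?thesis by (rule dist_triangle_half_l)
      qed
      then show "\<exists>M. \<forall>m\<ge>M. \<forall>n\<ge>M. dist (X m z) (X n z) < e" by blast
    qed
    then show ?thesis unfolding x_def by (rule convergent_LIMSEQ_iff[THEN iffD1, OF Cauchy_convergent])
  qed
  have xX: "cmod (x z - X i z) \<le> E i" if z: "norm z \<le> r i" for i z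
  proof (rule tendsto_upperbound)
    show "(\<lambda>j. cmod (X j z - X i z)) \<longlonglongrightarrow> cmod (x z - X i z)" by (intro tendsto_intros lim[OF z])
    show "\<forall>\<^sub>F j in sequentially. cmod (X j z - X i z) \<le> E i"
      using eventually_ge_at_top[of i]
    proof eventually_elim
      case (elim j)
      then show ?case using near[OF elim z] X(3)[of j] by simp
    qed
  qed simp
  have hx: "holomorphic_ball x"
  proof (rule holomorphic_ball_limit[of X])
    show "holomorphic_ball (X n)" for n by (rule besov_holomorphic[OF X(1)])
    fix t :: real assume "t < 1"
    then obtain i where i: "t \<le> r i" using rr by blast
    show "uniform_limit (cball 0 t) X x sequentially"
    proof (rule uniform_limit_bound[OF E0, where K = i])
      fix k z assume "i \<le> k" "z \<in> cball (0 :: complex ^ 'd) t"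
      then have "norm z \<le> r k" using i rmono[of i k] by simp
      from xX[OF this] show "cmod (X k z - x z) \<le> E k" by (simp add: norm_minus_commute)
    qed
  qed
  have "besov_norm_sq N x \<le> ennreal 4"
  proof (rule besov_norm_sq_le_const)
    fix M
    obtain \<kappa> where \<kappa>: "\<kappa> \<ge> 0" "\<And>f s. holomorphic_ball f \<Longrightarrow> (\<And>z. norm z \<le> 1/2 \<Longrightarrow> cmod (f z) \<le> s) \<Longrightarrow> besov_norm_sq_upto N M f \<le> \<kappa> * s\<^sup>2"
      using besov_norm_sq_upto_bound[of "1/2" N M] by auto
    have "(\<lambda>i. \<kappa> * (E i)\<^sup>2) \<longlonglongrightarrow> \<kappa> * 0\<^sup>2" by (intro tendsto_intros E0)
    then have "\<forall>\<^sub>F i in sequentially. \<kappa> * (E i)\<^sup>2 < 1" by (rule order_tendstoD(2)) simp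
    then obtain i where i: "\<kappa> * (E i)\<^sup>2 < 1" unfolding eventually_sequentially by blast
    have "besov_norm_sq_upto N M (\<lambda>z. x z - X i z) \<le> \<kappa> * (E i)\<^sup>2"
    proof (rule \<kappa>(2))
      show "cmod (x z - X i z) \<le> E i" if "norm z \<le> 1/2" for z
        using that r(1)[of i] by (intro xX) simp
    qed (intro holomorphic_ball_diff hx besov_holomorphic[OF X(1)])
    moreover have "ennreal (besov_norm_sq_upto N M (X i)) < ennreal 1"
      using le_less_trans[OF besov_norm_sq_upto_le_besov_norm_sq[of N M "X i"] X(2)[of i]] by simp
    then have "besov_norm_sq_upto N M (X i) < 1" by (subst (asm) ennreal_less_iff) auto
    moreover have "besov_norm_sq_upto N M (\<lambda>z. X i z + (x z - X i z)) \<le> 2 * besov_norm_sq_upto N M (X i) + 2 * besov_norm_sq_upto N M (\<lambda>z. x z - X i z)"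
      by (intro besov_norm_sq_upto_add_le2 holomorphic_ball_diff hx besov_holomorphic[OF X(1)])
    ultimately show "besov_norm_sq_upto N M x \<le> 4" using i by simp
  qed
  then have "x \<in> besov_space \<mu> \<sigma> N" using hx by (auto simp: besov_space_iff intro: le_less_trans)
  from besov_multD[OF \<phi> this] have "besov_norm_sq N (\<lambda>z. \<phi> z * x z) < \<infinity>" by (simp add: besov_space_iff)
  moreover have "besov_norm_sq N (\<lambda>z. \<phi> z * x z) \<ge> ennreal (real k)" for k
    by (rule S(3)[OF hx]) (use r(1)[of "Suc k"] in \<open>auto intro: xX\<close>)
  ultimately show False
    by (metis ennreal_of_nat_eq_real_of_nat infinity_ennreal_def leD ennreal_Ex_less_of_nat)
qed

section \<open>Multipliers are bounded\<close>

lemma besov_norm_sq_0: "holomorphic_ball f \<Longrightarrow> besov_norm_sq 0 f = L2_norm_sq \<mu> \<sigma> f"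
  by (simp add: besov_norm_sq_def L2_norm_sq_eq)

lemma sphere_mean_mult_le:
  assumes "\<And>z. z \<in> ball 0 1 \<Longrightarrow> cmod (h z) \<le> B" "holomorphic_ball f" "0 \<le> r" "r < 1"
  shows "sphere_mean (\<lambda>z. h z * f z) r \<le> ennreal (B\<^sup>2) * sphere_mean f r"
proof -
  have "sphere_mean (\<lambda>z. h z * f z) r \<le> (\<integral>\<^sup>+ w. ennreal (B\<^sup>2) * ennreal ((cmod (f (r *\<^sub>R w)))\<^sup>2) \<partial>\<sigma>)"
    unfolding sphere_mean_def
  proof (rule nn_integral_mono)
    fix w assume "w \<in> space \<sigma>"
    then have "cmod (h (r *\<^sub>R w)) \<le> B" using assms by (simp add: space_sphere)
    then have "(cmod (h (r *\<^sub>R w)))\<^sup>2 \<le> B\<^sup>2" by (intro power_mono) auto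
    then show "ennreal ((cmod (h (r *\<^sub>R w) * f (r *\<^sub>R w)))\<^sup>2) \<le> ennreal (B\<^sup>2) * ennreal ((cmod (f (r *\<^sub>R w)))\<^sup>2)"
      by (simp add: norm_mult power_mult_distrib ennreal_mult[symmetric] mult_right_mono ennreal_leI)
  qed
  also have "\<dots> = ennreal (B\<^sup>2) * sphere_mean f r"
    unfolding sphere_mean_def
  proof (rule nn_integral_cmult)
    have "(\<lambda>w. (cmod (f (r *\<^sub>R w)))\<^sup>2) \<in> borel_measurable \<sigma>"
      by (intro measurable_continuous_on_sphere continuous_intros
            continuous_on_compose2[OF holomorphic_ball_continuous[OF assms(2)]]) (use assms in auto)
    then show "(\<lambda>w. ennreal ((cmod (f (r *\<^sub>R w)))\<^sup>2)) \<in> borel_measurable \<sigma>" by measurable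
  qed
  finally show ?thesis .
qed

text \<open>
  The \<open>L\<^sup>2\<close> norm, unlike the sum over homogeneous components, makes it evident that bounded functions
  act boundedly.
\<close>

lemma besov_norm_sq_0_mult_le:
  assumes "\<And>z. z \<in> ball 0 1 \<Longrightarrow> cmod (h z) \<le> B" "holomorphic_ball h" "holomorphic_ball f"
  shows "besov_norm_sq 0 (\<lambda>z. h z * f z) \<le> ennreal (B\<^sup>2) * besov_norm_sq 0 f"
proof -
  have "hardy_norm_sq \<sigma> (\<lambda>z. h z * f z) \<le> ennreal (B\<^sup>2) * hardy_norm_sq \<sigma> f"
    unfolding hardy_norm_sq_sphere_mean
  proof (rule SUP_least)
    fix r :: real assume r: "r \<in> {0<..<1}"
    have "sphere_mean (\<lambda>z. h z * f z) r \<le> ennreal (B\<^sup>2) * sphere_mean f r"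
      by (rule sphere_mean_mult_le[OF assms(1,3)]) (use r in auto)
    also have "\<dots> \<le> ennreal (B\<^sup>2) * (SUP r\<in>{0<..<1}. sphere_mean f r)"
      by (intro mult_left_mono SUP_upper r) simp
    finally show "sphere_mean (\<lambda>z. h z * f z) r \<le> ennreal (B\<^sup>2) * (SUP r\<in>{0<..<1}. sphere_mean f r)" .
  qed
  then have 1: "emeasure \<mu> {1} * hardy_norm_sq \<sigma> (\<lambda>z. h z * f z) \<le> ennreal (B\<^sup>2) * (emeasure \<mu> {1} * hardy_norm_sq \<sigma> f)"
    using mult_left_mono[of "hardy_norm_sq \<sigma> (\<lambda>z. h z * f z)" _ "emeasure \<mu> {1}"] by (simp add: mult.left_commute)
  have F: "(\<lambda>z. ennreal ((cmod (f z))\<^sup>2) * indicator (ball 0 1) z) \<in> borel_measurable (radial_measure \<mu> \<sigma>)"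
    unfolding radial_measure_def
    by (simp add: measurable_restrict_space1[OF measurable_ball_indicator[OF assms(3)]])
  have "(\<integral>\<^sup>+ z\<in>ball 0 1. ennreal ((cmod (h z * f z))\<^sup>2) \<partial>radial_measure \<mu> \<sigma>)
     \<le> (\<integral>\<^sup>+ z. ennreal (B\<^sup>2) * (ennreal ((cmod (f z))\<^sup>2) * indicator (ball 0 1) z) \<partial>radial_measure \<mu> \<sigma>)"
  proof (rule nn_integral_mono)
    fix z
    show "ennreal ((cmod (h z * f z))\<^sup>2) * indicator (ball 0 1) z \<le> ennreal (B\<^sup>2) * (ennreal ((cmod (f z))\<^sup>2) * indicator (ball 0 1) z)"
    proof (cases "z \<in> ball 0 1")
      case True
      then have "(cmod (h z))\<^sup>2 \<le> B\<^sup>2" by (intro power_mono assms) auto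
      with True show ?thesis
        by (simp add: norm_mult power_mult_distrib ennreal_mult[symmetric] mult_right_mono ennreal_leI)
    qed simp
  qed
  also have "\<dots> = ennreal (B\<^sup>2) * (\<integral>\<^sup>+ z\<in>ball 0 1. ennreal ((cmod (f z))\<^sup>2) \<partial>radial_measure \<mu> \<sigma>)"
    by (rule nn_integral_cmult[OF F])
  finally show ?thesis
    using 1 by (simp add: besov_norm_sq_0 holomorphic_ball_mult assms L2_norm_sq_def distrib_left add_mono)
qed

lemma besov_mult_power_in_space: "\<phi> \<in> besov_mult \<mu> \<sigma> N \<Longrightarrow> (\<lambda>z. \<phi> z ^ j) \<in> besov_space \<mu> \<sigma> N"
  by (induction j) (simp_all add: besov_const besov_multD)

text \<open>
  Iterate the continuity estimate along \<open>\<phi>\<^sup>j\<^sup>+\<^sup>1 = \<phi> \<phi>\<^sup>j\<close>; the supremum of \<open>\<phi>\<^sup>j\<close> on the smaller ball is at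
  most \<open>L\<^sup>j\<close>.
\<close>

lemma besov_mult_power_growth:
  assumes \<phi>: "\<phi> \<in> besov_mult \<mu> \<sigma> N"
  obtains A B where "A \<ge> 1" "B \<ge> 0" "cmod (\<phi> 0) ^ 2 \<le> A" "\<And>j. besov_norm_sq N (\<lambda>z. \<phi> z ^ j) \<le> ennreal (B * A ^ j)"
proof -
  obtain C r where C: "C > 0" "0 < r" "r < 1"
    "\<And>f s. f \<in> besov_space \<mu> \<sigma> N \<Longrightarrow> (\<And>z. norm z \<le> r \<Longrightarrow> cmod (f z) \<le> s) \<Longrightarrow>
       besov_norm_sq N (\<lambda>z. \<phi> z * f z) \<le> ennreal C * (besov_norm_sq N f + ennreal (s\<^sup>2))"
    using besov_mult_frechet_bounded[OF \<phi>] by blast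
  obtain L where L: "L \<ge> 1" "\<And>z. norm z \<le> r \<Longrightarrow> cmod (\<phi> z) \<le> L"
    using holomorphic_ball_bounded_cball[OF besov_mult_holomorphic[OF \<phi>] C(3)] by blast
  \<comment> \<open>\<open>L\<^sup>2 \<le> A\<close> bounds the suprema of the powers, \<open>2 C \<le> A\<close> absorbs both terms of the estimate\<close>
  define A where "A = max (2 * C) (L\<^sup>2)"
  have A: "A \<ge> 2 * C" "A \<ge> L\<^sup>2" "L\<^sup>2 \<ge> 1" using L(1) by (auto simp: A_def one_le_power)
  define B where "B = moment 0 + 1"
  have B: "B \<ge> 1" by (simp add: B_def)
  show ?thesis
  proof
    show "A \<ge> 1" using A by linarith
    show "B \<ge> 0" using B by simp
    show "cmod (\<phi> 0) ^ 2 \<le> A" using power_mono[OF L(2)[of 0], of 2] C(2) A(2) by simp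
    show "besov_norm_sq N (\<lambda>z. \<phi> z ^ j) \<le> ennreal (B * A ^ j)" for j
    proof (induction j)
      case 0
      then show ?case by (simp add: besov_norm_sq_const B_def ennreal_leI)
    next
      case (Suc j)
      have p: "(L ^ j)\<^sup>2 \<le> A ^ j" using power_mono[OF A(2), of j] by (simp add: power_mult[symmetric] mult.commute)
      have "besov_norm_sq N (\<lambda>z. \<phi> z * \<phi> z ^ j) \<le> ennreal C * (besov_norm_sq N (\<lambda>z. \<phi> z ^ j) + ennreal ((L ^ j)\<^sup>2))"
        by (intro C(4) besov_mult_power_in_space \<phi>) (simp add: norm_power power_mono L(2))
      also have "\<dots> \<le> ennreal C * (ennreal (B * A ^ j) + ennreal (A ^ j))"
        using Suc p by (intro mult_left_mono add_mono ennreal_leI) auto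
      also have "\<dots> = ennreal (C * (B * A ^ j + A ^ j))"
        using C(1) B A by (subst ennreal_mult) auto
      also have "\<dots> \<le> ennreal (B * A ^ Suc j)"
      proof (rule ennreal_leI)
        have "A ^ j \<ge> 0" using A by simp
        then have "C * (B * A ^ j + A ^ j) \<le> C * (B * A ^ j + B * A ^ j)"
          using B C(1) by (intro mult_left_mono add_left_mono) (use mult_right_mono[of 1 B "A ^ j"] \<open>A ^ j \<ge> 0\<close> in auto)
        also have "\<dots> = (2 * C) * (B * A ^ j)" by simp
        also have "\<dots> \<le> A * (B * A ^ j)" using A B \<open>A ^ j \<ge> 0\<close> by (intro mult_right_mono) auto
        finally show "C * (B * A ^ j + A ^ j) \<le> B * A ^ Suc j" by (simp add: mult_ac)
      qed
      finally show ?case by simp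
    qed
  qed
qed

lemma sphere_mean_le_besov_norm_sq:
  assumes f: "holomorphic_ball f" and r: "0 < r" "r < 1"
  shows "sphere_mean f r \<le> ennreal (1 / measure \<mu> {r<..1}) * besov_norm_sq k f"
proof -
  note m = moment_lower[OF r]
  show ?thesis
    unfolding sphere_mean_eq[OF f less_imp_le[OF r(1)] r(2)] besov_norm_sq_def ennreal_suminf_cmult[symmetric]
  proof (intro suminf_le summableI)
    fix n
    have "r ^ (2 * n) \<le> 1 / measure \<mu> {r<..1} * moment n" using m by (simp add: field_simps)
    also have "\<dots> \<le> 1 / measure \<mu> {r<..1} * (real (Suc n) ^ (2 * k) * moment n)"
      using mult_right_mono[of 1 "real (Suc n) ^ (2 * k)" "moment n"] m(2)
      by (intro mult_left_mono) (auto simp: one_le_power)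
    finally have "r ^ (2 * n) * energy n f \<le> 1 / measure \<mu> {r<..1} * (real (Suc n) ^ (2 * k) * moment n) * energy n f"
      by (rule mult_right_mono) simp
    then show "ennreal (r ^ (2 * n) * energy n f) \<le> ennreal (1 / measure \<mu> {r<..1}) * ennreal (real (Suc n) ^ (2 * k) * (moment n * energy n f))"
      by (subst ennreal_mult[symmetric]) (auto simp: mult.assoc intro: ennreal_leI)
  qed
qed

text \<open>
  If \<open>\<bar>\<phi>(r w)\<bar>\<^sup>2 > A\<close> for some \<open>w\<close>, then \<open>\<bar>\<phi>\<bar>\<^sup>2 \<ge> A' > A\<close> on \<open>r\<close> times a cap around \<open>w\<close>, and the mean squares
  of \<open>\<phi>\<^sup>j\<close> grow at least like \<open>A'\<^sup>j\<close>, faster than the norms allow.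
\<close>

lemma besov_mult_bounded:
  assumes \<phi>: "\<phi> \<in> besov_mult \<mu> \<sigma> N"
  obtains B where "\<And>z. z \<in> ball 0 1 \<Longrightarrow> cmod (\<phi> z) \<le> B"
proof -
  note h\<phi> = besov_mult_holomorphic[OF \<phi>]
  obtain A B where A: "A \<ge> 1" "B \<ge> 0" "cmod (\<phi> 0) ^ 2 \<le> A" "\<And>j. besov_norm_sq N (\<lambda>z. \<phi> z ^ j) \<le> ennreal (B * A ^ j)"
    using besov_mult_power_growth[OF \<phi>] by blast
  have sq: "(cmod (\<phi> z))\<^sup>2 \<le> A" if z: "z \<in> ball 0 1" for z
  proof (rule ccontr)
    assume "\<not> ?thesis"
    then have big: "(cmod (\<phi> z))\<^sup>2 > A" by simp
    then have "z \<noteq> 0" using A(3) by auto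
    define r where "r = norm z"
    define w where "w = (1 / r) *\<^sub>R z"
    have r: "0 < r" "r < 1" using z \<open>z \<noteq> 0\<close> by (auto simp: r_def)
    have w: "norm w = 1" "r *\<^sub>R w = z" using r by (auto simp: w_def r_def)
    obtain A' where A': "A < A'" "A' < (cmod (\<phi> z))\<^sup>2" using dense[OF big] by blast
    have "continuous_on (sphere 0 1) (\<lambda>w. (cmod (\<phi> (r *\<^sub>R w)))\<^sup>2)"
      by (intro continuous_intros continuous_on_compose2[OF holomorphic_ball_continuous[OF h\<phi>]]) (use r in auto)
    then obtain d where d: "d > 0" "\<And>v. norm v = 1 \<Longrightarrow> dist v w < d \<Longrightarrow>
        dist ((cmod (\<phi> (r *\<^sub>R v)))\<^sup>2) ((cmod (\<phi> (r *\<^sub>R w)))\<^sup>2) < (cmod (\<phi> z))\<^sup>2 - A'"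
      using A'(2) w(1) unfolding continuous_on_iff by (metis diff_gt_0_iff_gt mem_sphere_0)
    define cap where "cap = sphere 0 1 \<inter> ball w d"
    have cap: "(cmod (\<phi> (r *\<^sub>R v)))\<^sup>2 \<ge> A'" if "v \<in> cap" for v
      using d(2)[of v] that by (auto simp: cap_def w(2) dist_commute dist_real_def)
    define m where "m = measure \<sigma> cap"
    have m: "m > 0" unfolding m_def cap_def by (rule cap_pos[OF w(1) d(1)])
    define c where "c = measure \<mu> {r<..1}"
    have c: "c > 0" unfolding c_def by (rule moment_lower(2)[OF r])
    have ineq: "A' ^ j * m \<le> (1 / c) * (B * A ^ j)" for j
    proof -
      have "ennreal (A' ^ j * m) = (\<integral>\<^sup>+ v. ennreal (A' ^ j) * indicator cap v \<partial>\<sigma>)"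
        using m A' A(1) cap_sets[of w d]
        by (simp add: nn_integral_cmult_indicator cap_def[symmetric] m_def emeasure_eq_measure ennreal_mult)
      also have "\<dots> \<le> sphere_mean (\<lambda>z. \<phi> z ^ j) r"
        unfolding sphere_mean_def
      proof (rule nn_integral_mono)
        fix v
        have "A' ^ j \<le> (cmod (\<phi> (r *\<^sub>R v) ^ j))\<^sup>2" if "v \<in> cap"
          using power_mono[OF cap[OF that], of j] A' A(1)
          by (simp add: norm_power power_mult[symmetric] mult.commute)
        then show "ennreal (A' ^ j) * indicator cap v \<le> ennreal ((cmod (\<phi> (r *\<^sub>R v) ^ j))\<^sup>2)"
          by (auto simp: indicator_def intro: ennreal_leI)
      qed
      also have "\<dots> \<le> ennreal (1 / c) * besov_norm_sq N (\<lambda>z. \<phi> z ^ j)"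
        unfolding c_def by (rule sphere_mean_le_besov_norm_sq[OF holomorphic_ball_power[OF h\<phi>] r])
      also have "\<dots> \<le> ennreal (1 / c) * ennreal (B * A ^ j)" by (intro mult_left_mono A) simp
      also have "\<dots> = ennreal (1 / c * (B * A ^ j))" using c A by (subst ennreal_mult) auto
      finally show ?thesis using c A by (subst (asm) ennreal_le_iff) auto
    qed
    have "A' / A > 1" using A' A(1) by simp
    then obtain j where j: "(A' / A) ^ j > B / (c * m)" using real_arch_pow by blast
    have "A ^ j > 0" using A(1) by simp
    with j have "A' ^ j * (c * m) > B * A ^ j" using c m by (simp add: power_divide field_simps)
    with ineq[of j] c show False by (simp add: field_simps)
  qed
  have "cmod (\<phi> z) \<le> sqrt A" if "z \<in> ball 0 1" for z using sq[OF that] by (rule real_le_rsqrt)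
  then show ?thesis by (rule that)
qed

end

section \<open>Multipliers of higher order are multipliers of lower order\<close>

lemma suminf_swap_ennreal:
  fixes f :: "nat \<Rightarrow> nat \<Rightarrow> ennreal"
  shows "(\<Sum>m. \<Sum>n. f m n) = (\<Sum>n. \<Sum>m. f m n)"
  using nn_integral_suminf[of "\<lambda>n m. f m n" "count_space UNIV"] by (simp add: nn_integral_count_space_nat)

text \<open>
  The summands are at most \<open>2 k / (m + 1)\<^sup>p\<^sup>+\<^sup>1\<close> with \<open>p = 2 N - 2 k \<ge> 2\<close>, and the tails of
  \<open>1 / (m (m + 1)) \<ge> 1 / (m + 1)\<^sup>2\<close> telescope.
\<close>

lemma tail_weight_bound:
  assumes "1 \<le> k" "k < N"
  shows "(\<Sum>m. if n < m then ennreal ((real (Suc m) ^ (2 * k) - real m ^ (2 * k)) / real (Suc m) ^ (2 * N)) else 0)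
    \<le> ennreal (2 * real k * real (Suc n) ^ (2 * k) / real (Suc n) ^ (2 * N))"
proof -
  define p where "p = 2 * N - 2 * k"
  have p: "p \<ge> 2" "2 * N = 2 * k + p" using assms by (auto simp: p_def)
  define g where "g m = 2 * real k / real (Suc n) ^ (p - 1) * (1 / real (n + 1 + m) - 1 / real (n + 2 + m))" for m
  have t: "(real (Suc m) ^ (2 * k) - real m ^ (2 * k)) / real (Suc m) ^ (2 * N) \<le> g (m - Suc n)" if "n < m" for m
  proof -
    have "real m ^ (2 * k) \<ge> real (Suc m) ^ (2 * k) - 2 * real k * real (Suc m) ^ (2 * k - 1)"
    proof -
      have "1 + real (2 * k) * (- 1 / real (Suc m)) \<le> (1 + (- 1 / real (Suc m))) ^ (2 * k)"
        by (rule Bernoulli_inequality) simp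
      also have "1 + (- 1 / real (Suc m)) = real m / real (Suc m)" by (simp add: field_simps)
      finally have 1: "(1 - 2 * real k / real (Suc m)) * real (Suc m) ^ (2 * k) \<le> (real m / real (Suc m)) ^ (2 * k) * real (Suc m) ^ (2 * k)"
        by (intro mult_right_mono) auto
      have "(real m / real (Suc m)) ^ (2 * k) * real (Suc m) ^ (2 * k) = real m ^ (2 * k)" by (simp add: power_divide)
      with 1 have "(1 - 2 * real k / real (Suc m)) * real (Suc m) ^ (2 * k) \<le> real m ^ (2 * k)"
        by (simp only:)
      moreover have "(1 - b / S) * (a * S) = a * S - b * a" if "S \<noteq> 0" for a b S :: real
        using that by (simp add: field_simps)
      moreover have "real (Suc m) ^ (2 * k) = real (Suc m) ^ (2 * k - 1) * real (Suc m)"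
        using assms(1) power_minus_mult[of "2 * k" "real (Suc m)"] by simp
      ultimately show ?thesis by (metis of_nat_neq_0)
    qed
    then have "(real (Suc m) ^ (2 * k) - real m ^ (2 * k)) / real (Suc m) ^ (2 * N)
        \<le> 2 * real k * real (Suc m) ^ (2 * k - 1) / real (Suc m) ^ (2 * N)"
      by (intro divide_right_mono) auto
    also have "\<dots> = 2 * real k / real (Suc m) ^ (p + 1)"
    proof -
      have "2 * N = (2 * k - 1) + (p + 1)" using p assms by simp
      then have "real (Suc m) ^ (2 * N) = real (Suc m) ^ (2 * k - 1) * real (Suc m) ^ (p + 1)"
        by (simp only: power_add)
      then show ?thesis by simp
    qed
    also have "\<dots> = 2 * real k / (real (Suc m) ^ (p - 1) * real (Suc m) ^ 2)"
    proof -
      have "p + 1 = (p - 1) + 2" using p by simp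
      then show ?thesis by (simp only: power_add)
    qed
    also have "\<dots> \<le> 2 * real k / (real (Suc n) ^ (p - 1) * (real m * real (Suc m)))"
      using that by (intro divide_left_mono mult_mono power_mono) (auto simp: power2_eq_square)
    also have "\<dots> = g (m - Suc n)"
    proof -
      have e: "n + 1 + (m - Suc n) = m" "n + 2 + (m - Suc n) = Suc m" using that by auto
      have "1 / real m - 1 / real (Suc m) = 1 / (real m * real (Suc m))" using that by (simp add: field_simps)
      then show ?thesis unfolding g_def e by simp
    qed
    finally show ?thesis .
  qed
  have gs: "g sums (2 * real k / real (Suc n) ^ (p - 1) * (1 / real (n + 1 + 0) - 0))"
  proof -
    have "(\<lambda>m. 1 / real (n + 1 + m)) \<longlonglongrightarrow> 0" by real_asymp
    from telescope_sums'[OF this] show ?thesis unfolding g_def by (intro sums_mult) simp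
  qed
  have g0: "g m \<ge> 0" for m unfolding g_def by (intro mult_nonneg_nonneg) (auto intro!: frac_le)
  have "(\<Sum>m. if n < m then ennreal ((real (Suc m) ^ (2 * k) - real m ^ (2 * k)) / real (Suc m) ^ (2 * N)) else 0)
     \<le> (\<Sum>m. if n < m then ennreal (g (m - Suc n)) else 0)"
    using t by (intro suminf_le summableI) (auto intro: ennreal_leI)
  also have "\<dots> = (\<Sum>m. ennreal (g m))"
    by (subst suminf_offset[of _ "Suc n"]) auto
  also have "\<dots> = ennreal (2 * real k / real (Suc n) ^ (p - 1) * (1 / real (n + 1 + 0) - 0))"
    using gs g0 by (intro suminf_ennreal_eq) auto
  also have "2 * real k / real (Suc n) ^ (p - 1) * (1 / real (n + 1 + 0) - 0) = 2 * real k * real (Suc n) ^ (2 * k) / real (Suc n) ^ (2 * N)"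
  proof -
    have "real (Suc n) ^ (2 * N) = real (Suc n) ^ (2 * k) * (real (Suc n) ^ (p - 1) * real (Suc n))"
      using p power_minus_mult[of p "real (Suc n)"] by (simp only: power_add)
    then show ?thesis by (simp add: add.commute)
  qed
  finally show ?thesis .
qed

text \<open>
  The hypothesis says how much of \<open>b\<close> lies in degrees \<open>\<ge> m\<close>. Multiply it by the increment
  \<open>(m + 1)\<^sup>2\<^sup>k - m\<^sup>2\<^sup>k\<close> and sum over \<open>m\<close>: after exchanging the sums, both tails turn into the weight
  \<open>(n + 1)\<^sup>2\<^sup>k\<close> by telescoping, and the low-degree part is controlled by \<open>tail_weight_bound\<close>.
\<close>

lemma weighted_sum_interpolation:
  fixes b c :: "nat \<Rightarrow> ennreal"
  assumes kN: "1 \<le> k" "k < N"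
    and tail: "\<And>m. (\<Sum>n. if m \<le> n then b n else 0) \<le>
      K * (ennreal (1 / real (Suc m) ^ (2 * N)) * (\<Sum>n. if n < m then ennreal (real (Suc n) ^ (2 * N)) * c n else 0)
       + (\<Sum>n. if m \<le> n then c n else 0))"
  shows "(\<Sum>n. ennreal (real (Suc n) ^ (2 * k)) * b n) \<le>
     K * ennreal (2 * real k + 1) * (\<Sum>n. ennreal (real (Suc n) ^ (2 * k)) * c n)"
proof -
  define v where "v m = real (Suc m) ^ (2 * k) - real m ^ (2 * k)" for m
  have v: "v m \<ge> 0" for m unfolding v_def by (simp add: power_mono)
  have vs: "(\<Sum>m. if m \<le> n then ennreal (v m) else 0) = ennreal (real (Suc n) ^ (2 * k))" for n
  proof -
    have "(\<Sum>m. if m \<le> n then ennreal (v m) else 0) = (\<Sum>m\<in>{..<Suc n}. ennreal (v m))"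
      by (subst suminf_finite[of "{..<Suc n}"]) auto
    also have "\<dots> = ennreal (\<Sum>m<Suc n. v m)" by (rule sum_ennreal) (rule v)
    also have "(\<Sum>m<Suc n. v m) = real (Suc n) ^ (2 * k)"
      using kN(1) unfolding v_def by (subst sum_lessThan_telescope) (simp add: power_0_left)
    finally show ?thesis .
  qed
  have sw: "(\<Sum>m. ennreal (v m) * (\<Sum>n. if m \<le> n then d n else 0)) = (\<Sum>n. ennreal (real (Suc n) ^ (2 * k)) * d n)" for d
  proof -
    have "(\<Sum>m. ennreal (v m) * (\<Sum>n. if m \<le> n then d n else 0)) = (\<Sum>m. \<Sum>n. (if m \<le> n then ennreal (v m) else 0) * d n)"
      unfolding ennreal_suminf_cmult[symmetric] by (intro suminf_cong) auto
    also have "\<dots> = (\<Sum>n. (\<Sum>m. if m \<le> n then ennreal (v m) else 0) * d n)"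
      unfolding ennreal_suminf_multc[symmetric] by (rule suminf_swap_ennreal)
    finally show ?thesis by (simp only: vs)
  qed
  have "(\<Sum>n. ennreal (real (Suc n) ^ (2 * k)) * b n) = (\<Sum>m. ennreal (v m) * (\<Sum>n. if m \<le> n then b n else 0))"
    by (rule sw[symmetric])
  also have "\<dots> \<le> (\<Sum>m. K * (ennreal (v m / real (Suc m) ^ (2 * N)) * (\<Sum>n. if n < m then ennreal (real (Suc n) ^ (2 * N)) * c n else 0))
        + K * (ennreal (v m) * (\<Sum>n. if m \<le> n then c n else 0)))"
  proof (intro suminf_le summableI)
    fix m
    have e: "ennreal (v m / real (Suc m) ^ (2 * N)) = ennreal (v m) * ennreal (1 / real (Suc m) ^ (2 * N))"
      using v[of m] by (subst ennreal_mult[symmetric]) auto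
    show "ennreal (v m) * (\<Sum>n. if m \<le> n then b n else 0) \<le> K * (ennreal (v m / real (Suc m) ^ (2 * N)) * (\<Sum>n. if n < m then ennreal (real (Suc n) ^ (2 * N)) * c n else 0))
        + K * (ennreal (v m) * (\<Sum>n. if m \<le> n then c n else 0))"
      using mult_left_mono[OF tail[of m], of "ennreal (v m)"] unfolding e by (simp add: distrib_left mult_ac)
  qed
  also have "\<dots> = K * (\<Sum>m. ennreal (v m / real (Suc m) ^ (2 * N)) * (\<Sum>n. if n < m then ennreal (real (Suc n) ^ (2 * N)) * c n else 0))
      + K * (\<Sum>m. ennreal (v m) * (\<Sum>n. if m \<le> n then c n else 0))"
    unfolding ennreal_suminf_cmult[symmetric, of K] by (rule suminf_add[symmetric]) auto
  also have "(\<Sum>m. ennreal (v m / real (Suc m) ^ (2 * N)) * (\<Sum>n. if n < m then ennreal (real (Suc n) ^ (2 * N)) * c n else 0))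
      = (\<Sum>n. (\<Sum>m. if n < m then ennreal (v m / real (Suc m) ^ (2 * N)) else 0) * (ennreal (real (Suc n) ^ (2 * N)) * c n))"
    unfolding ennreal_suminf_cmult[symmetric] ennreal_suminf_multc[symmetric]
    by (subst suminf_swap_ennreal) (intro suminf_cong, auto)
  also have "\<dots> \<le> (\<Sum>n. ennreal (2 * real k) * (ennreal (real (Suc n) ^ (2 * k)) * c n))"
  proof (intro suminf_le summableI)
    fix n
    have "(\<Sum>m. if n < m then ennreal (v m / real (Suc m) ^ (2 * N)) else 0) * (ennreal (real (Suc n) ^ (2 * N)) * c n)
       \<le> ennreal (2 * real k * real (Suc n) ^ (2 * k) / real (Suc n) ^ (2 * N)) * (ennreal (real (Suc n) ^ (2 * N)) * c n)"
      unfolding v_def by (rule mult_right_mono[OF tail_weight_bound[OF kN]]) simp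
    also have "\<dots> = ennreal (2 * real k * real (Suc n) ^ (2 * k) / real (Suc n) ^ (2 * N) * real (Suc n) ^ (2 * N)) * c n"
      by (subst ennreal_mult) (auto simp: mult.assoc)
    also have "2 * real k * real (Suc n) ^ (2 * k) / real (Suc n) ^ (2 * N) * real (Suc n) ^ (2 * N) = 2 * real k * real (Suc n) ^ (2 * k)"
      by simp
    also have "ennreal (2 * real k * real (Suc n) ^ (2 * k)) * c n = ennreal (2 * real k) * (ennreal (real (Suc n) ^ (2 * k)) * c n)"
      by (subst ennreal_mult) (auto simp: mult.assoc)
    finally show "(\<Sum>m. if n < m then ennreal (v m / real (Suc m) ^ (2 * N)) else 0) * (ennreal (real (Suc n) ^ (2 * N)) * c n)
       \<le> ennreal (2 * real k) * (ennreal (real (Suc n) ^ (2 * k)) * c n)" .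
  qed
  also have "K * (\<Sum>n. ennreal (2 * real k) * (ennreal (real (Suc n) ^ (2 * k)) * c n)) + K * (\<Sum>m. ennreal (v m) * (\<Sum>n. if m \<le> n then c n else 0))
     = K * ennreal (2 * real k + 1) * (\<Sum>n. ennreal (real (Suc n) ^ (2 * k)) * c n)"
    unfolding sw ennreal_suminf_cmult by (simp add: distrib_left distrib_right mult.assoc)
  finally show ?thesis by (simp add: add_right_mono mult_left_mono)
qed

context radial_besov
begin

lemma energy_taylor:
  assumes "holomorphic_ball f"
  shows "energy n (\<lambda>z. \<Sum>j<m. homog_part j f z) = (if n < m then energy n f else 0)"
    "energy n (\<lambda>z. f z - (\<Sum>j<m. homog_part j f z)) = (if n < m then 0 else energy n f)"
proof -
  have h: "holomorphic_ball (\<lambda>z. \<Sum>j<m. homog_part j f z)"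
    by (intro holomorphic_ball_sum holomorphic_ball_homog_part assms)
  show "energy n (\<lambda>z. \<Sum>j<m. homog_part j f z) = (if n < m then energy n f else 0)"
    by (simp add: energy_def homog_part_taylor[OF assms])
  show "energy n (\<lambda>z. f z - (\<Sum>j<m. homog_part j f z)) = (if n < m then 0 else energy n f)"
    by (simp add: energy_def homog_part_diff[OF assms h] homog_part_taylor[OF assms])
qed

text \<open>
  The continuity estimate of order \<open>N\<close> contains the square of a supremum \<open>s\<close> of Taylor polynomials of
  \<open>f\<close>. Since \<open>s\<close> does not depend on the degree, it can be counted as part of the coefficient of degree
  \<open>0\<close>.
\<close>

lemma besov_mult_interpolation:
  assumes \<phi>: "\<phi> \<in> besov_mult \<mu> \<sigma> N" and k: "1 \<le> k" "k < N"
  shows "\<phi> \<in> besov_mult \<mu> \<sigma> k"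
  unfolding besov_mult_def
proof (intro CollectI ballI)
  fix f assume f: "f \<in> besov_space \<mu> \<sigma> k"
  note hf = besov_holomorphic[OF f] and h\<phi> = besov_mult_holomorphic[OF \<phi>]
  obtain D where D: "\<And>z. z \<in> ball 0 1 \<Longrightarrow> cmod (\<phi> z) \<le> D" using besov_mult_bounded[OF \<phi>] by blast
  obtain C r where C: "C > 0" "0 < r" "r < 1"
    "\<And>f s. f \<in> besov_space \<mu> \<sigma> N \<Longrightarrow> (\<And>z. norm z \<le> r \<Longrightarrow> cmod (f z) \<le> s) \<Longrightarrow>
       besov_norm_sq N (\<lambda>z. \<phi> z * f z) \<le> ennreal C * (besov_norm_sq N f + ennreal (s\<^sup>2))"
    using besov_mult_frechet_bounded[OF \<phi>] by blast
  obtain s where s: "s \<ge> 0" "\<And>m z. norm z \<le> r \<Longrightarrow> cmod (\<Sum>j<m. homog_part j f z) \<le> s"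
    using taylor_bounded[OF hf C(3)] by blast
  define b where "b n = ennreal (moment n * energy n (\<lambda>z. \<phi> z * f z))" for n
  \<comment> \<open>the coefficients of \<open>f\<close>, with \<open>s\<^sup>2\<close> put into degree \<open>0\<close>\<close>
  define c where "c n = ennreal (moment n * energy n f) + (if n = 0 then ennreal (s\<^sup>2) else 0)" for n
  define K where "K = 2 * max C (D\<^sup>2)"
  have tail: "(\<Sum>n. if m \<le> n then b n else 0) \<le>
      ennreal K * (ennreal (1 / real (Suc m) ^ (2 * N)) * (\<Sum>n. if n < m then ennreal (real (Suc n) ^ (2 * N)) * c n else 0)
       + (\<Sum>n. if m \<le> n then c n else 0))" for m
  proof -
    define p where "p z = (\<Sum>j<m. homog_part j f z)" for z
    define q where "q z = f z - p z" for z
    have hp: "holomorphic_ball p" unfolding p_def by (intro holomorphic_ball_sum holomorphic_ball_homog_part hf)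
    have hq: "holomorphic_ball q" unfolding q_def by (intro holomorphic_ball_diff hf hp)
    have ep: "energy n p = (if n < m then energy n f else 0)" and eq: "energy n q = (if n < m then 0 else energy n f)" for n
      using energy_taylor[OF hf] unfolding p_def q_def by auto
    have split: "b n \<le> 2 * ennreal (moment n * energy n (\<lambda>z. \<phi> z * p z)) + 2 * ennreal (moment n * energy n (\<lambda>z. \<phi> z * q z))" for n
    proof -
      have "energy n (\<lambda>z. \<phi> z * p z + \<phi> z * q z) \<le> 2 * energy n (\<lambda>z. \<phi> z * p z) + 2 * energy n (\<lambda>z. \<phi> z * q z)"
        by (intro energy_add_le2 holomorphic_ball_mult h\<phi> hp hq)
      then have "energy n (\<lambda>z. \<phi> z * f z) \<le> 2 * energy n (\<lambda>z. \<phi> z * p z) + 2 * energy n (\<lambda>z. \<phi> z * q z)"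
        by (simp add: q_def algebra_simps)
      from mult_left_mono[OF this moment_nonneg[of n]]
      have "b n \<le> ennreal (2 * (moment n * energy n (\<lambda>z. \<phi> z * p z)) + 2 * (moment n * energy n (\<lambda>z. \<phi> z * q z)))"
        unfolding b_def by (intro ennreal_leI) (simp add: algebra_simps)
      also have "\<dots> = 2 * ennreal (moment n * energy n (\<lambda>z. \<phi> z * p z)) + 2 * ennreal (moment n * energy n (\<lambda>z. \<phi> z * q z))"
        by (simp add: ennreal_mult)
      finally show ?thesis .
    qed
    have low: "(\<Sum>n. if m \<le> n then ennreal (moment n * energy n (\<lambda>z. \<phi> z * p z)) else 0)
       \<le> ennreal C * (ennreal (1 / real (Suc m) ^ (2 * N)) * (\<Sum>n. if n < m then ennreal (real (Suc n) ^ (2 * N)) * c n else 0))"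
    proof (cases "m = 0")
      case True
      then have e0: "energy n (\<lambda>z. \<phi> z * p z) = 0" for n
        using energy_cmult[of "\<lambda>_. 0" n 0] by (simp add: p_def)
      show ?thesis by (simp add: e0 cong: if_cong)
    next
      case False
      have wp: "besov_norm_sq N p = (\<Sum>n. if n < m then ennreal (real (Suc n) ^ (2 * N) * (moment n * energy n f)) else 0)"
        unfolding besov_norm_sq_def ep by (intro suminf_cong) auto
      have "besov_norm_sq N p = (\<Sum>n\<in>{..<m}. ennreal (real (Suc n) ^ (2 * N) * (moment n * energy n f)))"
        unfolding wp by (subst suminf_finite[of "{..<m}"]) auto
      then have "besov_norm_sq N p < \<infinity>" by (simp add: sum_ennreal)
      then have pB: "p \<in> besov_space \<mu> \<sigma> N" using hp by (simp add: besov_space_iff)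
      have "(\<Sum>n. if m \<le> n then ennreal (moment n * energy n (\<lambda>z. \<phi> z * p z)) else 0)
         \<le> ennreal (1 / real (Suc m) ^ (2 * N)) * besov_norm_sq N (\<lambda>z. \<phi> z * p z)"
        unfolding besov_norm_sq_def ennreal_suminf_cmult[symmetric]
      proof (intro suminf_le summableI)
        fix n
        show "(if m \<le> n then ennreal (moment n * energy n (\<lambda>z. \<phi> z * p z)) else 0)
          \<le> ennreal (1 / real (Suc m) ^ (2 * N)) * ennreal (real (Suc n) ^ (2 * N) * (moment n * energy n (\<lambda>z. \<phi> z * p z)))"
        proof (cases "m \<le> n")
          case True
          then have "1 \<le> 1 / real (Suc m) ^ (2 * N) * real (Suc n) ^ (2 * N)"
            by (simp add: field_simps power_mono)
          from mult_right_mono[OF this, of "moment n * energy n (\<lambda>z. \<phi> z * p z)"] True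
          show ?thesis by (subst ennreal_mult[symmetric]) (auto simp: mult.assoc intro: ennreal_leI)
        qed simp
      qed
      also have "\<dots> \<le> ennreal (1 / real (Suc m) ^ (2 * N)) * (ennreal C * (besov_norm_sq N p + ennreal (s\<^sup>2)))"
        by (intro mult_left_mono C(4)[OF pB]) (auto simp: p_def s)
      also have "besov_norm_sq N p + ennreal (s\<^sup>2) = (\<Sum>n. if n < m then ennreal (real (Suc n) ^ (2 * N)) * c n else 0)"
      proof -
        have "ennreal (s\<^sup>2) = (\<Sum>n. if n \<in> {0::nat} then ennreal (s\<^sup>2) else 0)"
          by (subst suminf_finite[of "{0}"]) auto
        then have "besov_norm_sq N p + ennreal (s\<^sup>2) = (\<Sum>n. if n < m then ennreal (real (Suc n) ^ (2 * N) * (moment n * energy n f)) else 0)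
            + (\<Sum>n. if n \<in> {0::nat} then ennreal (s\<^sup>2) else 0)"
          by (simp only: wp)
        also have "\<dots> = (\<Sum>n. (if n < m then ennreal (real (Suc n) ^ (2 * N) * (moment n * energy n f)) else 0)
            + (if n \<in> {0} then ennreal (s\<^sup>2) else 0))"
          by (rule suminf_add) auto
        also have "\<dots> = (\<Sum>n. if n < m then ennreal (real (Suc n) ^ (2 * N)) * c n else 0)"
          using False by (intro suminf_cong) (auto simp: c_def ennreal_mult distrib_left)
        finally show ?thesis .
      qed
      finally show ?thesis by (simp add: mult.left_commute)
    qed
    have high: "(\<Sum>n. if m \<le> n then ennreal (moment n * energy n (\<lambda>z. \<phi> z * q z)) else 0)
       \<le> ennreal (D\<^sup>2) * (\<Sum>n. if m \<le> n then c n else 0)"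
    proof -
      have "(\<Sum>n. if m \<le> n then ennreal (moment n * energy n (\<lambda>z. \<phi> z * q z)) else 0) \<le> besov_norm_sq 0 (\<lambda>z. \<phi> z * q z)"
        unfolding besov_norm_sq_def by (intro suminf_le summableI) auto
      also have "\<dots> \<le> ennreal (D\<^sup>2) * besov_norm_sq 0 q" by (rule besov_norm_sq_0_mult_le[OF D h\<phi> hq])
      also have "besov_norm_sq 0 q \<le> (\<Sum>n. if m \<le> n then c n else 0)"
        unfolding besov_norm_sq_def eq by (intro suminf_le summableI) (auto simp: c_def)
      finally show ?thesis by (simp add: mult_left_mono)
    qed
    have "(\<Sum>n. if m \<le> n then b n else 0) \<le> (\<Sum>n. 2 * (if m \<le> n then ennreal (moment n * energy n (\<lambda>z. \<phi> z * p z)) else 0)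
        + 2 * (if m \<le> n then ennreal (moment n * energy n (\<lambda>z. \<phi> z * q z)) else 0))"
      using split by (intro suminf_le summableI) auto
    also have "\<dots> = 2 * (\<Sum>n. if m \<le> n then ennreal (moment n * energy n (\<lambda>z. \<phi> z * p z)) else 0)
        + 2 * (\<Sum>n. if m \<le> n then ennreal (moment n * energy n (\<lambda>z. \<phi> z * q z)) else 0)"
      unfolding ennreal_suminf_cmult[symmetric] by (rule suminf_add[symmetric]) auto
    also have "\<dots> \<le> 2 * (ennreal C * (ennreal (1 / real (Suc m) ^ (2 * N)) * (\<Sum>n. if n < m then ennreal (real (Suc n) ^ (2 * N)) * c n else 0)))
        + 2 * (ennreal (D\<^sup>2) * (\<Sum>n. if m \<le> n then c n else 0))"
      by (intro add_mono mult_left_mono low high) auto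
    also have "\<dots> \<le> ennreal K * (ennreal (1 / real (Suc m) ^ (2 * N)) * (\<Sum>n. if n < m then ennreal (real (Suc n) ^ (2 * N)) * c n else 0))
        + ennreal K * (\<Sum>n. if m \<le> n then c n else 0)"
    proof (intro add_mono)
      have 2: "2 * (ennreal x * y) \<le> ennreal K * y" if "0 \<le> x" "x \<le> max C (D\<^sup>2)" for x y
      proof -
        have "2 * (ennreal x * y) = ennreal (2 * x) * y" using that(1) by (simp add: ennreal_mult mult.assoc)
        also have "\<dots> \<le> ennreal K * y" using that(2) by (intro mult_right_mono ennreal_leI) (simp_all add: K_def)
        finally show ?thesis .
      qed
      show "2 * (ennreal C * y) \<le> ennreal K * y" "2 * (ennreal (D\<^sup>2) * y) \<le> ennreal K * y" for y
        using C(1) by (auto intro!: 2)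
    qed
    finally show ?thesis by (simp only: distrib_left)
  qed
  have "besov_norm_sq k (\<lambda>z. \<phi> z * f z) = (\<Sum>n. ennreal (real (Suc n) ^ (2 * k)) * b n)"
    unfolding besov_norm_sq_def b_def by (intro suminf_cong ennreal_mult) auto
  also have "\<dots> \<le> ennreal K * ennreal (2 * real k + 1) * (\<Sum>n. ennreal (real (Suc n) ^ (2 * k)) * c n)"
    by (rule weighted_sum_interpolation[OF k tail])
  also have "(\<Sum>n. ennreal (real (Suc n) ^ (2 * k)) * c n) = besov_norm_sq k f + ennreal (s\<^sup>2)"
  proof -
    have "(\<Sum>n. ennreal (real (Suc n) ^ (2 * k)) * c n) = (\<Sum>n. ennreal (real (Suc n) ^ (2 * k) * (moment n * energy n f))
        + (if n \<in> {0} then ennreal (s\<^sup>2) else 0))"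
      by (intro suminf_cong) (auto simp: c_def ennreal_mult distrib_left)
    also have "\<dots> = besov_norm_sq k f + (\<Sum>n. if n \<in> {0::nat} then ennreal (s\<^sup>2) else 0)"
      unfolding besov_norm_sq_def by (rule suminf_add[symmetric]) auto
    also have "(\<Sum>n. if n \<in> {0::nat} then ennreal (s\<^sup>2) else 0) = ennreal (s\<^sup>2)"
      by (subst suminf_finite[of "{0}"]) auto
    finally show ?thesis .
  qed
  also have "ennreal K * ennreal (2 * real k + 1) * (besov_norm_sq k f + ennreal (s\<^sup>2)) < \<infinity>"
    using f by (auto simp: besov_space_iff ennreal_mult_less_top)
  finally show "(\<lambda>z. \<phi> z * f z) \<in> besov_space \<mu> \<sigma> k"
    using hf h\<phi> by (auto simp: besov_space_iff)
qed

lemma bounded_mult_besov_0: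
  assumes "\<And>z. z \<in> ball 0 1 \<Longrightarrow> cmod (h z) \<le> B" "holomorphic_ball h" "f \<in> besov_space \<mu> \<sigma> 0"
  shows "(\<lambda>z. h z * f z) \<in> besov_space \<mu> \<sigma> 0"
  using besov_norm_sq_0_mult_le[OF assms(1,2), of f] assms
  by (auto simp: besov_space_iff ennreal_mult_less_top intro: le_less_trans)

lemma besov_mult_antimono:
  assumes \<phi>: "\<phi> \<in> besov_mult \<mu> \<sigma> N" and "k \<le> N"
  shows "\<phi> \<in> besov_mult \<mu> \<sigma> k"
proof -
  consider "k = 0" | "k = N" | "1 \<le> k" "k < N" using assms(2) by linarith
  then show ?thesis
  proof cases
    case 1
    obtain B where "\<And>z. z \<in> ball 0 1 \<Longrightarrow> cmod (\<phi> z) \<le> B" using besov_mult_bounded[OF \<phi>] by blast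
    from bounded_mult_besov_0[OF this besov_mult_holomorphic[OF \<phi>]] show ?thesis
      unfolding 1 besov_mult_def by blast
  qed (use \<phi> besov_mult_interpolation in auto)
qed

section \<open>Quotients of multipliers\<close>

lemma besov_Suc_iff:
  "f \<in> besov_space \<mu> \<sigma> (Suc k) \<longleftrightarrow> holomorphic_ball f \<and> radial_deriv f \<in> besov_space \<mu> \<sigma> k"
  by (auto simp: besov_space_def funpow_swap1 intro: holomorphic_ball_radial_deriv)

text \<open>
  Solve the product rule \<open>R (\<phi> f) = \<phi> R f + (R \<phi>) f\<close> for the last term; it therefore suffices that \<open>\<phi>\<close>
  multiplies both orders.
\<close>

lemma radial_deriv_mult_besov:
  assumes "\<phi> \<in> besov_mult \<mu> \<sigma> k" "\<phi> \<in> besov_mult \<mu> \<sigma> (Suc k)" "f \<in> besov_space \<mu> \<sigma> (Suc k)"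
  shows "(\<lambda>z. radial_deriv \<phi> z * f z) \<in> besov_space \<mu> \<sigma> k"
proof (rule besov_cong)
  have "radial_deriv (\<lambda>z. \<phi> z * f z) \<in> besov_space \<mu> \<sigma> k" "radial_deriv f \<in> besov_space \<mu> \<sigma> k"
    using besov_multD[OF assms(2,3)] assms(3) by (auto simp: besov_Suc_iff)
  then show "(\<lambda>z. radial_deriv (\<lambda>z. \<phi> z * f z) z - \<phi> z * radial_deriv f z) \<in> besov_space \<mu> \<sigma> k"
    by (intro besov_diff besov_multD[OF assms(1)])
  fix z :: "complex ^ 'd" assume "z \<in> ball 0 1"
  then show "radial_deriv (\<lambda>z. \<phi> z * f z) z - \<phi> z * radial_deriv f z = radial_deriv \<phi> z * f z"
    by (simp add: radial_deriv_mult[OF besov_mult_holomorphic[OF assms(1)] besov_holomorphic[OF assms(3)]])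
qed

lemma radial_deriv_power_Suc:
  assumes "holomorphic_ball f" "z \<in> ball 0 1"
  shows "radial_deriv (\<lambda>z. f z ^ Suc n) z = of_nat (Suc n) * f z ^ n * radial_deriv f z"
proof (induction n)
  case (Suc n)
  have "radial_deriv (\<lambda>z. f z * f z ^ Suc n) z = f z * radial_deriv (\<lambda>z. f z ^ Suc n) z + radial_deriv f z * f z ^ Suc n"
    by (rule radial_deriv_mult[OF assms(1) holomorphic_ball_power[OF assms(1)] assms(2)])
  then show ?case unfolding Suc power_Suc[of _ "Suc n"] by (simp add: algebra_simps)
qed simp

lemma radial_deriv_power:
  assumes "holomorphic_ball f" "z \<in> ball 0 1"
  shows "f z * radial_deriv (\<lambda>z. f z ^ n) z = of_nat n * f z ^ n * radial_deriv f z"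
proof (cases n)
  case 0
  have "radial_deriv (\<lambda>_. 1 :: complex) z = 0"
    by (rule radial_deriv_eq[OF has_derivative_const, THEN trans]) simp_all
  with 0 show ?thesis by simp
next
  case (Suc m)
  then show ?thesis using radial_deriv_power_Suc[OF assms, of m] by simp
qed

text \<open>
  Induction on \<open>k\<close>, for all exponents \<open>a\<close> at once, because differentiating \<open>h\<^sup>a\<close> produces both \<open>h\<^sup>a\<close> and
  \<open>h\<^sup>a\<^sup>+\<^sup>1\<close>. By \<open>\<Phi> R h = h (R \<Phi> - h R \<psi>)\<close> with \<open>\<Phi> = \<phi>\<close>, the radial derivative of \<open>h\<^sup>a \<phi>\<^sup>k\<^sup>+\<^sup>1 f\<close> is a
  combination of functions \<open>h\<^sup>b \<phi>\<^sup>k g\<close>, where \<open>g\<close> is one of \<open>(R \<phi>) f\<close>, \<open>(R \<psi>) f\<close> and \<open>\<phi> R f\<close>, all of which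
  lie in the space of order \<open>k\<close>.
\<close>

lemma besov_quotient_power_mult:
  assumes \<phi>: "\<And>j. j \<le> N \<Longrightarrow> \<phi> \<in> besov_mult \<mu> \<sigma> j" and \<psi>: "\<And>j. j \<le> N \<Longrightarrow> \<psi> \<in> besov_mult \<mu> \<sigma> j"
    and h: "holomorphic_ball h" "\<And>z. z \<in> ball 0 1 \<Longrightarrow> cmod (h z) \<le> B"
    and eq: "\<And>z. z \<in> ball 0 1 \<Longrightarrow> \<phi> z = h z * \<psi> z"
  shows "k \<le> N \<Longrightarrow> f \<in> besov_space \<mu> \<sigma> k \<Longrightarrow> (\<lambda>z. h z ^ a * (\<phi> z ^ k * f z)) \<in> besov_space \<mu> \<sigma> k"
proof (induction k arbitrary: f a)
  case 0
  have "(\<lambda>z. h z ^ a * f z) \<in> besov_space \<mu> \<sigma> 0"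
  proof (rule bounded_mult_besov_0)
    show "cmod (h z ^ a) \<le> B ^ a" if "z \<in> ball 0 1" for z
      using power_mono[OF h(2)[OF that]] by (simp add: norm_power)
  qed (use 0 h in auto)
  then show ?case by simp
next
  case (Suc k)
  have kN: "k \<le> N" using Suc by simp
  note hf = besov_holomorphic[OF Suc.prems(2)]
  note h\<phi> = besov_mult_holomorphic[OF \<phi>[OF kN]] and h\<psi> = besov_mult_holomorphic[OF \<psi>[OF kN]]
  define G where "G b g z = h z ^ b * (\<phi> z ^ k * g z)" for b and g :: "complex ^ 'd \<Rightarrow> complex" and z
  have G: "G b g \<in> besov_space \<mu> \<sigma> k" if "g \<in> besov_space \<mu> \<sigma> k" for b g
    unfolding G_def by (rule Suc.IH[OF kN that])
  have R: "(\<lambda>z. radial_deriv \<phi> z * f z) \<in> besov_space \<mu> \<sigma> k" "(\<lambda>z. radial_deriv \<psi> z * f z) \<in> besov_space \<mu> \<sigma> k"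
    "(\<lambda>z. \<phi> z * radial_deriv f z) \<in> besov_space \<mu> \<sigma> k"
    using Suc.prems kN by (auto intro!: radial_deriv_mult_besov \<phi> \<psi> besov_multD[OF \<phi>] simp: besov_Suc_iff)
  \<comment> \<open>the radial derivative of \<open>h\<^sup>a \<phi>\<^sup>k\<^sup>+\<^sup>1 f\<close>, written without derivatives of \<open>h\<close>\<close>
  define F where "F z = (of_nat a + of_nat (Suc k)) * G a (\<lambda>z. radial_deriv \<phi> z * f z) z
      - of_nat a * G (Suc a) (\<lambda>z. radial_deriv \<psi> z * f z) z + G a (\<lambda>z. \<phi> z * radial_deriv f z) z" for z
  have F: "F \<in> besov_space \<mu> \<sigma> k"
    unfolding F_def by (intro besov_add besov_diff besov_cmult G R)
  have RF: "radial_deriv (\<lambda>z. h z ^ a * (\<phi> z ^ Suc k * f z)) z = F z" if z: "z \<in> ball 0 1" for z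
  proof -
    have hp: "holomorphic_ball (\<lambda>z. h z ^ a)" "holomorphic_ball (\<lambda>z. \<phi> z ^ Suc k)"
      using h h\<phi> by blast+
    have 1: "radial_deriv (\<lambda>z. h z ^ a * (\<phi> z ^ Suc k * f z)) z
       = h z ^ a * (\<phi> z ^ Suc k * radial_deriv f z + radial_deriv (\<lambda>z. \<phi> z ^ Suc k) z * f z)
        + radial_deriv (\<lambda>z. h z ^ a) z * (\<phi> z ^ Suc k * f z)"
      by (simp only: radial_deriv_mult[OF hp(1) holomorphic_ball_mult[OF hp(2) hf] z] radial_deriv_mult[OF hp(2) hf z])
    have 2: "radial_deriv \<phi> z = h z * radial_deriv \<psi> z + radial_deriv h z * \<psi> z"
      using radial_deriv_cong[OF eq h\<phi> z] radial_deriv_mult[OF h(1) h\<psi> z] by simp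
    have 3: "radial_deriv (\<lambda>z. \<phi> z ^ Suc k) z = of_nat (Suc k) * \<phi> z ^ k * radial_deriv \<phi> z"
      by (rule radial_deriv_power_Suc[OF h\<phi> z])
    have 4: "radial_deriv (\<lambda>z. h z ^ a) z * \<phi> z = of_nat a * h z ^ a * (radial_deriv \<phi> z - h z * radial_deriv \<psi> z)"
    proof -
      have "radial_deriv (\<lambda>z. h z ^ a) z * \<phi> z = h z * radial_deriv (\<lambda>z. h z ^ a) z * \<psi> z"
        by (simp add: eq[OF z])
      also have "\<dots> = of_nat a * h z ^ a * (radial_deriv h z * \<psi> z)"
        by (simp add: radial_deriv_power[OF h(1) z])
      finally show ?thesis by (simp add: 2)
    qed
    have "radial_deriv (\<lambda>z. h z ^ a) z * (\<phi> z ^ Suc k * f z) = (radial_deriv (\<lambda>z. h z ^ a) z * \<phi> z) * (\<phi> z ^ k * f z)"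
      by simp
    then show ?thesis unfolding 1 3 F_def G_def 4 by (simp add: algebra_simps)
  qed
  have "radial_deriv (\<lambda>z. h z ^ a * (\<phi> z ^ Suc k * f z)) \<in> besov_space \<mu> \<sigma> k"
    by (rule besov_cong[OF RF[symmetric] F])
  moreover have "holomorphic_ball (\<lambda>z. h z ^ a * (\<phi> z ^ Suc k * f z))"
    by (intro holomorphic_ball_mult holomorphic_ball_power h h\<phi> hf)
  ultimately show ?case unfolding besov_Suc_iff by blast
qed

lemma besov_mult_power: "\<phi> \<in> besov_mult \<mu> \<sigma> k \<Longrightarrow> (\<lambda>z. \<phi> z ^ n) \<in> besov_mult \<mu> \<sigma> k"
proof (induction n)
  case (Suc n)
  then show ?case unfolding besov_mult_def by (auto simp: mult.assoc)
qed (simp add: besov_mult_def)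

end

section \<open>The radical of a multiplier\<close>

theorem corollary3p4:
  fixes N :: nat
    and \<mu> :: "real measure"
    and \<sigma> :: "(complex ^ 'd) measure"
    and \<phi> \<psi> :: "complex ^ 'd \<Rightarrow> complex"
  assumes "N \<ge> 1"
    and "rotation_invariant_sphere_measure \<sigma>"
    and "admissible_radial_part \<mu>"
    and "\<phi> \<in> besov_mult \<mu> \<sigma> N"
    and "\<psi> \<in> besov_mult \<mu> \<sigma> N"
    and "\<exists>z\<in>ball 0 1. \<psi> z \<noteq> 0"
  shows "\<phi> \<in> besov_rad \<mu> \<sigma> N \<psi> \<longleftrightarrow>
    (\<exists>n::nat. n \<ge> 1 \<and>
      (\<exists>h. bounded_holomorphic_ball h \<and> (\<forall>z\<in>ball 0 1. \<phi> z ^ n = h z * \<psi> z)))"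
proof -
  interpret radial_besov \<sigma> \<mu>
    using assms(2,3) by unfold_locales
  show ?thesis
  proof
    assume "\<phi> \<in> besov_rad \<mu> \<sigma> N \<psi>"
    then obtain u n where u: "u \<in> besov_mult \<mu> \<sigma> N" "n \<ge> 1" "\<And>z. z \<in> ball 0 1 \<Longrightarrow> \<phi> z ^ n = u z * \<psi> z"
      unfolding besov_rad_def by blast
    obtain B where "\<And>z. z \<in> ball 0 1 \<Longrightarrow> cmod (u z) \<le> B" using besov_mult_bounded[OF u(1)] by blast
    then have "bounded (u ` ball 0 1)" by (auto simp: bounded_iff intro!: exI[of _ B])
    then have "bounded_holomorphic_ball u"
      by (simp add: bounded_holomorphic_ball_def besov_mult_holomorphic[OF u(1)])
    then show "\<exists>n\<ge>1. \<exists>h. bounded_holomorphic_ball h \<and> (\<forall>z\<in>ball 0 1. \<phi> z ^ n = h z * \<psi> z)"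
      using u(2,3) by (intro exI[of _ n] conjI exI[of _ u]) auto
  next
    assume "\<exists>n\<ge>1. \<exists>h. bounded_holomorphic_ball h \<and> (\<forall>z\<in>ball 0 1. \<phi> z ^ n = h z * \<psi> z)"
    then obtain n h where n: "n \<ge> 1" and h: "bounded_holomorphic_ball h"
      and eq: "\<And>z. z \<in> ball 0 1 \<Longrightarrow> \<phi> z ^ n = h z * \<psi> z" by blast
    obtain B where B: "\<And>z. z \<in> ball 0 1 \<Longrightarrow> cmod (h z) \<le> B" and hh: "holomorphic_ball h"
      using h unfolding bounded_holomorphic_ball_def bounded_iff by blast
    \<comment> \<open>\<open>N\<close> factors \<open>\<phi>\<^sup>n\<close>, one for each derivative that may fall on \<open>h\<close>\<close>
    define u where "u z = h z * (\<phi> z ^ n) ^ N" for z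
    have "u \<in> besov_mult \<mu> \<sigma> N"
      unfolding besov_mult_def
    proof (intro CollectI ballI)
      fix f assume "f \<in> besov_space \<mu> \<sigma> N"
      from besov_quotient_power_mult[of N "\<lambda>z. \<phi> z ^ n" \<psi> h B N f 1,
          OF besov_mult_power[OF besov_mult_antimono[OF assms(4)]] besov_mult_antimono[OF assms(5)] hh B eq order_refl this]
      show "(\<lambda>z. u z * f z) \<in> besov_space \<mu> \<sigma> N" by (simp add: u_def mult.assoc)
    qed
    moreover have "n * Suc N \<ge> 1" using n by simp
    moreover have "\<phi> z ^ (n * Suc N) = u z * \<psi> z" if "z \<in> ball 0 1" for z
    proof -
      have "\<phi> z ^ (n * Suc N) = (\<phi> z ^ n) ^ N * \<phi> z ^ n" by (simp only: power_mult power_Suc2)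
      also have "\<dots> = (\<phi> z ^ n) ^ N * (h z * \<psi> z)"
        using eq[OF that] by (rule arg_cong)
      finally show ?thesis by (simp only: u_def mult_ac)
    qed
    ultimately show "\<phi> \<in> besov_rad \<mu> \<sigma> N \<psi>"
      unfolding besov_rad_def using assms(4) by (intro CollectI conjI bexI[of _ u] exI[of _ "n * Suc N"]) auto
  qed
qed

end
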